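(* Let $\widetilde H^1=\{v\in H^1(\mathbb{R}):v(0)=0\}$ and let $L$ be the linear operator $Lv=(1-\phi^2)v'+\phi\phi' v$ on $\widetilde H^1$, where $\phi(\xi)=e^{-|\xi|}$, with domain $\mathrm{Dom}(L)=\{v\in\widetilde H^1:(1-\phi^2)v'\in\widetilde H^1\}$. The spectrum of $L$ is $$\sigma(L)=\{\lambda\in\mathbb{C}:\operatorname{Re}\lambda=0\},$$ and it consists of continuous spectrum only (i.e. $\sigma_{\rm p}(L)=\sigma_{\rm r}(L)=\emptyset$ and $\sigma_{\rm c}(L)=i\mathbb{R}$).
   Context: All function spaces consist of complex-valued functions on $\mathbb{R}$ (variable $\xi$); $\widetilde H^1$ carries the $H^1(\mathbb{R})$ norm; $\phi'(\xi)=-\operatorname{sgn}(\xi)e^{-|\xi|}$ for $\xi\ne0$. For a closed linear operator $A$ on a Banach space $X$ with domain $\mathrm{Dom}(A)\subset X$: the spectrum $\sigma(A)$ is the set of $\lambda\in\mathbb{C}$ such that $A-\lambda I:\mathrm{Dom}(A)\to X$ is not a bijection; the point spectrum is $\sigma_{\rm p}(A)=\{\lambda:\ker(A-\lambda I)\ne\{0\}\}$; the residual spectrum is $\sigma_{\rm r}(A)=\{\lambda:\ker(A-\lambda I)=\{0\},\ \overline{\mathrm{Ran}(A-\lambda I)}\neq X\}$; the continuous spectrum is $\sigma_{\rm c}(A)=\{\lambda:\ker(A-\lambda I)=\{0\},\ \overline{\mathrm{Ran}(A-\lambda I)}=X,\ \mathrm{Ran}(A-\lambda I)\ne X\}$.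 *)

theory Defs
  imports "HOL-Analysis.Analysis"
begin

section \<open>The Sobolev space on the line\<close>

definition vderiv :: "(real \<Rightarrow> complex) \<Rightarrow> real \<Rightarrow> complex" where
  "vderiv f = (\<lambda>x. vector_derivative f (at x))"

definition test_function :: "(real \<Rightarrow> complex) \<Rightarrow> bool" where
  "test_function \<psi> \<longleftrightarrow>
     (\<forall>n x. (vderiv ^^ n) \<psi> differentiable (at x)) \<and> (\<exists>R. \<forall>x. \<bar>x\<bar> > R \<longrightarrow> \<psi> x = 0)"

definition L2 :: "(real \<Rightarrow> complex) set" where
  "L2 = {f \<in> borel_measurable lborel. integrable lborel (\<lambda>x. (cmod (f x))\<^sup>2)}"

definition is_weak_derivative :: "(real \<Rightarrow> complex) \<Rightarrow> (real \<Rightarrow> complex) \<Rightarrow> bool" where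
  "is_weak_derivative v g \<longleftrightarrow>
     (\<forall>\<psi>. test_function \<psi> \<longrightarrow>
        (LINT x|lborel. v x * vderiv \<psi> x) = - (LINT x|lborel. g x * \<psi> x))"

text \<open>A class in \<open>H\<^sup>1(\<real>)\<close> is represented by its unique continuous member, so that
  point values and equality of functions have their usual meaning.\<close>

definition H1 :: "(real \<Rightarrow> complex) set" where
  "H1 = {v. continuous_on UNIV v \<and> v \<in> L2 \<and> (\<exists>g\<in>L2. is_weak_derivative v g)}"

text \<open>The choice only fixes a representative: weak derivatives are unique almost everywhere.\<close>

definition weak_deriv :: "(real \<Rightarrow> complex) \<Rightarrow> real \<Rightarrow> complex" where
  "weak_deriv v = (SOME g. g \<in> L2 \<and> is_weak_derivative v g)"

definition H1_norm :: "(real \<Rightarrow> complex) \<Rightarrow> real" where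
  "H1_norm v = sqrt ((LINT x|lborel. (cmod (v x))\<^sup>2) + (LINT x|lborel. (cmod (weak_deriv v x))\<^sup>2))"

definition H1_tilde :: "(real \<Rightarrow> complex) set" where
  "H1_tilde = {v \<in> H1. v 0 = 0}"

section \<open>The operator\<close>

definition phi :: "real \<Rightarrow> real" where
  "phi \<xi> = exp (- \<bar>\<xi>\<bar>)"

text \<open>The value at \<open>0\<close> (here \<open>0\<close>) is immaterial, since the operator is given up to null sets.\<close>

definition phi' :: "real \<Rightarrow> real" where
  "phi' \<xi> = - sgn \<xi> * exp (- \<bar>\<xi>\<bar>)"

definition continuous_rep :: "(real \<Rightarrow> complex) \<Rightarrow> real \<Rightarrow> complex" where
  "continuous_rep f = (THE g. continuous_on UNIV g \<and> (AE x in lborel. g x = f x))"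

text \<open>\<open>v'\<close> is only defined almost everywhere, so membership of \<open>(1 - \<phi>\<^sup>2) v'\<close> in the space
  means that its class contains an element of \<open>H1_tilde\<close>.\<close>

definition Dom_L :: "(real \<Rightarrow> complex) set" where
  "Dom_L = {v \<in> H1_tilde. \<exists>w\<in>H1_tilde.
     AE \<xi> in lborel. w \<xi> = of_real (1 - (phi \<xi>)\<^sup>2) * weak_deriv v \<xi>}"

definition L_op :: "(real \<Rightarrow> complex) \<Rightarrow> real \<Rightarrow> complex" where
  "L_op v = continuous_rep (\<lambda>\<xi>. of_real (1 - (phi \<xi>)\<^sup>2) * weak_deriv v \<xi>
                               + of_real (phi \<xi> * phi' \<xi>) * v \<xi>)"

section \<open>Spectra\<close>

text \<open>Below \<open>X\<close> is a complex vector space of functions with norm \<open>N\<close>, and \<open>A\<close> is an operator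
  in \<open>X\<close> with domain \<open>D\<close>; values of \<open>A\<close> off \<open>D\<close> are irrelevant.\<close>

definition shifted :: "(('a \<Rightarrow> complex) \<Rightarrow> 'a \<Rightarrow> complex) \<Rightarrow> complex \<Rightarrow> ('a \<Rightarrow> complex) \<Rightarrow> 'a \<Rightarrow> complex" where
  "shifted A \<mu> v = (\<lambda>x. A v x - \<mu> * v x)"

definition kernel_on :: "('a \<Rightarrow> complex) set \<Rightarrow> (('a \<Rightarrow> complex) \<Rightarrow> 'a \<Rightarrow> complex) \<Rightarrow> ('a \<Rightarrow> complex) set" where
  "kernel_on D T = {v \<in> D. T v = (\<lambda>_. 0)}"

definition closure_in :: "('a \<Rightarrow> complex) set \<Rightarrow> (('a \<Rightarrow> complex) \<Rightarrow> real) \<Rightarrow> ('a \<Rightarrow> complex) set \<Rightarrow> ('a \<Rightarrow> complex) set" where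
  "closure_in X N S = {u \<in> X. \<forall>\<epsilon>>0. \<exists>s\<in>S. N (\<lambda>x. u x - s x) < \<epsilon>}"

definition spectrum :: "('a \<Rightarrow> complex) set \<Rightarrow> ('a \<Rightarrow> complex) set \<Rightarrow> (('a \<Rightarrow> complex) \<Rightarrow> 'a \<Rightarrow> complex) \<Rightarrow> complex set" where
  "spectrum X D A = {\<mu>. \<not> bij_betw (shifted A \<mu>) D X}"

definition point_spectrum :: "('a \<Rightarrow> complex) set \<Rightarrow> (('a \<Rightarrow> complex) \<Rightarrow> 'a \<Rightarrow> complex) \<Rightarrow> complex set" where
  "point_spectrum D A = {\<mu>. kernel_on D (shifted A \<mu>) \<noteq> {\<lambda>_. 0}}"

definition residual_spectrum :: "('a \<Rightarrow> complex) set \<Rightarrow> (('a \<Rightarrow> complex) \<Rightarrow> real) \<Rightarrow> ('a \<Rightarrow> complex) set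
    \<Rightarrow> (('a \<Rightarrow> complex) \<Rightarrow> 'a \<Rightarrow> complex) \<Rightarrow> complex set" where
  "residual_spectrum X N D A = {\<mu>. kernel_on D (shifted A \<mu>) = {\<lambda>_. 0} \<and>
     closure_in X N (shifted A \<mu> ` D) \<noteq> X}"

definition continuous_spectrum :: "('a \<Rightarrow> complex) set \<Rightarrow> (('a \<Rightarrow> complex) \<Rightarrow> real) \<Rightarrow> ('a \<Rightarrow> complex) set
    \<Rightarrow> (('a \<Rightarrow> complex) \<Rightarrow> 'a \<Rightarrow> complex) \<Rightarrow> complex set" where
  "continuous_spectrum X N D A = {\<mu>. kernel_on D (shifted A \<mu>) = {\<lambda>_. 0} \<and>
     closure_in X N (shifted A \<mu> ` D) = X \<and> shifted A \<mu> ` D \<noteq> X}"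

end

theory Submission
  imports Defs
begin

text \<open>On either half-line write \<open>v = \<surd>(1 - \<phi>\<^sup>2) u\<close> and let \<open>dy = dx / (1 - \<phi>\<^sup>2)\<close>. Since \<open>(1 - \<phi>\<^sup>2)' = - 2 \<phi> \<phi>'\<close>,
  the operator becomes \<open>d/dy\<close> on the whole line, and by the Hardy inequality (applicable because \<open>v 0 = 0\<close>)
  the \<open>H\<^sup>1\<close> norm of \<open>v\<close> controls the \<open>L\<^sup>2(dy)\<close> norm of \<open>u\<close>, which is the \<open>L\<^sup>2(dx)\<close> norm of \<open>r = v / (1 - \<phi>\<^sup>2)\<close>.
  If \<open>L v - \<mu> v = f\<close> and \<open>F = f / (1 - \<phi>\<^sup>2)\<close>, then \<open>M = |v|\<^sup>2 / (1 - \<phi>\<^sup>2) = |u|\<^sup>2\<close> satisfies the energy identity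
  \<open>M' = 2 Re (F r\<^sup>*) + 2 Re \<mu> |r|\<^sup>2\<close> and vanishes at \<open>0\<close> and at infinity. Hence the kernel is trivial for every \<open>\<mu>\<close>, and
  for \<open>Re \<mu> \<noteq> 0\<close> the bounded solution of \<open>u' = \<mu> u + h\<close> yields a preimage of \<open>f\<close>.
  For \<open>Re \<mu> = 0\<close> the range is dense because \<open>(L - \<mu>) v = f + \<epsilon> v\<close> when \<open>(L - \<mu> - \<epsilon>) v = f\<close>, and \<open>\<epsilon> v\<close> tends to \<open>0\<close>;
  it is not everything because for a suitable \<open>f\<close> the real part of \<open>u exp (- \<mu> y)\<close> would be strictly increasing
  in \<open>y\<close> with limit \<open>0\<close> at both ends.\<close>

subsection \<open>Smooth cut-offs\<close>

text \<open>The coefficient \<open>wt\<close> = 1 - phi^2 vanishes at 0, so the origin is at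
  infinite y-distance from either side: the half-lines decouple, no matching condition arises, and
  two solutions are joined at 0 by continuity alone. Membership in the domain then hinges on r = v /
  \<open>wt\<close> being square-integrable, since v = \<open>wt\<close> r and v' = F + (mu -
  \<open>kap\<close>) r. The bounded solution supplies only |v|^2 \<le> B \<open>wt\<close>; a local
  form of the energy identity, on intervals that avoid 0, upgrades this to r in L2. For density, the
  energy identity with Re mu = eps shows that eps r is bounded in L2, not that it is small.
  Smallness comes from a bound on sup M whose constant does not involve mu: it gives pointwise decay
  of order sqrt eps, which absorption and dominated convergence turn into L2 decay. Explicit smooth
  plateaus are built because weak derivatives are given only through smooth tests, while every
  estimate needs v b - v a as an integral of the weak derivative.\<close>

definition bump :: "real poly \<Rightarrow> nat \<Rightarrow> real \<Rightarrow> real" where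
  "bump p k x = (if 0 < x \<and> x < 1
     then poly p x / (x * (1 - x)) ^ k * exp (- 1 / (x * (1 - x))) else 0)"

text \<open>With q = x (1 - x) given by \<open>[:0, 1, -1:]\<close> and q' by
  \<open>[:1, -2:]\<close>, this is the numerator p' q^2 - k p q' q + p q' that the quotient rule
  yields over q^(k+2). The functions \<open>bump p k\<close> thus form a family closed under
  differentiation that contains the standard bump exp (-1/q).\<close>

definition bump_step :: "real poly \<Rightarrow> nat \<Rightarrow> real poly" where
  "bump_step p k = pderiv p * [:0, 1, -1:]^2 - smult (real k) (p * [:1, -2:] * [:0, 1, -1:])
     + p * [:1, -2:]"

text \<open>A single term of the exponential series of 1/q, the one of index k + 2, already bounds
  exp (1/q) from below.\<close>

lemma exp_minus_inverse_le:
  fixes q :: real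
  assumes "q > 0"
  shows "exp (- 1 / q) / q ^ k \<le> fact (k + 2) * q\<^sup>2"
proof -
  have s: "(\<lambda>n. (1/q)^n /\<^sub>R fact n) sums exp (1 / q)"
    by (rule exp_converges)
  have "(\<Sum>n\<in>{k+2}. (1/q)^n /\<^sub>R fact n) \<le> exp (1 / q)"
    unfolding sums_unique[OF s]
    by (rule sum_le_suminf[OF sums_summable[OF s]]) (use assms in auto)
  then have 1: "1 / q ^ (k + 2) \<le> fact (k + 2) * exp (1 / q)"
    using assms by (simp add: power_one_over divide_simps mult_ac del: fact_Suc power_Suc power_add)
  have "exp (- 1 / q) / q ^ k = exp (- 1/q) * q\<^sup>2 * (1 / q ^ (k + 2))"
    using assms by (simp add: field_simps power_add power2_eq_square)
  also have "\<dots> \<le> exp (- 1/q) * q\<^sup>2 * (fact (k + 2) * exp (1 / q))"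
    by (rule mult_left_mono[OF 1]) auto
  also have "\<dots> = (exp (- 1/q) * exp (1/q)) * (fact (k + 2) * q\<^sup>2)"
    by (simp only: ac_simps)
  also have "exp (- 1/q) * exp (1/q) = 1"
    by (simp flip: exp_add)
  finally show ?thesis by simp
qed

text \<open>Quadratic flatness at both endpoints makes the extension by zero differentiable there
  with derivative 0. It follows from the q^2 bound because q \<le> x and q \<le> 1 - x on the unit
  interval.\<close>

lemma bump_quadratic_bound: "\<exists>C. \<forall>x. \<bar>bump p k x\<bar> \<le> C * x\<^sup>2 \<and> \<bar>bump p k x\<bar> \<le> C * (1 - x)\<^sup>2"
proof -
  have "continuous_on {0..1} (poly p)" by (intro continuous_intros)
  then have "bounded (poly p ` {0..1})"
    using compact_continuous_image compact_imp_bounded by blast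
  then obtain B where B: "\<And>x. x \<in> {0..1} \<Longrightarrow> \<bar>poly p x\<bar> \<le> B"
    unfolding bounded_iff by (metis image_eqI real_norm_def)
  then have B0: "B \<ge> 0" by (meson abs_ge_zero atLeastAtMost_iff le_numeral_extra(3) order_trans zero_le_one)
  define C where "C = B * fact (k + 2)"
  have C0: "C \<ge> 0" using B0 by (simp add: C_def)
  have "\<bar>bump p k x\<bar> \<le> C * x\<^sup>2 \<and> \<bar>bump p k x\<bar> \<le> C * (1 - x)\<^sup>2" for x
  proof (cases "0 < x \<and> x < 1")
    case True
    define q where "q = x * (1 - x)"
    have q: "q > 0" "q \<le> x" "q \<le> 1 - x"
      using True by (auto simp: q_def mult_left_le mult_left_le_one_le)
    have "\<bar>bump p k x\<bar> = \<bar>poly p x\<bar> * (exp (- 1/q) / q ^ k)"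
      using True q by (simp add: bump_def abs_mult flip: q_def)
    also have "\<dots> \<le> B * (fact (k+2) * q\<^sup>2)"
      by (rule mult_mono[OF B exp_minus_inverse_le]) (use q True B0 in auto)
    finally have 1: "\<bar>bump p k x\<bar> \<le> C * q\<^sup>2" by (simp add: C_def mult.assoc)
    have "C * q\<^sup>2 \<le> C * x\<^sup>2" "C * q\<^sup>2 \<le> C * (1-x)\<^sup>2"
      using q C0 by (auto intro!: mult_left_mono power_mono)
    with 1 show ?thesis by linarith
  next
    case False
    then have "bump p k x = 0" by (auto simp: bump_def)
    then show ?thesis using C0 by simp
  qed
  then show ?thesis by blast
qed

lemma DERIV_zero_of_quadratic:
  fixes f :: "real \<Rightarrow> real"
  assumes "\<And>x. \<bar>f x\<bar> \<le> C * (x - a)\<^sup>2"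
  shows "(f has_real_derivative 0) (at a)"
proof -
  have fa: "f a = 0" using assms[of a] by simp
  have "((\<lambda>h. f (a + h) / h) \<longlongrightarrow> 0) (at 0)"
  proof (rule Lim_null_comparison)
    show "\<forall>\<^sub>F h in at 0. norm (f (a + h) / h) \<le> C * \<bar>h\<bar>"
    proof (intro always_eventually allI)
      fix h :: real
      have "C \<ge> 0 \<or> h = 0" using assms[of "a + h"] 
        by (smt (verit, ccfv_SIG) add_diff_cancel_left' mult_neg_pos zero_less_power2)
      then show "norm (f (a + h) / h) \<le> C * \<bar>h\<bar>"
        using assms[of "a + h"]
        by (auto simp: divide_simps abs_mult power2_eq_square split: if_splits)
    qed
    show "((\<lambda>h. C * \<bar>h\<bar>) \<longlongrightarrow> 0) (at 0)" by (auto intro!: tendsto_eq_intros)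
  qed
  then show ?thesis by (simp add: DERIV_def fa)
qed

text \<open>Outside the unit interval the function is locally zero, at 0 and 1 the quadratic bound
  decides, and inside the quotient rule produces exactly \<open>bump_step\<close>.\<close>

lemma bump_DERIV: "(bump p k has_real_derivative bump (bump_step p k) (k + 2) x) (at x)"
proof -
  obtain C where C: "\<And>x. \<bar>bump p k x\<bar> \<le> C * x\<^sup>2" "\<And>x. \<bar>bump p k x\<bar> \<le> C * (1 - x)\<^sup>2"
    using bump_quadratic_bound by metis
  consider "x < 0 \<or> x > 1" | "x = 0" | "x = 1" | "0 < x" "x < 1" by linarith
  then show ?thesis
  proof cases
    case 1
    then have "x \<in> {..<0} \<union> {1<..}" by auto
    moreover have "open ({..<0::real} \<union> {1<..})" by auto
    ultimately have "eventually (\<lambda>y. y \<in> {..<0} \<union> {1<..}) (nhds x)"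
      by (rule eventually_nhds_in_open[rotated])
    then have "eventually (\<lambda>y. bump p k y = 0) (nhds x)"
      by eventually_elim (auto simp: bump_def)
    then have "(bump p k has_real_derivative 0) (at x)"
      by (subst DERIV_cong_ev[OF refl _ refl]) auto
    then show ?thesis using 1 by (auto simp: bump_def)
  next
    case 2
    then show ?thesis using DERIV_zero_of_quadratic[of "bump p k" C 0] C by (simp add: bump_def)
  next
    case 3
    then show ?thesis using DERIV_zero_of_quadratic[of "bump p k" C 1] C
      by (simp add: bump_def power2_commute)
  next
    case 4
    have "eventually (\<lambda>y. y \<in> {0<..<1}) (nhds x)"
      using 4 by (intro eventually_nhds_in_open) auto
    then have ev: "eventually (\<lambda>y. bump p k y = poly p y / (y * (1 - y)) ^ k * exp (- 1 / (y * (1 - y)))) (nhds x)"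
      by eventually_elim (auto simp: bump_def)
    define q where "q = x * (1 - x)"
    have q: "q > 0" using 4 by (simp add: q_def)
    have pq: "poly [:0, 1, -1:] x = q" by (simp add: q_def algebra_simps)
    have dq: "((\<lambda>y. y * (1 - y)) has_real_derivative (1 - 2 * x)) (at x)"
      by (auto intro!: derivative_eq_intros)
    have d1: "((\<lambda>y. (y * (1 - y)) ^ k) has_real_derivative real k * (1 - 2*x) * q ^ (k - 1)) (at x)"
      using DERIV_power[OF dq, of k] by (simp add: q_def mult_ac)
    have d2: "((\<lambda>y. exp (- 1 / (y * (1 - y)))) has_real_derivative exp (- 1 / q) * ((1 - 2 * x) / q\<^sup>2)) (at x)"
    proof -
      have "((\<lambda>y. - 1 / (y * (1 - y))) has_real_derivative (1 - 2 * x) / q\<^sup>2) (at x)"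
        using DERIV_divide[OF DERIV_const[of "- 1"] dq] 4 by (simp add: q_def power2_eq_square)
      from DERIV_fun_exp[OF this] show ?thesis by (simp add: q_def)
    qed
    have "((\<lambda>y. poly p y / (y * (1 - y)) ^ k * exp (- 1 / (y * (1 - y)))) has_real_derivative
        ((poly (pderiv p) x * q ^ k - poly p x * (real k * (1 - 2*x) * q ^ (k - 1))) / (q ^ k * q ^ k)) * exp (- 1/q)
        + (exp (- 1 / q) * ((1 - 2 * x) / q\<^sup>2)) * (poly p x / q ^ k)) (at x)"
      using DERIV_mult[OF DERIV_divide[OF poly_DERIV d1] d2] 4 by (simp add: q_def)
    also have "((poly (pderiv p) x * q ^ k - poly p x * (real k * (1 - 2*x) * q ^ (k - 1))) / (q ^ k * q ^ k)) * exp (- 1/q)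
        + (exp (- 1 / q) * ((1 - 2 * x) / q\<^sup>2)) * (poly p x / q ^ k)
        = poly (bump_step p k) x / q ^ (k + 2) * exp (- 1 / q)"
    proof -
      have st: "poly (bump_step p k) x = poly (pderiv p) x * q\<^sup>2 - real k * (poly p x * (1 - 2*x) * q) + poly p x * (1 - 2*x)"
        unfolding bump_step_def poly_add poly_diff poly_mult poly_smult poly_power pq
        by (simp add: mult.commute)
      have "real k * q ^ (k - 1) * q = real k * q ^ k" by (cases k) auto
      then have k: "real k * q ^ (k - 1) = real k * q ^ k / q" using q by (simp add: field_simps)
      have e: "(poly (pderiv p) x * q ^ k - poly p x * (real k * (1 - 2*x) * q ^ (k - 1))) / (q ^ k * q ^ k)
         = (poly (pderiv p) x * q\<^sup>2 - real k * (poly p x * (1 - 2*x) * q)) / q ^ (k + 2)" (is "?L = ?R")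
      proof -
        have "poly p x * (real k * (1 - 2*x) * q ^ (k - 1)) = poly p x * (1 - 2*x) * (real k * q ^ k / q)"
          unfolding k[symmetric] by simp
        then have "?L = (poly (pderiv p) x * q ^ k - poly p x * (1 - 2*x) * (real k * q ^ k / q)) / (q ^ k * q ^ k)"
          by simp
        also have "\<dots> = ?R"
          using q unfolding power_add by (simp add: divide_simps power2_eq_square) (simp add: algebra_simps)
        finally show ?thesis .
      qed
      show ?thesis unfolding e st using q by (simp add: field_simps power_add power2_eq_square)
    qed
    finally show ?thesis
      using 4 by (subst DERIV_cong_ev[OF refl ev refl]) (simp add: bump_def flip: q_def)
  qed
qed

lemma bump_smult: "c * bump p k x = bump (smult c p) k x"
  by (simp add: bump_def)

text \<open>Smoothness is reduced to exhibiting a class \<open>P\<close> of differentiable functions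
  that is stable under \<open>vderiv\<close>, so no formula for the n-th derivative is
  required.\<close>

lemma iterated_vderiv_differentiable:
  assumes "P f" and step: "\<And>f. P f \<Longrightarrow> (\<forall>x. f differentiable (at x)) \<and> P (vderiv f)"
  shows "(vderiv ^^ n) f differentiable (at x)"
proof -
  have "P ((vderiv ^^ n) f)" by (induction n) (use assms in auto)
  then show ?thesis using step by blast
qed

lemma continuous_on_bump: "continuous_on A (bump p k)"
  using bump_DERIV DERIV_isCont continuous_at_imp_continuous_on by blast

text \<open>A smooth transition from 0 to 1 on the unit interval. Starting the integral at -1, where
  the integrand still vanishes, keeps x = 0 in the interior of the integration range, so the
  fundamental theorem gives a two-sided derivative there.\<close>

definition step :: "real \<Rightarrow> real" where
  "step x = integral {-1..x} (bump 1 0) / integral {-1..1} (bump 1 0)"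

lemma bump_integral_pos: "integral {-1..1} (bump 1 0) > 0"
proof -
  have "integral {-1..1} (bump 1 0) \<ge> 0"
    by (rule integral_nonneg) (auto intro: integrable_continuous_real continuous_on_bump simp: bump_def)
  moreover have "integral {-1..1} (bump 1 0) \<noteq> 0"
  proof
    assume "integral {-1..1} (bump 1 0) = 0"
    then have "\<forall>x\<in>{-1..1}. bump 1 0 x = 0"
      using integral_eq_0_iff[OF continuous_on_bump[of "{-1..1}" 1 0]] by (simp add: bump_def)
    from bspec[OF this, of "1/2"] show False by (simp add: bump_def)
  qed
  ultimately show ?thesis by simp
qed

lemma step_le_0: "x \<le> 0 \<Longrightarrow> step x = 0"
proof -
  assume "x \<le> 0"
  then have "integral {-1..x} (bump 1 0) = integral {-1..x} (\<lambda>_. 0)"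
    by (intro integral_cong) (auto simp: bump_def)
  then show ?thesis by (simp add: step_def)
qed

lemma step_ge_1: "x \<ge> 1 \<Longrightarrow> step x = 1"
proof -
  assume x: "x \<ge> 1"
  have "integral {-1..x} (bump 1 0) = integral {-1..1} (bump 1 0) + integral {1..x} (bump 1 0)"
    by (rule Henstock_Kurzweil_Integration.integral_combine[symmetric])
       (use x in \<open>auto intro: integrable_continuous_real continuous_on_bump\<close>)
  also have "integral {1..x} (bump 1 0) = integral {1..x} (\<lambda>_. 0)"
    by (intro integral_cong) (auto simp: bump_def)
  finally show ?thesis using bump_integral_pos by (simp add: step_def)
qed

text \<open>The normalising constant as a polynomial, so that the derivative of \<open>step\<close>
  is again a member of the \<open>bump\<close> family and a probability density on the unit
  interval.\<close>

definition step_poly :: "real poly" where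
  "step_poly = smult (1 / integral {-1..1} (bump 1 0)) 1"

lemma step_DERIV: "(step has_real_derivative bump step_poly 0 x) (at x)"
proof (cases "x < 0")
  case True
  have "eventually (\<lambda>y. y \<in> {..<0}) (nhds x)"
    using True by (intro eventually_nhds_in_open) auto
  then have "eventually (\<lambda>y. step y = 0) (nhds x)"
    by eventually_elim (auto simp: step_le_0)
  then have "(step has_real_derivative 0) (at x)"
    by (subst DERIV_cong_ev[OF refl _ refl]) auto
  then show ?thesis using True by (simp add: bump_def)
next
  case False
  have "((\<lambda>u. integral {-1..u} (bump 1 0)) has_real_derivative bump 1 0 x) (at x within {-1..x+1})"
    by (rule integral_has_real_derivative) (use False in \<open>auto simp: continuous_on_bump\<close>)
  moreover have "at x within {-1..x+1} = at x"
    using False by (intro at_within_Icc_at) auto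
  ultimately have "((\<lambda>u. integral {-1..u} (bump 1 0)) has_real_derivative bump 1 0 x) (at x)" by simp
  from DERIV_cdivide[OF this, of "integral {-1..1} (bump 1 0)"] show ?thesis
    unfolding step_def[abs_def] step_poly_def bump_smult[symmetric] by simp
qed

lemma step_mono:
  assumes "x \<le> y"
  shows "step x \<le> step y"
proof (rule DERIV_nonneg_imp_nondecreasing[OF assms])
  fix z show "\<exists>d. (step has_real_derivative d) (at z) \<and> 0 \<le> d"
    using step_DERIV[of z] bump_integral_pos by (intro exI[of _ "bump step_poly 0 z"]) (auto simp: bump_def step_poly_def)
qed

lemma step_bounds: "0 \<le> step x" "step x \<le> 1"
  using step_mono[of "min x 0" x] step_mono[of x "max x 1"] step_le_0[of "min x 0"] step_ge_1[of "max x 1"] by auto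

text \<open>The rise takes place on [a, a + 1/m] and the descent on [b, b + 1/m]; for a \<le> b
  these functions tend to the indicator of the half-open interval (a, b] as m grows.\<close>

definition plateau :: "real \<Rightarrow> real \<Rightarrow> real \<Rightarrow> real \<Rightarrow> complex" where
  "plateau m a b x = of_real (step (m * (x - a)) - step (m * (x - b)))"

lemma vderiv_of_real:
  assumes "\<And>x. (f has_real_derivative f' x) (at x)"
  shows "(\<lambda>x. complex_of_real (f x)) differentiable (at x)" "vderiv (\<lambda>x. complex_of_real (f x)) = (\<lambda>x. of_real (f' x))"
proof -
  have d: "((\<lambda>x. complex_of_real (f x)) has_vector_derivative of_real (f' x)) (at x)" for x
    using assms[of x] by (rule has_vector_derivative_of_real)
  show "(\<lambda>x. complex_of_real (f x)) differentiable (at x)"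
    using d by (rule differentiableI_vector)
  show "vderiv (\<lambda>x. complex_of_real (f x)) = (\<lambda>x. of_real (f' x))"
    using d by (auto simp: vderiv_def vector_derivative_at)
qed

lemma bump_affine_DERIV:
  "((\<lambda>x. bump p k (m * (x - a))) has_real_derivative m * bump (bump_step p k) (k + 2) (m * (x - a))) (at x)"
proof -
  have "((\<lambda>x. m * (x - a)) has_real_derivative m) (at x)"
    by (auto intro!: derivative_eq_intros)
  from DERIV_chain2[OF bump_DERIV this] show ?thesis by (simp add: mult.commute)
qed

lemma step_affine_DERIV:
  "((\<lambda>x. step (m * (x - a))) has_real_derivative m * bump step_poly 0 (m * (x - a))) (at x)"
proof -
  have "((\<lambda>x. m * (x - a)) has_real_derivative m) (at x)"
    by (auto intro!: derivative_eq_intros)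
  from DERIV_chain2[OF step_DERIV this] show ?thesis by (simp add: mult.commute)
qed

lemma plateau_derivative:
  "plateau m a b differentiable (at x)"
  "vderiv (plateau m a b) =
    (\<lambda>x. of_real (m * bump step_poly 0 (m * (x - a)) - m * bump step_poly 0 (m * (x - b))))"
  using vderiv_of_real[OF DERIV_diff[OF step_affine_DERIV[of m a] step_affine_DERIV[of m b]]]
  by (simp_all add: plateau_def[abs_def])

lemma test_function_plateau:
  assumes "m > 0"
  shows "test_function (plateau m a b)"
proof -
  \<comment> \<open>\<open>step\<close> itself does not belong to the \<open>bump\<close> family,
    but its first derivative does. Hence \<open>P\<close> describes only the derivatives of order at
    least one, and order zero is treated separately.\<close>
  define P where "P f \<longleftrightarrow> (\<exists>p q k l. f = (\<lambda>x. complex_of_real (bump p k (m * (x - a)) - bump q l (m * (x - b)))))"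
    for f
  have P: "(\<forall>x. f differentiable (at x)) \<and> P (vderiv f)" if Pf: "P f" for f
  proof -
    obtain p q k l where f: "f = (\<lambda>x. complex_of_real (bump p k (m * (x - a)) - bump q l (m * (x - b))))"
      using Pf unfolding P_def by (elim exE) blast
    note d = vderiv_of_real[OF DERIV_diff[OF bump_affine_DERIV[of p k m a] bump_affine_DERIV[of q l m b]]]
    have "P (vderiv f)"
      unfolding f d(2) bump_smult P_def by blast
    with d(1) show ?thesis by (simp add: f)
  qed
  have P1: "P (vderiv (plateau m a b))"
    unfolding plateau_derivative bump_smult P_def by blast
  have "(vderiv ^^ n) (plateau m a b) differentiable (at x)" for n x
  proof (cases n)
    case (Suc n')
    then show ?thesis
      using iterated_vderiv_differentiable[of P, OF P1 P, of n'] by (simp add: funpow_swap1)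
  qed (simp add: plateau_derivative)
  moreover have "plateau m a b x = 0" if x: "\<bar>x\<bar> > \<bar>a\<bar> + \<bar>b\<bar> + 1 / m" for x
  proof (cases "x < 0")
    case True
    have "1 / m > 0" using assms by simp
    then have "x - a \<le> 0" "x - b \<le> 0" using True x by linarith+
    then show ?thesis using assms by (simp add: plateau_def step_le_0 mult_nonneg_nonpos)
  next
    case False
    then have "x - a \<ge> 1 / m" "x - b \<ge> 1 / m" using x by linarith+
    then have "m * (x - a) \<ge> 1" "m * (x - b) \<ge> 1"
      using assms by (auto simp: field_simps)
    then show ?thesis by (simp add: plateau_def step_ge_1)
  qed
  ultimately show ?thesis unfolding test_function_def by blast
qed

subsection \<open>Weak derivatives on the line\<close>

lemma L2_D: "f \<in> L2 \<Longrightarrow> f \<in> borel_measurable borel" "f \<in> L2 \<Longrightarrow> integrable lborel (\<lambda>x. (cmod (f x))\<^sup>2)"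
  by (auto simp: L2_def)

lemma L2_set_integrable:
  assumes "g \<in> L2"
  shows "set_integrable lborel {a..b} g"
  unfolding set_integrable_def
proof (rule Bochner_Integration.integrable_bound)
  show "integrable lborel (\<lambda>x. indicator {a..b} x + (cmod (g x))\<^sup>2)"
    using L2_D[OF assms] by (intro Bochner_Integration.integrable_add integrable_real_indicator) (auto simp: emeasure_lborel_Icc_eq)
  show "(\<lambda>x. indicat_real {a..b} x *\<^sub>R g x) \<in> borel_measurable lborel"
    using L2_D[OF assms] by measurable
  have "cmod (g x) \<le> 1 + (cmod (g x))\<^sup>2" for x
    using zero_le_power2[of "cmod (g x) - 1/2"] unfolding power2_eq_square by (simp add: algebra_simps)
  then show "AE x in lborel. norm (indicat_real {a..b} x *\<^sub>R g x) \<le> norm (indicator {a..b} x + (cmod (g x))\<^sup>2)"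
    by (auto simp: indicator_def)
qed

lemma bump_step_poly_nonneg: "bump step_poly 0 x \<ge> 0"
  using bump_integral_pos by (auto simp: bump_def step_poly_def)

lemma bump_outside: "x \<notin> {0..1} \<Longrightarrow> bump p k x = 0"
  by (auto simp: bump_def)

lemma bump_borel [measurable]: "bump p k \<in> borel_measurable borel"
  by (rule borel_measurable_continuous_onI[OF continuous_on_bump])

lemma indicator_bump: "(\<lambda>x. indicator {0..1} x *\<^sub>R bump p k x) = bump p k"
  using bump_outside[of _ p k] by (force simp: indicator_def)

lemma integrable_bump: "integrable lborel (bump p k)"
proof -
  have "set_integrable lborel {0..1} (bump p k)"
    by (rule borel_integrable_atLeastAtMost'[OF continuous_on_bump])
  then show ?thesis by (simp only: set_integrable_def indicator_bump)
qed

lemma integral_bump_step_poly: "(LINT x|lborel. bump step_poly 0 x) = 1"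
proof -
  have "(LINT x|lborel. indicator {0..1} x *\<^sub>R bump step_poly 0 x) = step 1 - step 0"
    by (rule integral_FTC_atLeastAtMost)
      (auto simp: continuous_on_bump intro: has_vector_derivative_at_within
         step_DERIV[unfolded has_real_derivative_iff_has_vector_derivative])
  then show ?thesis unfolding indicator_bump by (simp add: step_le_0 step_ge_1)
qed

lemma integrable_continuous_bump:
  assumes v: "continuous_on UNIV v"
  shows "integrable lborel (\<lambda>x. v x * complex_of_real (m * bump p k (m * (x - a))))"
proof (cases "m = 0")
  case False
  have vb: "v \<in> borel_measurable borel" using v by (rule borel_measurable_continuous_onI)
  have i: "integrable lborel (\<lambda>x. v (a + (1/m) * x) * complex_of_real (m * bump p k x))"
  proof -
    have "set_integrable lborel {0..1} (\<lambda>x. v (a + (1/m) * x) * complex_of_real (m * bump p k x))"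
      by (intro borel_integrable_atLeastAtMost' continuous_intros continuous_on_bump
            continuous_on_compose2[OF v]) auto
    moreover have "indicator {0..1} x *\<^sub>R (v (a + (1/m) * x) * complex_of_real (m * bump p k x))
        = v (a + (1/m) * x) * complex_of_real (m * bump p k x)" for x
      using bump_outside[of x p k] by (auto simp: indicator_def)
    ultimately show ?thesis by (simp add: set_integrable_def)
  qed
  show ?thesis
    using lborel_integrable_real_affine_iff[of "1/m" "\<lambda>x. v x * complex_of_real (m * bump p k (m * (x - a)))" a] False i
    by simp
qed simp

text \<open>Substituting x = a + t / (n+1) moves the dependence on n into the argument of
  \<open>v\<close>, and dominated convergence applies. The kernels sit to the right of
  \<open>a\<close>, so a bound of \<open>v\<close> on [a, a + 1] is enough.\<close>

lemma approximate_identity: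
  fixes v :: "real \<Rightarrow> complex"
  assumes v: "continuous_on UNIV v"
  shows "(\<lambda>n. LINT x|lborel. v x * of_real (real (Suc n) * bump step_poly 0 (real (Suc n) * (x - a))))
           \<longlonglongrightarrow> v a"
proof -
  have [measurable]: "v \<in> borel_measurable borel" using v by (rule borel_measurable_continuous_onI)
  have eq: "(LINT x|lborel. v x * of_real (real (Suc n) * bump step_poly 0 (real (Suc n) * (x - a))))
      = (LINT x|lborel. v (a + (1/real (Suc n)) * x) * of_real (bump step_poly 0 x))" for n
  proof -
    have "(LINT x|lborel. v x * of_real (real (Suc n) * bump step_poly 0 (real (Suc n) * (x - a))))
      = \<bar>1/real (Suc n)\<bar> *\<^sub>R (LINT x|lborel. v (a + (1/real (Suc n)) * x) *
           of_real (real (Suc n) * bump step_poly 0 (real (Suc n) * (a + (1/real (Suc n)) * x - a))))"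
      by (rule lborel_integral_real_affine) simp
    also have "\<dots> = (LINT x|lborel. \<bar>1/real (Suc n)\<bar> *\<^sub>R (v (a + (1/real (Suc n)) * x) *
           of_real (real (Suc n) * bump step_poly 0 (real (Suc n) * (a + (1/real (Suc n)) * x - a)))))"
      by (rule integral_scaleR_right[symmetric])
    also have "\<dots> = (LINT x|lborel. v (a + (1/real (Suc n)) * x) * of_real (bump step_poly 0 x))"
    proof (intro Bochner_Integration.integral_cong refl)
      fix x
      have "real (Suc n) * (a + (1/real (Suc n)) * x - a) = x" by (simp add: field_simps del: of_nat_Suc)
      then show "\<bar>1/real (Suc n)\<bar> *\<^sub>R (v (a + (1/real (Suc n)) * x) *
           of_real (real (Suc n) * bump step_poly 0 (real (Suc n) * (a + (1/real (Suc n)) * x - a))))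
           = v (a + (1/real (Suc n)) * x) * of_real (bump step_poly 0 x)"
        by (simp add: scaleR_conv_of_real del: of_nat_Suc)
    qed
    finally show ?thesis .
  qed
  have "compact (v ` {a..a+1})"
    by (rule compact_continuous_image) (use v continuous_on_subset in auto)
  then have "bounded (v ` {a..a+1})" by (rule compact_imp_bounded)
  then obtain B where B: "\<And>x. x \<in> {a..a+1} \<Longrightarrow> cmod (v x) \<le> B"
    unfolding bounded_iff by (metis image_eqI)
  have "(\<lambda>n. LINT x|lborel. v (a + (1/real (Suc n)) * x) * of_real (bump step_poly 0 x))
      \<longlonglongrightarrow> (LINT x|lborel. v a * of_real (bump step_poly 0 x))"
  proof (rule integral_dominated_convergence[where w="\<lambda>x. B * bump step_poly 0 x"])
    show "integrable lborel (\<lambda>x. B * bump step_poly 0 x)" using integrable_bump by simp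
    show "AE x in lborel. (\<lambda>n. v (a + (1/real (Suc n)) * x) * of_real (bump step_poly 0 x))
        \<longlonglongrightarrow> v a * of_real (bump step_poly 0 x)"
    proof (intro always_eventually allI tendsto_mult tendsto_const)
      fix x
      have "(\<lambda>n. 1 / real (Suc n)) \<longlonglongrightarrow> 0" using lim_1_over_n LIMSEQ_Suc by blast
      then have l: "(\<lambda>n. a + (1/real (Suc n)) * x) \<longlonglongrightarrow> a + 0 * x"
        by (intro tendsto_intros)
      have "isCont v a" using v by (simp add: continuous_on_eq_continuous_at)
      then show "(\<lambda>n. v (a + (1/real (Suc n)) * x)) \<longlonglongrightarrow> v a"
        using l by (auto intro: isCont_tendsto_compose)
    qed
    fix n
    show "AE x in lborel. norm (v (a + (1/real (Suc n)) * x) * of_real (bump step_poly 0 x)) \<le> B * bump step_poly 0 x"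
    proof (intro always_eventually allI)
      fix x
      show "norm (v (a + (1/real (Suc n)) * x) * of_real (bump step_poly 0 x)) \<le> B * bump step_poly 0 x"
      proof (cases "x \<in> {0..1}")
        case True
        then have "a + (1/real (Suc n)) * x \<in> {a..a+1}" by (auto simp: field_simps)
        from B[OF this] show ?thesis
          using bump_step_poly_nonneg[of x] by (simp add: norm_mult mult_right_mono)
      qed (simp add: bump_outside)
    qed
  qed measurable
  then show ?thesis unfolding eq using integral_bump_step_poly by simp
qed

text \<open>Testing with smooth plateaus: their derivatives are differences of approximate identities at \<open>a\<close> and \<open>b\<close>,
  and they converge to the indicator of the interval.\<close>

lemma weak_derivative_FTC:
  assumes v: "continuous_on UNIV v" and g: "g \<in> L2" and w: "is_weak_derivative v g" and ab: "a \<le> b"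
  shows "v b - v a = (LINT x:{a..b}|lborel. g x)"
proof -
  note [measurable] = L2_D(1)[OF g]
  define \<psi> where "\<psi> n = plateau (real (Suc n)) a b" for n
  have w': "(LINT x|lborel. v x * vderiv (\<psi> n) x) = - (LINT x|lborel. g x * \<psi> n x)" for n
    using w test_function_plateau[of "real (Suc n)" a b] unfolding is_weak_derivative_def \<psi>_def by simp
  have "(\<lambda>n. LINT x|lborel. v x * vderiv (\<psi> n) x) \<longlonglongrightarrow> v a - v b"
  proof -
    have "(LINT x|lborel. v x * vderiv (\<psi> n) x) =
       (LINT x|lborel. v x * of_real (real (Suc n) * bump step_poly 0 (real (Suc n) * (x - a)))) -
       (LINT x|lborel. v x * of_real (real (Suc n) * bump step_poly 0 (real (Suc n) * (x - b))))" for n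
    proof -
      have e: "v x * vderiv (\<psi> n) x = v x * of_real (real (Suc n) * bump step_poly 0 (real (Suc n) * (x - a)))
          - v x * of_real (real (Suc n) * bump step_poly 0 (real (Suc n) * (x - b)))" for x
        unfolding \<psi>_def plateau_derivative of_real_diff by (rule right_diff_distrib)
      show ?thesis unfolding e
        by (rule Bochner_Integration.integral_diff[OF integrable_continuous_bump[OF v] integrable_continuous_bump[OF v]])
    qed
    then show ?thesis using tendsto_diff[OF approximate_identity[OF v, of a] approximate_identity[OF v, of b]] by simp
  qed
  moreover have "(\<lambda>n. LINT x|lborel. g x * \<psi> n x) \<longlonglongrightarrow> (LINT x:{a..b}|lborel. g x)"
    unfolding set_lebesgue_integral_def
  \<comment> \<open>The plateaus overshoot \<open>b\<close> by 1/(n+1), which is at most 1; hence a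
    common support [a, b + 1].\<close>
  proof (rule integral_dominated_convergence[where w="\<lambda>x. norm (indicator {a..b+1} x *\<^sub>R g x)"])
    show "integrable lborel (\<lambda>x. norm (indicat_real {a..b + 1} x *\<^sub>R g x))"
      using L2_set_integrable[OF g, of a "b+1"] unfolding set_integrable_def by (rule integrable_norm)
    have st: "(\<lambda>n. step (real (Suc n) * (x - c))) \<longlonglongrightarrow> (if x > c then 1 else 0)" for x c
    proof (cases "x > c")
      case True
      obtain N where N: "1 < real N * (x - c)" using True ex_less_of_nat_mult[of "x - c" 1] by auto
      have "eventually (\<lambda>n. step (real (Suc n) * (x - c)) = 1) sequentially"
      proof (rule eventually_sequentiallyI[of N])
        fix n assume "N \<le> n"
        then have "real N * (x - c) \<le> real (Suc n) * (x - c)" using True by (intro mult_right_mono) auto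
        then show "step (real (Suc n) * (x - c)) = 1" using N by (intro step_ge_1) linarith
      qed
      then show ?thesis using True by (simp add: tendsto_eventually)
    next
      case False
      then have "step (real (Suc n) * (x - c)) = 0" for n
        by (intro step_le_0) (simp add: mult_nonneg_nonpos)
      then show ?thesis using False by simp
    qed
    \<comment> \<open>At x = a every plateau is 0 although the indicator is 1, so this point has to
      be left out.\<close>
    show "AE x in lborel. (\<lambda>n. g x * \<psi> n x) \<longlonglongrightarrow> indicator {a..b} x *\<^sub>R g x"
      using AE_lborel_singleton[of a]
    proof eventually_elim
      fix x assume xa: "x \<noteq> a"
      have "(\<lambda>n. \<psi> n x) \<longlonglongrightarrow> of_real ((if x > a then 1 else 0) - (if x > b then 1 else 0))"
        unfolding \<psi>_def plateau_def by (intro tendsto_of_real tendsto_diff st)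
      then have "(\<lambda>n. g x * \<psi> n x) \<longlonglongrightarrow> g x * of_real ((if x > a then 1 else 0) - (if x > b then 1 else 0))"
        by (rule tendsto_mult_left)
      also have "g x * of_real ((if x > a then 1 else 0) - (if x > b then 1 else 0)) = indicator {a..b} x *\<^sub>R g x"
        using xa ab by (auto simp: indicator_def)
      finally show "(\<lambda>n. g x * \<psi> n x) \<longlonglongrightarrow> indicator {a..b} x *\<^sub>R g x" .
    qed
    have \<psi>c: "continuous_on UNIV (\<psi> n)" for n
      unfolding \<psi>_def continuous_on_eq_continuous_within
      by (auto intro: differentiable_imp_continuous_within plateau_derivative(1))
    then have [measurable]: "\<psi> n \<in> borel_measurable borel" for n
      by (rule borel_measurable_continuous_onI)
    show "(\<lambda>x. g x * \<psi> n x) \<in> borel_measurable lborel" for n by measurable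
    show "(\<lambda>x. indicat_real {a..b} x *\<^sub>R g x) \<in> borel_measurable lborel" by measurable
    fix n
    show "AE x in lborel. norm (g x * \<psi> n x) \<le> norm (indicat_real {a..b + 1} x *\<^sub>R g x)"
    proof (intro always_eventually allI)
      fix x
      show "norm (g x * \<psi> n x) \<le> norm (indicat_real {a..b + 1} x *\<^sub>R g x)"
      proof (cases "x \<in> {a..b+1}")
        case True
        have "norm (\<psi> n x) \<le> 1"
          unfolding \<psi>_def plateau_def norm_of_real
          using step_bounds[of "real (Suc n) * (x - a)"] step_bounds[of "real (Suc n) * (x - b)"] by linarith
        then show ?thesis using True by (simp add: norm_mult mult_left_le)
      next
        case False
        then consider "x < a" | "x > b + 1" by force
        then have "\<psi> n x = 0"
        proof cases
          case 1
          then show ?thesis using ab unfolding \<psi>_def plateau_def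
            by (simp add: step_le_0 mult_nonneg_nonpos)
        next
          case 2
          have "1 * 1 \<le> real (Suc n) * (x - a)" "1 * 1 \<le> real (Suc n) * (x - b)"
            by (rule mult_mono; use 2 ab in simp)+
          then show ?thesis unfolding \<psi>_def plateau_def
            by (simp add: step_ge_1)
        qed
        then show ?thesis by simp
      qed
    qed
  qed
  ultimately have "(\<lambda>n. LINT x|lborel. v x * vderiv (\<psi> n) x) \<longlonglongrightarrow> - (LINT x:{a..b}|lborel. g x)"
    unfolding w' by (simp add: tendsto_minus)
  then have "v a - v b = - (LINT x:{a..b}|lborel. g x)"
    using \<open>_ \<longlonglongrightarrow> v a - v b\<close> LIMSEQ_unique by blast
  then show ?thesis by (simp add: algebra_simps)
qed

text \<open>The half-lines are an intersection-stable generator of the Borel sets, so a Dynkin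
  argument carries the vanishing of the integral to all of them. Complements require the integral
  over the whole line to vanish, which follows by letting c tend to infinity.\<close>

lemma AE_eq_0_if_integral_atMost_eq_0:
  fixes f :: "real \<Rightarrow> complex"
  assumes f: "integrable lborel f" and z: "\<And>c. (LINT x:{..c}|lborel. f x) = 0"
  shows "AE x in lborel. f x = 0"
proof (rule sigma_finite_measure.density_zero[OF _ f])
  show "sigma_finite_measure (lborel :: real measure)" by (rule lborel.sigma_finite_measure_axioms)
  have [measurable]: "f \<in> borel_measurable borel" using f by auto
  have UNIV0: "(LINT x|lborel. f x) = 0"
    using tendsto_integral_at_top[OF _ f] z
    by (simp add: set_lebesgue_integral_def tendsto_const_iff LIMSEQ_const_iff)
  have si: "set_integrable lborel A f" if "A \<in> sets borel" for A
    unfolding set_integrable_def using f that by (intro integrable_mult_indicator) auto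
  have Int: "Int_stable (range (\<lambda>c::real. {..c}))" by (auto simp: Int_stable_def)
  have gen: "range (\<lambda>c::real. {..c}) \<subseteq> Pow UNIV" by auto
  fix A :: "real set" assume "A \<in> sets lborel"
  then have "A \<in> sigma_sets UNIV (range (\<lambda>c. {..c}))"
    by (simp add: borel_eq_atMost)
  then show "(LINT x:A|lborel. f x) = 0"
  proof (induction rule: sigma_sets_induct_disjoint[OF Int gen, consumes 1, case_names basic empty compl union])
    case (basic A) then show ?case using z by auto
  next
    case empty then show ?case by (simp add: set_lebesgue_integral_def)
  next
    case (compl A)
    then have A: "A \<in> sets borel" by (simp add: borel_eq_atMost)
    have "(LINT x|lborel. f x) = (LINT x:A \<union> (UNIV - A)|lborel. f x)"
      by (simp add: set_lebesgue_integral_def)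
    also have "\<dots> = (LINT x:A|lborel. f x) + (LINT x:UNIV - A|lborel. f x)"
      by (rule set_integral_Un) (use A si in auto)
    finally show ?case using compl UNIV0 by simp
  next
    case (union A)
    then have A: "A i \<in> sets borel" for i by (auto simp: borel_eq_atMost)
    have "(LINT x:(\<Union>i. A i)|lborel. f x) = (\<Sum>i. LINT x:A i|lborel. f x)"
      by (rule lebesgue_integral_countable_add)
        (use A union si in \<open>auto simp: disjoint_family_on_def\<close>)
    then show ?case using union by simp
  qed
qed

text \<open>Functions in \<open>L2\<close> need not be integrable on the line. The difference is
  therefore truncated to [-n, n], and the countably many null sets are united.\<close>

lemma AE_eq_if_interval_integrals_eq:
  assumes g: "g \<in> L2" "h \<in> L2"
    and eq: "\<And>a b. a \<le> b \<Longrightarrow> (LINT x:{a..b}|lborel. g x) = (LINT x:{a..b}|lborel. h x)"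
  shows "AE x in lborel. g x = h x"
proof -
  have "AE x in lborel. indicator {- real n..real n} x *\<^sub>R (g x - h x) = 0" for n
  proof (rule AE_eq_0_if_integral_atMost_eq_0)
    have si: "set_integrable lborel {a..b} (\<lambda>x. g x - h x)" for a b
      using L2_set_integrable g by (intro set_integral_diff) auto
    from si show "integrable lborel (\<lambda>x. indicat_real {- real n..real n} x *\<^sub>R (g x - h x))"
      by (simp add: set_integrable_def)
    fix c :: real
    have "(LINT x:{..c}|lborel. indicat_real {- real n..real n} x *\<^sub>R (g x - h x))
        = (LINT x:{- real n..min c (real n)}|lborel. g x - h x)"
      unfolding set_lebesgue_integral_def
      by (intro Bochner_Integration.integral_cong) (auto simp: indicator_def)
    also have "\<dots> = 0"
    proof (cases "- real n \<le> min c (real n)")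
      case True
      then show ?thesis using eq[OF True] L2_set_integrable g by (subst set_integral_diff) auto
    qed (simp add: set_lebesgue_integral_def)
    finally show "(LINT x:{..c}|lborel. indicat_real {- real n..real n} x *\<^sub>R (g x - h x)) = 0" .
  qed
  then have "AE x in lborel. \<forall>n. indicator {- real n..real n} x *\<^sub>R (g x - h x) = 0"
    unfolding AE_all_countable by blast
  then show ?thesis
  proof eventually_elim
    fix x assume *: "\<forall>n. indicat_real {- real n..real n} x *\<^sub>R (g x - h x) = 0"
    obtain n where "\<bar>x\<bar> \<le> real n" using real_arch_simple by blast
    then have "x \<in> {- real n..real n}" by auto
    with *[rule_format, of n] show "g x = h x" by simp
  qed
qed

lemma weak_derivative_unique:
  assumes "continuous_on UNIV v" "g \<in> L2" "is_weak_derivative v g" "h \<in> L2" "is_weak_derivative v h"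
  shows "AE x in lborel. g x = h x"
  using weak_derivative_FTC[OF assms(1,2,3)] weak_derivative_FTC[OF assms(1,4,5)] assms(2,4)
  by (intro AE_eq_if_interval_integrals_eq) auto

lemma test_function_D:
  assumes "test_function \<psi>"
  shows "(\<psi> has_vector_derivative vderiv \<psi> x) (at x)" "continuous_on UNIV \<psi>" "continuous_on UNIV (vderiv \<psi>)"
    "\<exists>R>0. \<forall>x. \<bar>x\<bar> > R \<longrightarrow> \<psi> x = 0 \<and> vderiv \<psi> x = 0"
proof -
  have d: "(vderiv ^^ n) \<psi> differentiable (at x)" for n x
    using assms by (simp add: test_function_def)
  have d0: "(\<psi> has_vector_derivative vderiv \<psi> x) (at x)" for x
    using d[of 0] by (simp add: vderiv_def vector_derivative_works)
  show "(\<psi> has_vector_derivative vderiv \<psi> x) (at x)" by (rule d0)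
  show "continuous_on UNIV \<psi>" "continuous_on UNIV (vderiv \<psi>)"
    unfolding continuous_on_eq_continuous_within
    using d[of 0] d[of 1] by (auto intro: differentiable_imp_continuous_within)
  obtain R where R: "\<And>x. \<bar>x\<bar> > R \<Longrightarrow> \<psi> x = 0"
    using assms by (auto simp: test_function_def)
  have "vderiv \<psi> x = 0" if "\<bar>x\<bar> > max R 1" for x
  proof -
    have "open {y. \<bar>y\<bar> > R}" by (intro open_Collect_less continuous_intros)
    then have "((\<lambda>_. 0) has_vector_derivative vderiv \<psi> x) (at x)"
      by (rule has_vector_derivative_transform_within_open[OF d0]) (use R that in auto)
    then show ?thesis using vector_derivative_at vector_derivative_const_at by metis
  qed
  then show "\<exists>R>0. \<forall>x. \<bar>x\<bar> > R \<longrightarrow> \<psi> x = 0 \<and> vderiv \<psi> x = 0"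
    using R by (intro exI[of _ "max R 1"]) auto
qed

lemma integrable_mult_compact_support:
  fixes f q :: "real \<Rightarrow> complex"
  assumes f: "set_integrable lborel {-R..R} f" and q: "continuous_on UNIV q"
    and s: "\<And>x. \<bar>x\<bar> > R \<Longrightarrow> q x = 0"
  shows "integrable lborel (\<lambda>x. f x * q x)"
proof -
  have [measurable]: "q \<in> borel_measurable borel" using q by (rule borel_measurable_continuous_onI)
  have "bounded (q ` {-R..R})"
    by (intro compact_imp_bounded compact_continuous_image) (use q continuous_on_subset in auto)
  then obtain B where B: "\<And>x. x \<in> {-R..R} \<Longrightarrow> cmod (q x) \<le> B"
    unfolding bounded_iff by (metis image_eqI)
  have i: "integrable lborel (\<lambda>x. (indicator {-R..R} x *\<^sub>R f x) * q x)"
  proof (rule Bochner_Integration.integrable_bound)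
    show "integrable lborel (\<lambda>x. B * norm (indicator {-R..R} x *\<^sub>R f x))"
      using f unfolding set_integrable_def by (intro integrable_mult_right integrable_norm)
    show "(\<lambda>x. (indicator {-R..R} x *\<^sub>R f x) * q x) \<in> borel_measurable lborel"
      using f unfolding set_integrable_def by measurable
    show "AE x in lborel. norm ((indicator {-R..R} x *\<^sub>R f x) * q x) \<le> norm (B * norm (indicator {-R..R} x *\<^sub>R f x))"
    proof (intro always_eventually allI)
      fix x
      show "norm ((indicator {-R..R} x *\<^sub>R f x) * q x) \<le> norm (B * norm (indicator {-R..R} x *\<^sub>R f x))"
      proof (cases "x \<in> {-R..R}")
        case True
        then have "cmod (f x) * cmod (q x) \<le> cmod (f x) * \<bar>B\<bar>"
          using B[OF True] by (intro mult_left_mono) auto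
        then show ?thesis using True by (simp add: norm_mult abs_mult mult.commute)
      qed simp
    qed
  qed
  have "(indicator {-R..R} x *\<^sub>R f x) * q x = f x * q x" for x
    using s[of x] by (cases "\<bar>x\<bar> > R") (auto simp: indicator_def abs_le_iff not_less)
  then show ?thesis using i by simp
qed

lemma continuous_set_integrable: "continuous_on UNIV f \<Longrightarrow> set_integrable lborel {a..b} (f :: real \<Rightarrow> complex)"
  by (rule borel_integrable_atLeastAtMost') (rule continuous_on_subset, auto)

lemma weak_derivative_integrable:
  assumes "test_function \<psi>"
  shows "continuous_on UNIV v \<Longrightarrow> integrable lborel (\<lambda>x. v x * vderiv \<psi> x)"
    and "g \<in> L2 \<Longrightarrow> integrable lborel (\<lambda>x. g x * \<psi> x)"
proof -
  obtain R where R: "\<And>x. \<bar>x\<bar> > R \<Longrightarrow> \<psi> x = 0" "\<And>x. \<bar>x\<bar> > R \<Longrightarrow> vderiv \<psi> x = 0"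
    using test_function_D(4)[OF assms] by blast
  show "integrable lborel (\<lambda>x. v x * vderiv \<psi> x)" if "continuous_on UNIV v"
    using integrable_mult_compact_support[OF continuous_set_integrable[OF that] test_function_D(3)[OF assms] R(2)] .
  show "integrable lborel (\<lambda>x. g x * \<psi> x)" if "g \<in> L2"
    using integrable_mult_compact_support[OF L2_set_integrable[OF that] test_function_D(2)[OF assms] R(1)] .
qed

lemma is_weak_derivative_add:
  assumes "continuous_on UNIV u" "g \<in> L2" "is_weak_derivative u g"
    and "continuous_on UNIV v" "h \<in> L2" "is_weak_derivative v h"
  shows "is_weak_derivative (\<lambda>x. u x + v x) (\<lambda>x. g x + h x)"
  unfolding is_weak_derivative_def
proof (intro allI impI)
  fix \<psi> assume t: "test_function \<psi>"
  note i = weak_derivative_integrable[OF t]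
  have "(LINT x|lborel. (u x + v x) * vderiv \<psi> x) = (LINT x|lborel. u x * vderiv \<psi> x) + (LINT x|lborel. v x * vderiv \<psi> x)"
    unfolding distrib_right using assms i by simp
  also have "\<dots> = - ((LINT x|lborel. g x * \<psi> x) + (LINT x|lborel. h x * \<psi> x))"
    using assms t by (simp add: is_weak_derivative_def)
  also have "(LINT x|lborel. g x * \<psi> x) + (LINT x|lborel. h x * \<psi> x) = (LINT x|lborel. (g x + h x) * \<psi> x)"
    unfolding distrib_right using assms i by simp
  finally show "(LINT x|lborel. (u x + v x) * vderiv \<psi> x) = - (LINT x|lborel. (g x + h x) * \<psi> x)" .
qed

lemma is_weak_derivative_cmult:
  assumes "is_weak_derivative v h"
  shows "is_weak_derivative (\<lambda>x. c * v x) (\<lambda>x. c * h x)"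
  using assms unfolding is_weak_derivative_def by (simp add: mult.assoc)

text \<open>The product of \<open>v\<close> and a test function is integrated over an interval
  containing the support. Because \<open>v\<close> is continuous across 0, the exceptional point
  contributes no jump term and the fundamental theorem tolerates it.\<close>

lemma is_weak_derivative_piecewise:
  assumes v: "continuous_on UNIV v" and g: "g \<in> L2"
    and d: "\<And>x. x \<noteq> 0 \<Longrightarrow> (v has_vector_derivative g x) (at x)"
  shows "is_weak_derivative v g"
  unfolding is_weak_derivative_def
proof (intro allI impI)
  fix \<psi> assume t: "test_function \<psi>"
  note i = weak_derivative_integrable(1)[OF t v] weak_derivative_integrable(2)[OF t g]
  obtain R where R: "R > 0" "\<And>x. \<bar>x\<bar> > R \<Longrightarrow> \<psi> x = 0" "\<And>x. \<bar>x\<bar> > R \<Longrightarrow> vderiv \<psi> x = 0"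
    using test_function_D(4)[OF t] by blast
  let ?h = "\<lambda>x. v x * vderiv \<psi> x + g x * \<psi> x"
  \<comment> \<open>The endpoints are at distance R + 1 because the test function is known to vanish
    only for |x| strictly above R.\<close>
  have "(?h has_integral (v (R+1) * \<psi> (R+1) - v (-(R+1)) * \<psi> (-(R+1)))) {-(R+1)..R+1}"
    by (rule fundamental_theorem_of_calculus_interior_strong[of "{0}"])
       (use R test_function_D(1,2)[OF t] v d in
         \<open>auto intro!: has_vector_derivative_mult continuous_intros intro: continuous_on_subset\<close>)
  then have "(?h has_integral 0) {-(R+1)..R+1}" using R by simp
  then have "(?h has_integral 0) UNIV"
    by (rule has_integral_on_superset) (use R in auto)
  moreover have "(?h has_integral (LINT x|lborel. ?h x)) UNIV"
    by (rule has_integral_integral_lborel) (use i in simp)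
  ultimately have "(LINT x|lborel. ?h x) = 0" using has_integral_unique by blast
  then show "(LINT x|lborel. v x * vderiv \<psi> x) = - (LINT x|lborel. g x * \<psi> x)"
    using i by (simp add: eq_neg_iff_add_eq_0)
qed

section \<open>Square-integrable functions: sums, bounded multipliers, products, reflection\<close>

lemma L2_bound:
  assumes f: "integrable lborel f" and "g \<in> borel_measurable borel"
    and "\<And>x. (cmod (g x))\<^sup>2 \<le> f x"
  shows "g \<in> L2"
  unfolding L2_def
proof safe
  show g: "g \<in> borel_measurable lborel" using assms(2) by simp
  show "integrable lborel (\<lambda>x. (cmod (g x))\<^sup>2)"
    by (rule Bochner_Integration.integrable_bound[OF f])
      (use g assms(3) in \<open>auto intro: order_trans[OF _ abs_ge_self]\<close>)
qed

lemma L2_add: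
  assumes "f \<in> L2" "g \<in> L2"
  shows "(\<lambda>x. f x + g x) \<in> L2"
proof (rule L2_bound)
  show "integrable lborel (\<lambda>x. 2 * (cmod (f x))\<^sup>2 + 2 * (cmod (g x))\<^sup>2)"
    using assms L2_D(2) by auto
  show "(\<lambda>x. f x + g x) \<in> borel_measurable borel" using assms L2_D(1) by auto
  show "(cmod (f x + g x))\<^sup>2 \<le> 2 * (cmod (f x))\<^sup>2 + 2 * (cmod (g x))\<^sup>2" for x
  proof -
    have "(cmod (f x + g x))\<^sup>2 \<le> (cmod (f x) + cmod (g x))\<^sup>2"
      by (intro power_mono norm_triangle_ineq) auto
    then show ?thesis using sum_squares_bound[of "cmod (f x)" "cmod (g x)"] by (simp add: power2_sum)
  qed
qed

lemma L2_mult_bounded: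
  assumes "f \<in> L2" "b \<in> borel_measurable borel" "\<And>x. cmod (b x) \<le> B"
  shows "(\<lambda>x. b x * f x) \<in> L2"
proof (rule L2_bound)
  show "integrable lborel (\<lambda>x. B\<^sup>2 * (cmod (f x))\<^sup>2)"
    using assms L2_D(2) by auto
  show "(\<lambda>x. b x * f x) \<in> borel_measurable borel" using assms L2_D(1) by auto
  show "(cmod (b x * f x))\<^sup>2 \<le> B\<^sup>2 * (cmod (f x))\<^sup>2" for x
    unfolding norm_mult power_mult_distrib using assms(3) by (intro mult_right_mono power_mono) auto
qed

lemma L2_cmult: "f \<in> L2 \<Longrightarrow> (\<lambda>x. c * f x) \<in> L2"
  by (rule L2_mult_bounded[of f "\<lambda>_. c" "cmod c"]) auto

lemma L2_product_integrable:
  assumes "f \<in> L2" "g \<in> L2"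
  shows "integrable lborel (\<lambda>x. cmod (f x) * cmod (g x))"
proof (rule Bochner_Integration.integrable_bound)
  show "integrable lborel (\<lambda>x. (cmod (f x))\<^sup>2 + (cmod (g x))\<^sup>2)"
    using assms L2_D(2) by auto
  show "(\<lambda>x. cmod (f x) * cmod (g x)) \<in> borel_measurable lborel"
    using assms[THEN L2_D(1)] by measurable
  have "cmod (f x) * cmod (g x) \<le> (cmod (f x))\<^sup>2 + (cmod (g x))\<^sup>2" for x
    using sum_squares_bound[of "cmod (f x)" "cmod (g x)"] mult_nonneg_nonneg[of "cmod (f x)" "cmod (g x)"]
    by (simp del: mult_nonneg_nonneg)
  then show "AE x in lborel. norm (cmod (f x) * cmod (g x)) \<le> norm ((cmod (f x))\<^sup>2 + (cmod (g x))\<^sup>2)"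
    by simp
qed

lemma L2_reflect:
  assumes "f \<in> L2"
  shows "(\<lambda>x. f (- x)) \<in> L2"
proof -
  note [measurable] = L2_D(1)[OF assms]
  have "integrable lborel (\<lambda>x. (cmod (f (0 + (-1) * x)))\<^sup>2)"
    by (rule lborel_integrable_real_affine[OF L2_D(2)[OF assms]]) simp
  then show ?thesis unfolding L2_def by auto
qed

section \<open>The space \<open>H1_tilde\<close>: access to weak derivatives and membership
  criteria\<close>

lemma H1_tilde_weak_deriv:
  assumes "v \<in> H1_tilde"
  shows "continuous_on UNIV v" "v 0 = 0" "v \<in> L2" "weak_deriv v \<in> L2" "is_weak_derivative v (weak_deriv v)"
proof -
  show "continuous_on UNIV v" "v 0 = 0" "v \<in> L2"
    using assms by (auto simp: H1_tilde_def H1_def)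
  have "\<exists>g. g \<in> L2 \<and> is_weak_derivative v g"
    using assms by (auto simp: H1_tilde_def H1_def)
  from someI_ex[OF this] show "weak_deriv v \<in> L2" "is_weak_derivative v (weak_deriv v)"
    unfolding weak_deriv_def by auto
qed

lemma H1_tildeI:
  assumes "continuous_on UNIV v" "v 0 = 0" "v \<in> L2" "g \<in> L2" "is_weak_derivative v g"
  shows "v \<in> H1_tilde"
  using assms by (auto simp: H1_tilde_def H1_def)

lemma weak_deriv_AE:
  assumes "continuous_on UNIV v" "g \<in> L2" "is_weak_derivative v g"
  shows "AE x in lborel. weak_deriv v x = g x"
proof -
  have "\<exists>g. g \<in> L2 \<and> is_weak_derivative v g"
    using assms by auto
  from someI_ex[OF this] show ?thesis
    unfolding weak_deriv_def using assms by (intro weak_derivative_unique[OF assms(1)]) auto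
qed

lemma H1_tilde_add:
  assumes "u \<in> H1_tilde" "v \<in> H1_tilde"
  shows "(\<lambda>x. u x + v x) \<in> H1_tilde"
  using H1_tilde_weak_deriv[OF assms(1)] H1_tilde_weak_deriv[OF assms(2)]
  by (intro H1_tildeI[OF _ _ _ _ is_weak_derivative_add]) (auto intro: L2_add continuous_intros)

lemma H1_tilde_cmult:
  assumes "v \<in> H1_tilde"
  shows "(\<lambda>x. c * v x) \<in> H1_tilde"
  using H1_tilde_weak_deriv[OF assms]
  by (intro H1_tildeI[OF _ _ _ _ is_weak_derivative_cmult]) (auto intro: L2_cmult continuous_intros)

lemma H1_tilde_piecewise:
  assumes "continuous_on UNIV v" "v 0 = 0" "v \<in> L2" "g \<in> L2"
    and "\<And>x. x \<noteq> 0 \<Longrightarrow> (v has_vector_derivative g x) (at x)"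
  shows "v \<in> H1_tilde"
  by (rule H1_tildeI[OF assms(1-4)]) (rule is_weak_derivative_piecewise[OF assms(1,4,5)])

subsection \<open>The Hardy inequality and the behaviour at zero and at infinity\<close>

lemma integral_Icc_Cauchy_Schwarz:
  assumes g: "g \<in> L2" and ab: "a \<le> b"
  shows "(cmod (LINT x:{a..b}|lborel. g x))\<^sup>2 \<le> (b - a) * (LINT x:{a..b}|lborel. (cmod (g x))\<^sup>2)"
proof -
  note [measurable] = L2_D(1)[OF g]
  let ?I = "indicator {a..b} :: real \<Rightarrow> real"
  have "ennreal (cmod (LINT x:{a..b}|lborel. g x)) \<le> (\<integral>\<^sup>+x. ennreal (cmod (?I x *\<^sub>R g x)) \<partial>lborel)"
    unfolding set_lebesgue_integral_def
    using L2_set_integrable[OF g] by (intro integral_norm_bound_ennreal) (simp add: set_integrable_def)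
  also have "\<dots> = (\<integral>\<^sup>+x. ennreal (?I x) * ennreal (?I x * cmod (g x)) \<partial>lborel)"
    by (intro nn_integral_cong) (auto simp: indicator_def)
  finally have "(ennreal (cmod (LINT x:{a..b}|lborel. g x)))\<^sup>2
     \<le> (\<integral>\<^sup>+x. ennreal (?I x) * ennreal (?I x * cmod (g x)) \<partial>lborel)\<^sup>2"
    by (rule power_mono) simp
  also have "\<dots> \<le> (\<integral>\<^sup>+x. (ennreal (?I x))\<^sup>2 \<partial>lborel) * (\<integral>\<^sup>+x. (ennreal (?I x * cmod (g x)))\<^sup>2 \<partial>lborel)"
    by (rule Cauchy_Schwarz_nn_integral) measurable
  also have "(\<integral>\<^sup>+x. (ennreal (?I x))\<^sup>2 \<partial>lborel) = (\<integral>\<^sup>+x. indicator {a..b} x \<partial>lborel)"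
    by (intro nn_integral_cong) (auto simp: indicator_def)
  also have "\<dots> = ennreal (b - a)" using ab by simp
  also have "(\<integral>\<^sup>+x. (ennreal (?I x * cmod (g x)))\<^sup>2 \<partial>lborel) = (\<integral>\<^sup>+x. ennreal (?I x *\<^sub>R (cmod (g x))\<^sup>2) \<partial>lborel)"
    by (intro nn_integral_cong) (auto simp: indicator_def ennreal_power)
  also have "\<dots> = ennreal (LINT x:{a..b}|lborel. (cmod (g x))\<^sup>2)"
    unfolding set_lebesgue_integral_def
    by (intro nn_integral_eq_integral integrable_mult_indicator L2_D(2)[OF g]) auto
  also have "ennreal (b - a) * \<dots> = ennreal ((b - a) * (LINT x:{a..b}|lborel. (cmod (g x))\<^sup>2))"
    using ab by (subst ennreal_mult) (auto simp: set_lebesgue_integral_def)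
  finally show ?thesis
    using ab by (subst (asm) ennreal_power, simp, subst (asm) ennreal_le_iff)
       (auto simp: set_lebesgue_integral_def)
qed

text \<open>The fundamental theorem detached from test functions, so that the Hardy inequality
  transfers to the reflected function by a mere change of variables.\<close>

definition primitive :: "(real \<Rightarrow> complex) \<Rightarrow> (real \<Rightarrow> complex) \<Rightarrow> bool" where
  "primitive v g \<longleftrightarrow> (\<forall>a b. a \<le> b \<longrightarrow> v b - v a = (LINT x:{a..b}|lborel. g x))"

lemma primitive_reflect:
  assumes "primitive v g"
  shows "primitive (\<lambda>x. v (- x)) (\<lambda>x. - g (- x))"
  unfolding primitive_def
proof (intro allI impI)
  fix a b :: real assume "a \<le> b"
  then have "v (-a) - v (-b) = (LINT x:{-b..-a}|lborel. g x)"
    using assms by (simp add: primitive_def)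
  also have "\<dots> = \<bar>-1\<bar> *\<^sub>R (LINT x|lborel. indicator {-b..-a} (0 + (-1) * x) *\<^sub>R g (0 + (-1) * x))"
    unfolding set_lebesgue_integral_def by (rule lborel_integral_real_affine) simp
  also have "\<dots> = (LINT x:{a..b}|lborel. g (- x))"
    unfolding set_lebesgue_integral_def
    by simp (intro Bochner_Integration.integral_cong, auto simp: indicator_def)
  finally have "v (- b) - v (- a) = - (LINT x:{a..b}|lborel. g (- x))" by (metis minus_diff_eq)
  then show "v (- b) - v (- a) = (LINT x:{a..b}|lborel. - g (- x))"
    by (simp add: set_lebesgue_integral_def)
qed

text \<open>The weight \<open>t powr (1/2)\<close> is chosen so that Tonelli's theorem gives the full inequality.\<close>

lemma Hardy_pointwise:
  assumes g: "g \<in> L2" and v: "primitive v g" "v 0 = 0" and x: "x > 0"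
  shows "(ennreal (cmod (v x)))\<^sup>2 \<le> ennreal (2 * x powr (1/2)) *
    (\<integral>\<^sup>+t. ennreal ((cmod (g t))\<^sup>2 * t powr (1/2)) * indicator {0..x} t \<partial>lborel)"
proof -
  note [measurable] = L2_D(1)[OF g]
  let ?I = "indicator {0..x} :: real \<Rightarrow> real"
  have "v x = (LINT x:{0..x}|lborel. g x)"
    using v x unfolding primitive_def by (metis diff_zero less_imp_le)
  then have "ennreal (cmod (v x)) \<le> (\<integral>\<^sup>+t. ennreal (cmod (?I t *\<^sub>R g t)) \<partial>lborel)"
    unfolding set_lebesgue_integral_def
    using L2_set_integrable[OF g] by (simp only:, intro integral_norm_bound_ennreal) (simp add: set_integrable_def)
  \<comment> \<open>Splitting off t^(-1/4) before Cauchy-Schwarz leaves the integrable square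
    t^(-1/2), whose integral over [0, x] is 2 sqrt x, and puts the weight t^(1/2) on |g|^2.\<close>
  also have "\<dots> = (\<integral>\<^sup>+t. ennreal (?I t * t powr (-1/4)) * ennreal (?I t * t powr (1/4) * cmod (g t)) \<partial>lborel)"
  proof (intro nn_integral_cong_AE, use AE_lborel_singleton[of 0] in eventually_elim)
    fix t :: real assume t: "t \<noteq> 0"
    show "ennreal (cmod (?I t *\<^sub>R g t)) = ennreal (?I t * t powr (-1/4)) * ennreal (?I t * t powr (1/4) * cmod (g t))"
    proof (cases "t \<in> {0..x}")
      case True
      have "t powr (-1/4) * (t powr (1/4) * cmod (g t)) = cmod (g t)"
        using t by (simp flip: mult.assoc powr_add)
      then show ?thesis using True by (simp flip: ennreal_mult)
    qed simp
  qed
  finally have "(ennreal (cmod (v x)))\<^sup>2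
     \<le> (\<integral>\<^sup>+t. ennreal (?I t * t powr (-1/4)) * ennreal (?I t * t powr (1/4) * cmod (g t)) \<partial>lborel)\<^sup>2"
    by (rule power_mono) simp
  also have "\<dots> \<le> (\<integral>\<^sup>+t. (ennreal (?I t * t powr (-1/4)))\<^sup>2 \<partial>lborel)
       * (\<integral>\<^sup>+t. (ennreal (?I t * t powr (1/4) * cmod (g t)))\<^sup>2 \<partial>lborel)"
    by (rule Cauchy_Schwarz_nn_integral) measurable
  also have "(\<integral>\<^sup>+t. (ennreal (?I t * t powr (-1/4)))\<^sup>2 \<partial>lborel)
      = (\<integral>\<^sup>+t. ennreal (t powr (-1/2)) * indicator {0..x} t \<partial>lborel)"
  proof (intro nn_integral_cong)
    fix t :: real
    have "(t powr (-1/4))\<^sup>2 = t powr (-1/2)" unfolding power2_eq_square by (simp flip: powr_add)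
    then show "(ennreal (?I t * t powr (-1/4)))\<^sup>2 = ennreal (t powr (-1/2)) * indicator {0..x} t"
      by (auto simp: indicator_def ennreal_power)
  qed
  also have "\<dots> = ennreal (x powr (-1/2+1) / (-1/2+1))"
    by (intro nn_integral_has_integral_lebesgue' has_integral_powr_from_0) (use x in auto)
  also have "x powr (-1/2+1) / (-1/2+1) = 2 * x powr (1/2)" by simp
  also have "(\<integral>\<^sup>+t. (ennreal (?I t * t powr (1/4) * cmod (g t)))\<^sup>2 \<partial>lborel)
      = (\<integral>\<^sup>+t. ennreal ((cmod (g t))\<^sup>2 * t powr (1/2)) * indicator {0..x} t \<partial>lborel)"
  proof (intro nn_integral_cong)
    fix t :: real
    have "(t powr (1/4))\<^sup>2 = t powr (1/2)" unfolding power2_eq_square by (simp flip: powr_add)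
    then have "(t powr (1/4) * cmod (g t))\<^sup>2 = (cmod (g t))\<^sup>2 * t powr (1/2)" by (simp add: power_mult_distrib)
    then show "(ennreal (?I t * t powr (1/4) * cmod (g t)))\<^sup>2 = ennreal ((cmod (g t))\<^sup>2 * t powr (1/2)) * indicator {0..x} t"
      by (auto simp: indicator_def ennreal_power)
  qed
  finally show ?thesis .
qed

text \<open>Dividing the pointwise bound by x^2 gives the kernel 2 x^(-3/2) t^(1/2) on t \<le> x.
  After exchanging the integrals, the integral over x \<ge> t equals 4 t^(-1/2) and cancels the
  weight; this is the classical constant 4.\<close>

lemma Hardy_halfline:
  assumes g: "g \<in> L2" and v: "primitive v g" "v 0 = 0"
  shows "(\<integral>\<^sup>+x. ennreal ((cmod (v x) / x)\<^sup>2) * indicator {0<..} x \<partial>lborel)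
     \<le> 4 * (\<integral>\<^sup>+x. ennreal ((cmod (g x))\<^sup>2) \<partial>lborel)"
proof -
  note [measurable] = L2_D(1)[OF g]
  let ?k = "\<lambda>x t. ennreal (2 * x powr (-3/2)) * indicator {0<..} x *
       (ennreal ((cmod (g t))\<^sup>2 * t powr (1/2)) * (if 0 \<le> t \<and> t \<le> x then 1 else 0))"
  have "(\<integral>\<^sup>+x. ennreal ((cmod (v x) / x)\<^sup>2) * indicator {0<..} x \<partial>lborel) \<le> (\<integral>\<^sup>+x. (\<integral>\<^sup>+t. ?k x t \<partial>lborel) \<partial>lborel)"
  proof (intro nn_integral_mono)
    fix x :: real
    show "ennreal ((cmod (v x) / x)\<^sup>2) * indicator {0<..} x \<le> (\<integral>\<^sup>+t. ?k x t \<partial>lborel)"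
    proof (cases "x > 0")
      case True
      have "ennreal ((cmod (v x) / x)\<^sup>2) = ennreal (1 / x\<^sup>2) * (ennreal (cmod (v x)))\<^sup>2"
        by (simp add: ennreal_power power_divide flip: ennreal_mult)
      also have "\<dots> \<le> ennreal (1 / x\<^sup>2) * (ennreal (2 * x powr (1/2)) *
           (\<integral>\<^sup>+t. ennreal ((cmod (g t))\<^sup>2 * t powr (1/2)) * indicator {0..x} t \<partial>lborel))"
        by (intro mult_left_mono Hardy_pointwise assms True) simp
      also have "\<dots> = ennreal (1 / x\<^sup>2 * (2 * x powr (1/2))) *
           (\<integral>\<^sup>+t. ennreal ((cmod (g t))\<^sup>2 * t powr (1/2)) * indicator {0..x} t \<partial>lborel)"
        by (subst ennreal_mult) (auto simp: mult.assoc)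
      also have "1 / x\<^sup>2 * (2 * x powr (1/2)) = 2 * x powr (-3/2)"
      proof -
        have "x powr (-3/2) * x powr 2 = x powr (1/2)" by (simp flip: powr_add)
        moreover have "x powr 2 = x\<^sup>2" using True by (simp add: powr_numeral)
        ultimately show ?thesis using True by (simp add: field_simps)
      qed
      also have "ennreal (2 * x powr (-3/2)) * (\<integral>\<^sup>+t. ennreal ((cmod (g t))\<^sup>2 * t powr (1/2)) * indicator {0..x} t \<partial>lborel)
         = (\<integral>\<^sup>+t. ?k x t \<partial>lborel)"
        using True by (subst nn_integral_cmult[symmetric]) (auto intro!: nn_integral_cong simp: indicator_def)
      finally show ?thesis using True by simp
    qed simp
  qed
  also have "\<dots> = (\<integral>\<^sup>+t. (\<integral>\<^sup>+x. ?k x t \<partial>lborel) \<partial>lborel)"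
    by (rule lborel_pair.Fubini'[symmetric]) measurable
  also have "\<dots> \<le> (\<integral>\<^sup>+t. 4 * ennreal ((cmod (g t))\<^sup>2) \<partial>lborel)"
  proof (intro nn_integral_mono_AE, use AE_lborel_singleton[of 0] in eventually_elim)
    fix t :: real assume t0: "t \<noteq> 0"
    show "(\<integral>\<^sup>+x. ?k x t \<partial>lborel) \<le> 4 * ennreal ((cmod (g t))\<^sup>2)"
    proof (cases "t > 0")
      case False
      then have k0: "?k x t = 0" for x using t0 by auto
      have "(\<integral>\<^sup>+x. ?k x t \<partial>lborel) = (\<integral>\<^sup>+(x::real). 0 \<partial>lborel)" by (intro nn_integral_cong k0)
      then show ?thesis by (simp only: nn_integral_const) simp
    next
      case True
      have "(\<integral>\<^sup>+x. ?k x t \<partial>lborel) = (\<integral>\<^sup>+x. ennreal ((cmod (g t))\<^sup>2 * t powr (1/2) * 2) *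
          (ennreal (x powr (-3/2)) * indicator {t..} x) \<partial>lborel)"
        using True
        by (intro nn_integral_cong) (auto simp: indicator_def mult_ac simp flip: ennreal_mult)
      also have "\<dots> = ennreal ((cmod (g t))\<^sup>2 * t powr (1/2) * 2) * (\<integral>\<^sup>+x. ennreal (x powr (-3/2)) * indicator {t..} x \<partial>lborel)"
        by (rule nn_integral_cmult) measurable
      also have "(\<integral>\<^sup>+x. ennreal (x powr (-3/2)) * indicator {t..} x \<partial>lborel) = ennreal (- (t powr (-3/2+1)) / (-3/2+1))"
        by (intro nn_integral_has_integral_lebesgue' has_integral_powr_to_inf) (use True in auto)
      also have "- (t powr (-3/2+1)) / (-3/2+1) = 2 * t powr (-1/2)" by simp
      also have "ennreal ((cmod (g t))\<^sup>2 * t powr (1/2) * 2) * ennreal (2 * t powr (-1/2))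
          = ennreal (4 * (cmod (g t))\<^sup>2 * (t powr (1/2) * t powr (-1/2)))"
        by (subst ennreal_mult[symmetric]) (auto simp: mult_ac)
      also have "t powr (1/2) * t powr (-1/2) = 1" using True by (simp flip: powr_add)
      finally show ?thesis by (simp add: ennreal_mult)
    qed
  qed
  also have "\<dots> = 4 * (\<integral>\<^sup>+x. ennreal ((cmod (g x))\<^sup>2) \<partial>lborel)"
    by (rule nn_integral_cmult) measurable
  finally show ?thesis .
qed

section \<open>The coefficients \<open>wt\<close> = 1 - phi^2 and \<open>kap\<close> = phi
  phi'\<close>

definition wt :: "real \<Rightarrow> real" where
  "wt x = 1 - (phi x)\<^sup>2"

lemma wt_eq: "wt x = 1 - exp (- 2 * \<bar>x\<bar>)"
  by (simp add: wt_def phi_def power2_eq_square flip: exp_add)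

lemma wt_0 [simp]: "wt 0 = 0"
  by (simp add: wt_eq)

lemma wt_minus [simp]: "wt (- x) = wt x"
  by (simp add: wt_eq)

lemma wt_le_1: "wt x \<le> 1"
  by (simp add: wt_eq)

lemma wt_nonneg [simp]: "0 \<le> wt x"
  by (simp add: wt_eq)

lemma wt_pos [simp]: "0 < wt x \<longleftrightarrow> x \<noteq> 0"
  by (simp add: wt_eq)

lemma wt_eq_0 [simp]: "wt x = 0 \<longleftrightarrow> x = 0"
  by (simp add: wt_eq)

text \<open>From 1 + 2 t \<le> exp (2 t). Division by \<open>wt\<close> thus costs at most a factor
  2 / min 1 |x|: the Hardy weight near 0 and a constant far away.\<close>

lemma wt_lower: "min 1 \<bar>x\<bar> \<le> 2 * wt x"
proof -
  define t where "t = \<bar>x\<bar>"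
  have t: "t \<ge> 0" by (simp add: t_def)
  have "1 + 2 * t \<le> exp (2 * t)" using exp_ge_add_one_self[of "2*t"] by simp
  then have "exp (- (2 * t)) \<le> 1 / (1 + 2 * t)"
    using t by (simp add: exp_minus field_simps)
  then have "wt x \<ge> 1 - 1 / (1 + 2 * t)" by (simp add: wt_eq t_def)
  also have "1 - 1 / (1 + 2 * t) = 2 * t / (1 + 2 * t)" using t by (simp add: field_simps)
  finally have *: "2 * t / (1 + 2 * t) \<le> wt x" .
  have "min 1 t \<le> 2 * (2 * t / (1 + 2 * t))"
  proof (cases "t \<le> 1")
    case True
    then have "t * (1 + 2 * t) \<le> t * 4" using t by (intro mult_left_mono) auto
    then show ?thesis using True t by (simp add: field_simps min_def)
  next
    case False
    then show ?thesis by (simp add: field_simps min_def)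
  qed
  with * show ?thesis by (simp add: t_def)
qed

lemma isCont_wt: "isCont wt x"
  unfolding wt_eq[abs_def] by (intro continuous_intros)

lemma continuous_on_wt [continuous_intros]: "continuous_on A f \<Longrightarrow> continuous_on A (\<lambda>x. wt (f x))"
  unfolding wt_eq by (intro continuous_intros)

lemma wt_borel [measurable]: "wt \<in> borel_measurable borel"
  by (intro borel_measurable_continuous_onI continuous_on_wt continuous_on_id)

definition kap :: "real \<Rightarrow> real" where
  "kap x = phi x * phi' x"

lemma kap_eq: "kap x = - sgn x * exp (- 2 * \<bar>x\<bar>)"
  by (simp add: kap_def phi_def phi'_def flip: exp_add)

lemma abs_kap_le: "\<bar>kap x\<bar> \<le> 1"
  by (simp add: kap_eq abs_mult sgn_real_def)

lemma kap_borel [measurable]: "kap \<in> borel_measurable borel"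
  unfolding kap_eq[abs_def] by measurable

lemma eventually_same_sign:
  fixes x :: real
  assumes "x \<noteq> 0"
  shows "eventually (\<lambda>y. sgn y = sgn x) (nhds x)"
proof (cases "x > 0")
  case True
  then have "eventually (\<lambda>y. y \<in> {0<..}) (nhds x)" by (intro eventually_nhds_in_open) auto
  then show ?thesis by eventually_elim (use True in auto)
next
  case False
  then have "eventually (\<lambda>y. y \<in> {..<0}) (nhds x)" using assms by (intro eventually_nhds_in_open) auto
  then show ?thesis by eventually_elim (use False assms in auto)
qed

lemma DERIV_exp_abs:
  assumes "x \<noteq> 0"
  shows "((\<lambda>x. exp (- 2 * \<bar>x\<bar>)) has_real_derivative 2 * kap x) (at x)"
proof -
  have "eventually (\<lambda>y. exp (- 2 * \<bar>y\<bar>) = exp (- 2 * (y * sgn x))) (nhds x)"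
    using eventually_same_sign[OF assms] by eventually_elim (simp add: abs_sgn)
  moreover have "((\<lambda>y. exp (- 2 * (y * sgn x))) has_real_derivative 2 * kap x) (at x)"
    by (auto intro!: derivative_eq_intros simp: kap_eq abs_sgn)
  ultimately show ?thesis by (subst DERIV_cong_ev[OF refl _ refl]) auto
qed

lemma wt_DERIV:
  assumes "x \<noteq> 0"
  shows "(wt has_real_derivative - 2 * kap x) (at x)"
  using DERIV_diff[OF DERIV_const[of 1] DERIV_exp_abs[OF assms]] by (simp add: wt_eq[abs_def])

lemma kap_DERIV:
  assumes "x \<noteq> 0"
  shows "(kap has_real_derivative 2 * (1 - wt x)) (at x)"
proof -
  have "eventually (\<lambda>y. kap y = - sgn x * exp (- 2 * \<bar>y\<bar>)) (nhds x)"
    using eventually_same_sign[OF assms] by eventually_elim (simp add: kap_eq)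
  moreover have "((\<lambda>y. - sgn x * exp (- 2 * \<bar>y\<bar>)) has_real_derivative - sgn x * (2 * kap x)) (at x)"
    by (rule DERIV_cmult[OF DERIV_exp_abs[OF assms]])
  moreover have "- sgn x * (2 * kap x) = 2 * (1 - wt x)"
    using assms by (auto simp: kap_eq wt_eq sgn_real_def)
  ultimately show ?thesis by (subst DERIV_cong_ev[OF refl _ refl]) auto
qed

section \<open>Pointwise control of |v|^2 / \<open>wt\<close> and the Hardy bound for v /
  \<open>wt\<close>\<close>

lemma H1_tilde_primitive:
  assumes "v \<in> H1_tilde"
  shows "primitive v (weak_deriv v)"
  unfolding primitive_def using weak_derivative_FTC H1_tilde_weak_deriv[OF assms] by blast

lemma primitive_diff_bound:
  assumes "primitive v g" "g \<in> L2" "a \<le> b"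
  shows "(cmod (v b - v a))\<^sup>2 \<le> (b - a) * (LINT x:{a..b}|lborel. (cmod (g x))\<^sup>2)"
  using integral_Icc_Cauchy_Schwarz[OF assms(2,3)] assms(1,3) by (simp add: primitive_def)

lemma set_integral_nonneg_mono:
  fixes p :: "real \<Rightarrow> real"
  assumes "integrable lborel p" "\<And>x. p x \<ge> 0" "A \<subseteq> B" "A \<in> sets borel" "B \<in> sets borel"
  shows "(LINT x:A|lborel. p x) \<le> (LINT x:B|lborel. p x)"
  unfolding set_lebesgue_integral_def
  by (intro integral_mono integrable_mult_indicator) (use assms in \<open>auto simp: indicator_def\<close>)

text \<open>Cauchy-Schwarz on the integral of the weak derivative from 0 to x. The integral over the
  shrinking interval is kept instead of the full norm, since it supplies the little-o needed at the
  origin.\<close>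

lemma H1_tilde_local_bound:
  assumes v: "v \<in> H1_tilde"
  shows "(cmod (v x))\<^sup>2 \<le> \<bar>x\<bar> * (LINT y:{-\<bar>x\<bar>..\<bar>x\<bar>}|lborel. (cmod (weak_deriv v y))\<^sup>2)"
proof -
  note V = H1_tilde_weak_deriv[OF v] and P = H1_tilde_primitive[OF v]
  have m: "(LINT y:{a..b}|lborel. (cmod (weak_deriv v y))\<^sup>2) \<le> (LINT y:{-\<bar>x\<bar>..\<bar>x\<bar>}|lborel. (cmod (weak_deriv v y))\<^sup>2)"
    if "-\<bar>x\<bar> \<le> a" "b \<le> \<bar>x\<bar>" for a b
    by (rule set_integral_nonneg_mono) (use L2_D(2)[OF V(4)] that in auto)
  show ?thesis
  proof (cases "x \<ge> 0")
    case True
    have "(cmod (v x))\<^sup>2 \<le> x * (LINT y:{0..x}|lborel. (cmod (weak_deriv v y))\<^sup>2)"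
      using primitive_diff_bound[OF P V(4) True] V(2) by simp
    also have "\<dots> \<le> x * (LINT y:{-\<bar>x\<bar>..\<bar>x\<bar>}|lborel. (cmod (weak_deriv v y))\<^sup>2)"
      using True by (intro mult_left_mono m) auto
    finally show ?thesis using True by simp
  next
    case False
    then have x: "x \<le> 0" by simp
    have "(cmod (v x))\<^sup>2 \<le> (- x) * (LINT y:{x..0}|lborel. (cmod (weak_deriv v y))\<^sup>2)"
      using primitive_diff_bound[OF P V(4) x] V(2) by simp
    also have "\<dots> \<le> (- x) * (LINT y:{-\<bar>x\<bar>..\<bar>x\<bar>}|lborel. (cmod (weak_deriv v y))\<^sup>2)"
      using x by (intro mult_left_mono m) auto
    finally show ?thesis using x by simp
  qed
qed

text \<open>The inequality |v x| \<le> |v y| + |v y - v x| is squared and averaged over y in the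
  unit window to the right of x. The bound is local, so it decays when the window moves to
  infinity.\<close>

lemma H1_tilde_unit_interval_bound:
  assumes v: "v \<in> H1_tilde"
  shows "(cmod (v x))\<^sup>2 \<le> 2 * (LINT y:{x..x+1}|lborel. (cmod (v y))\<^sup>2 + (cmod (weak_deriv v y))\<^sup>2)"
proof -
  note V = H1_tilde_weak_deriv[OF v] and P = H1_tilde_primitive[OF v]
  let ?G = "LINT y:{x..x+1}|lborel. (cmod (weak_deriv v y))\<^sup>2"
  have si: "set_integrable lborel {x..x+1} (\<lambda>y. (cmod (f y))\<^sup>2)" if "f \<in> L2" for f
    unfolding set_integrable_def using L2_D(2)[OF that] by (intro integrable_mult_indicator) auto
  have ci: "set_integrable lborel {x..x+1} (\<lambda>y. c)" for c :: real
    by (rule borel_integrable_atLeastAtMost') auto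
  have "(cmod (v x))\<^sup>2 = (LINT y:{x..x+1}|lborel. (cmod (v x))\<^sup>2)"
    by (simp add: set_lebesgue_integral_def)
  also have "\<dots> \<le> (LINT y:{x..x+1}|lborel. 2 * (cmod (v y))\<^sup>2 + 2 * ?G)"
  proof (rule set_integral_mono[OF ci])
    show "set_integrable lborel {x..x+1} (\<lambda>y. 2 * (cmod (v y))\<^sup>2 + 2 * ?G)"
      by (intro set_integral_add set_integrable_mult_right si V ci)
    fix y assume y: "y \<in> {x..x+1}"
    have "(cmod (v y - v x))\<^sup>2 \<le> (y - x) * (LINT y:{x..y}|lborel. (cmod (weak_deriv v y))\<^sup>2)"
      using primitive_diff_bound[OF P V(4)] y by simp
    also have "\<dots> \<le> 1 * ?G"
      using y L2_D(2)[OF V(4)]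
      by (intro mult_mono set_integral_nonneg_mono) (auto simp: set_lebesgue_integral_def)
    finally have 1: "(cmod (v y - v x))\<^sup>2 \<le> ?G" by simp
    have "cmod (v x) \<le> cmod (v y) + cmod (v y - v x)"
      by (metis norm_minus_commute norm_triangle_sub)
    then have "(cmod (v x))\<^sup>2 \<le> (cmod (v y) + cmod (v y - v x))\<^sup>2" by (intro power_mono) auto
    also have "\<dots> \<le> 2 * (cmod (v y))\<^sup>2 + 2 * (cmod (v y - v x))\<^sup>2"
      using sum_squares_bound[of "cmod (v y)" "cmod (v y - v x)"] by (simp add: power2_sum)
    finally show "(cmod (v x))\<^sup>2 \<le> 2 * (cmod (v y))\<^sup>2 + 2 * ?G" using 1 by linarith
  qed
  also have "\<dots> = 2 * (LINT y:{x..x+1}|lborel. (cmod (v y))\<^sup>2) + (LINT y:{x..x+1}|lborel. 2 * ?G)"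
    by (subst set_integral_add) (auto intro!: si V ci set_integrable_mult_right)
  also have "(LINT y:{x..x+1}|lborel. 2 * ?G) = 2 * ?G"
    by (simp add: set_lebesgue_integral_def)
  also have "2 * (LINT y:{x..x+1}|lborel. (cmod (v y))\<^sup>2) + 2 * ?G
      = 2 * (LINT y:{x..x+1}|lborel. (cmod (v y))\<^sup>2 + (cmod (weak_deriv v y))\<^sup>2)"
    by (subst set_integral_add) (auto intro!: si V)
  finally show ?thesis .
qed

text \<open>The unit-window bound serves for large |x| and the local bound near 0;
  \<open>wt_lower\<close> merges them. In terms of u = v / sqrt \<open>wt\<close> this is
  boundedness, which is the form in which right-hand sides enter the half-line problem.\<close>

lemma H1_tilde_bound_wt:
  assumes v: "v \<in> H1_tilde"
  shows "\<exists>C\<ge>0. \<forall>x. (cmod (v x))\<^sup>2 \<le> C * wt x"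
proof -
  note V = H1_tilde_weak_deriv[OF v]
  let ?p = "\<lambda>y. (cmod (v y))\<^sup>2 + (cmod (weak_deriv v y))\<^sup>2"
  have ip: "integrable lborel ?p" using L2_D(2) V by auto
  define K where "K = (LINT y|lborel. ?p y)"
  have K0: "K \<ge> 0" unfolding K_def by (intro integral_nonneg_AE) auto
  have UNIV: "(LINT y:UNIV|lborel. f y) = (LINT y|lborel. f y)" for f :: "real \<Rightarrow> real"
    by (simp add: set_lebesgue_integral_def)
  have "(cmod (v x))\<^sup>2 \<le> 4 * K * wt x" for x
  proof -
    have "(LINT y:{x..x+1}|lborel. ?p y) \<le> K"
      unfolding K_def UNIV[symmetric] by (rule set_integral_nonneg_mono[OF ip]) auto
    then have 1: "(cmod (v x))\<^sup>2 \<le> 2 * K" using H1_tilde_unit_interval_bound[OF v, of x] by linarith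
    have "(LINT y:{-\<bar>x\<bar>..\<bar>x\<bar>}|lborel. (cmod (weak_deriv v y))\<^sup>2) \<le> (LINT y:UNIV|lborel. (cmod (weak_deriv v y))\<^sup>2)"
      by (rule set_integral_nonneg_mono) (use L2_D(2)[OF V(4)] in auto)
    also have "\<dots> \<le> K" unfolding UNIV K_def using ip L2_D(2)[OF V(4)] by (intro integral_mono) auto
    finally have "\<bar>x\<bar> * (LINT y:{-\<bar>x\<bar>..\<bar>x\<bar>}|lborel. (cmod (weak_deriv v y))\<^sup>2) \<le> \<bar>x\<bar> * K"
      by (rule mult_left_mono) simp
    then have 2: "(cmod (v x))\<^sup>2 \<le> \<bar>x\<bar> * K" using H1_tilde_local_bound[OF v, of x] by linarith
    from 1 2 K0 have "(cmod (v x))\<^sup>2 \<le> 2 * K * min 1 \<bar>x\<bar>"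
      by (smt (verit) mult.commute mult_right_mono abs_ge_zero mult_nonneg_nonneg min_def mult_cancel_left1)
    also have "\<dots> \<le> 2 * K * (2 * wt x)" by (intro mult_left_mono wt_lower) (use K0 in auto)
    finally show ?thesis by simp
  qed
  then show ?thesis using K0 by (intro exI[of _ "4 * K"]) auto
qed

text \<open>For |x| < 1 the quotient is at most twice the integral of |v'|^2 over [-|x|, |x|], which
  tends to 0. At 0 itself the quotient is 0 by the convention for division by zero, so continuity
  says that the limit is 0.\<close>

lemma H1_tilde_vanishing_at_0:
  assumes v: "v \<in> H1_tilde"
  shows "isCont (\<lambda>x. (cmod (v x))\<^sup>2 / wt x) 0"
proof -
  note V = H1_tilde_weak_deriv[OF v]
  let ?E = "\<lambda>x. LINT y:{-\<bar>x\<bar>..\<bar>x\<bar>}|lborel. (cmod (weak_deriv v y))\<^sup>2"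
  note [measurable] = L2_D(1)[OF V(4)]
  have "(?E \<longlongrightarrow> 0) (at 0)"
    unfolding tendsto_at_iff_sequentially o_def
  proof (intro allI impI)
    fix X :: "nat \<Rightarrow> real" assume X: "X \<longlonglongrightarrow> 0"
    have "(\<lambda>n. LINT y|lborel. indicator {-\<bar>X n\<bar>..\<bar>X n\<bar>} y *\<^sub>R (cmod (weak_deriv v y))\<^sup>2) \<longlonglongrightarrow> (LINT y|(lborel::real measure). (0::real))"
    proof (rule integral_dominated_convergence[where w="\<lambda>y. (cmod (weak_deriv v y))\<^sup>2"])
      show "AE y in lborel. (\<lambda>n. indicator {-\<bar>X n\<bar>..\<bar>X n\<bar>} y *\<^sub>R (cmod (weak_deriv v y))\<^sup>2) \<longlonglongrightarrow> 0"
        using AE_lborel_singleton[of 0]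
      proof eventually_elim
        fix y :: real assume y: "y \<noteq> 0"
        have "eventually (\<lambda>n. \<bar>X n\<bar> < \<bar>y\<bar>) sequentially"
          using order_tendstoD(2)[OF tendsto_rabs_zero[OF X]] y by simp
        then have "eventually (\<lambda>n. indicator {-\<bar>X n\<bar>..\<bar>X n\<bar>} y *\<^sub>R (cmod (weak_deriv v y))\<^sup>2 = 0) sequentially"
          by eventually_elim (auto simp: indicator_def)
        then show "(\<lambda>n. indicator {-\<bar>X n\<bar>..\<bar>X n\<bar>} y *\<^sub>R (cmod (weak_deriv v y))\<^sup>2) \<longlonglongrightarrow> 0"
          by (rule tendsto_eventually)
      qed
    qed (use L2_D(2)[OF V(4)] in \<open>auto simp: indicator_def\<close>)
    then show "(\<lambda>n. ?E (X n)) \<longlonglongrightarrow> 0" by (simp add: set_lebesgue_integral_def)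
  qed
  then have E: "((\<lambda>x. 2 * ?E x) \<longlongrightarrow> 0) (at 0)" by (rule tendsto_mult_right_zero)
  have "((\<lambda>x. (cmod (v x))\<^sup>2 / wt x) \<longlongrightarrow> 0) (at 0)"
  proof (rule Lim_null_comparison[OF _ E])
    have "eventually (\<lambda>x. x \<in> {-1<..<1}) (at (0::real))"
      by (intro eventually_at_in_open') auto
    then show "eventually (\<lambda>x. norm ((cmod (v x))\<^sup>2 / wt x) \<le> 2 * ?E x) (at 0)"
    proof eventually_elim
      fix x :: real assume x: "x \<in> {-1<..<1}"
      have E0: "?E x \<ge> 0" by (simp add: set_lebesgue_integral_def)
      have "(cmod (v x))\<^sup>2 \<le> \<bar>x\<bar> * ?E x" by (rule H1_tilde_local_bound[OF v])
      also have "\<dots> \<le> (2 * wt x) * ?E x"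
        using wt_lower[of x] x E0 by (intro mult_right_mono) auto
      finally show "norm ((cmod (v x))\<^sup>2 / wt x) \<le> 2 * ?E x"
        using E0 by (cases "x = 0") (auto simp: divide_simps mult_ac)
    qed
  qed
  then show ?thesis by (simp add: isCont_def)
qed

text \<open>Once |X n| > 1, the quotient is at most four times the integral of |v|^2 + |v'|^2 over a
  unit window that escapes to infinity. The condition on |X n| covers both ends of the line at
  once.\<close>

lemma H1_tilde_vanishing_at_infinity:
  assumes v: "v \<in> H1_tilde" and X: "filterlim (\<lambda>n. \<bar>X n\<bar>) at_top sequentially"
  shows "(\<lambda>n. (cmod (v (X n)))\<^sup>2 / wt (X n)) \<longlonglongrightarrow> 0"
proof -
  note V = H1_tilde_weak_deriv[OF v]
  note [measurable] = L2_D(1)[OF V(4)] L2_D(1)[OF V(3)]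
  let ?p = "\<lambda>y. (cmod (v y))\<^sup>2 + (cmod (weak_deriv v y))\<^sup>2"
  have ip: "integrable lborel ?p" using L2_D(2) V by auto
  have "(\<lambda>n. LINT y|lborel. indicator {X n..X n + 1} y *\<^sub>R ?p y) \<longlonglongrightarrow> (LINT y|(lborel::real measure). (0::real))"
  proof (rule integral_dominated_convergence[OF _ _ ip])
    show "AE y in lborel. (\<lambda>n. indicator {X n..X n + 1} y *\<^sub>R ?p y) \<longlonglongrightarrow> 0"
    proof (intro always_eventually allI)
      fix y :: real
      have "eventually (\<lambda>n. \<bar>X n\<bar> > \<bar>y\<bar> + 1) sequentially"
        using X by (simp add: filterlim_at_top_dense)
      then have "eventually (\<lambda>n. indicator {X n..X n + 1} y *\<^sub>R ?p y = 0) sequentially"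
        by eventually_elim (auto simp: indicator_def)
      then show "(\<lambda>n. indicator {X n..X n + 1} y *\<^sub>R ?p y) \<longlonglongrightarrow> 0"
        by (rule tendsto_eventually)
    qed
  qed (auto simp: indicator_def)
  then have E: "(\<lambda>n. 4 * (LINT y:{X n..X n + 1}|lborel. ?p y)) \<longlonglongrightarrow> 0"
    by (intro tendsto_mult_right_zero) (simp add: set_lebesgue_integral_def)
  show ?thesis
  proof (rule Lim_null_comparison[OF _ E])
    have "eventually (\<lambda>n. \<bar>X n\<bar> > 1) sequentially"
      using X by (simp add: filterlim_at_top_dense)
    then show "eventually (\<lambda>n. norm ((cmod (v (X n)))\<^sup>2 / wt (X n)) \<le> 4 * (LINT y:{X n..X n + 1}|lborel. ?p y)) sequentially"
    proof eventually_elim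
      fix n assume n: "\<bar>X n\<bar> > 1"
      let ?J = "LINT y:{X n..X n + 1}|lborel. ?p y"
      have J: "?J \<ge> 0" by (simp add: set_lebesgue_integral_def)
      have "(cmod (v (X n)))\<^sup>2 \<le> 1 * (2 * ?J)" using H1_tilde_unit_interval_bound[OF v, of "X n"] by simp
      also have "\<dots> \<le> (2 * wt (X n)) * (2 * ?J)"
        using wt_lower[of "X n"] n J by (intro mult_right_mono) auto
      finally show "norm ((cmod (v (X n)))\<^sup>2 / wt (X n)) \<le> 4 * ?J"
        using n by (auto simp: divide_simps mult_ac)
    qed
  qed
qed

text \<open>The half-line inequality is used for \<open>v\<close> and for its reflection, and
  \<open>wt_lower\<close> gives |v / wt|^2 \<le> 4 (|v / x|^2 + |v|^2).\<close>

lemma H1_tilde_Hardy: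
  assumes v: "v \<in> H1_tilde"
  shows "(\<lambda>x. v x / of_real (wt x)) \<in> L2"
proof -
  note V = H1_tilde_weak_deriv[OF v] and P = H1_tilde_primitive[OF v]
  note [measurable] = L2_D(1)[OF V(4)] L2_D(1)[OF V(3)]
  have fin: "(\<integral>\<^sup>+x. ennreal ((cmod (g x))\<^sup>2) \<partial>lborel) < \<infinity>" if "g \<in> L2" for g
    using L2_D(2)[OF that] by (simp add: nn_integral_eq_integral)
  have H1: "(\<integral>\<^sup>+x. ennreal ((cmod (v x) / x)\<^sup>2) * indicator {0<..} x \<partial>lborel) < \<infinity>"
    using order_le_less_trans[OF Hardy_halfline[OF V(4) P V(2)]] fin[OF V(4)]
    by (simp add: ennreal_mult_less_top)
  have L2': "(\<lambda>x. - weak_deriv v (- x)) \<in> L2" using L2_cmult[OF L2_reflect[OF V(4)], of "-1"] by simp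
  have H2': "(\<integral>\<^sup>+x. ennreal ((cmod (v (- x)) / x)\<^sup>2) * indicator {0<..} x \<partial>lborel) < \<infinity>"
    using order_le_less_trans[OF Hardy_halfline[OF L2' primitive_reflect[OF P]]] fin[OF L2'] V(2)
    by (simp add: ennreal_mult_less_top)
  have "(\<integral>\<^sup>+x. ennreal ((cmod (v x) / x)\<^sup>2) * indicator {..<0} x \<partial>lborel)
      = ennreal \<bar>-1\<bar> * (\<integral>\<^sup>+x. ennreal ((cmod (v (0 + (-1) * x)) / (0 + (-1) * x))\<^sup>2) * indicator {..<0} (0 + (-1) * x) \<partial>lborel)"
    by (rule nn_integral_real_affine) auto
  also have "\<dots> = (\<integral>\<^sup>+x. ennreal ((cmod (v (- x)) / x)\<^sup>2) * indicator {0<..} x \<partial>lborel)"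
    by (auto intro!: nn_integral_cong simp: indicator_def)
  finally have H2: "(\<integral>\<^sup>+x. ennreal ((cmod (v x) / x)\<^sup>2) * indicator {..<0} x \<partial>lborel) < \<infinity>"
    using H2' by simp
  have "integrable lborel (\<lambda>x. (cmod (v x) / x)\<^sup>2)"
  proof (rule integrableI_nonneg)
    have "(\<integral>\<^sup>+x. ennreal ((cmod (v x) / x)\<^sup>2) \<partial>lborel) = (\<integral>\<^sup>+x. ennreal ((cmod (v x) / x)\<^sup>2) * indicator {..<0} x
       + ennreal ((cmod (v x) / x)\<^sup>2) * indicator {0<..} x \<partial>lborel)"
      by (intro nn_integral_cong) (auto simp: indicator_def)
    also have "\<dots> < \<infinity>" using H1 H2 by (subst nn_integral_add) auto
    finally show "(\<integral>\<^sup>+x. ennreal ((cmod (v x) / x)\<^sup>2) \<partial>lborel) < \<infinity>" .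
  qed auto
  then have i: "integrable lborel (\<lambda>x. 4 * ((cmod (v x) / x)\<^sup>2 + (cmod (v x))\<^sup>2))"
    using L2_D(2)[OF V(3)] by auto
  show ?thesis
  proof (rule L2_bound[OF i])
    fix x
    show "(cmod (v x / of_real (wt x)))\<^sup>2 \<le> 4 * ((cmod (v x) / x)\<^sup>2 + (cmod (v x))\<^sup>2)"
    proof (cases "x = 0")
      case False
      have "(cmod (v x / of_real (wt x)))\<^sup>2 = (cmod (v x))\<^sup>2 * (1 / wt x)\<^sup>2"
        by (simp add: norm_divide power_divide)
      also have "\<dots> \<le> (cmod (v x))\<^sup>2 * (4 / x\<^sup>2 + 4)"
      proof (rule mult_left_mono)
        have "1 / wt x \<le> 2 / min 1 \<bar>x\<bar>" using wt_lower[of x] False by (simp add: field_simps)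
        then have "(1 / wt x)\<^sup>2 \<le> (2 / min 1 \<bar>x\<bar>)\<^sup>2" by (intro power_mono) auto
        also have "\<dots> \<le> 4 / x\<^sup>2 + 4" by (auto simp: min_def power_divide)
        finally show "(1 / wt x)\<^sup>2 \<le> 4 / x\<^sup>2 + 4" .
      qed simp
      also have "\<dots> = 4 * ((cmod (v x) / x)\<^sup>2 + (cmod (v x))\<^sup>2)"
        by (simp add: power_divide field_simps)
      finally show ?thesis .
    qed simp
  qed auto
qed

subsection \<open>The operator\<close>

lemma continuous_AE_eq:
  fixes f g :: "real \<Rightarrow> complex"
  assumes "continuous_on UNIV f" "continuous_on UNIV g" "AE x in lborel. f x = g x"
  shows "f = g"
proof -
  have o: "open {x. f x \<noteq> g x}"
    using assms by (intro open_Collect_neq)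
  have "AE x in lborel. x \<notin> {x. f x \<noteq> g x}" using assms(3) by simp
  then have "{x. f x \<noteq> g x} \<in> null_sets lborel"
    using AE_iff_null_sets[of "{x. f x \<noteq> g x}" lborel] borel_open[OF o] by simp
  then have "negligible {x. f x \<noteq> g x}"
    by (simp add: negligible_iff_null_sets null_sets_completionI)
  then have "{x. f x \<noteq> g x} = {}" using o open_not_negligible by blast
  then show ?thesis by auto
qed

lemma continuous_rep_eq:
  assumes "continuous_on UNIV g" "AE x in lborel. g x = f x"
  shows "continuous_rep f = g"
  unfolding continuous_rep_def
proof (rule the_equality)
  fix h assume h: "continuous_on UNIV h \<and> (AE x in lborel. h x = f x)"
  have "AE x in lborel. h x = g x"
    using conjunct2[OF h] assms(2) by eventually_elim simp
  then show "h = g" using continuous_AE_eq h assms(1) by blast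
qed (use assms in auto)

lemma continuous_onI_punctured:
  fixes v :: "real \<Rightarrow> complex"
  assumes "\<And>x. x \<noteq> 0 \<Longrightarrow> isCont v x" "isCont v 0"
  shows "continuous_on UNIV v"
  unfolding continuous_on_eq_continuous_at[OF open_UNIV] using assms by metis

text \<open>\<open>kap\<close> jumps from 1 to -1 at the origin; the product stays continuous only
  because \<open>v 0 = 0\<close>. The product rule off 0 then gives a derivative with bounded
  coefficients in front of \<open>v\<close> and \<open>g\<close>.\<close>

lemma kap_mult_H1_tilde:
  assumes v: "continuous_on UNIV v" "v 0 = 0" "v \<in> L2" and g: "g \<in> L2"
    and d: "\<And>x. x \<noteq> 0 \<Longrightarrow> (v has_vector_derivative g x) (at x)"
  shows "(\<lambda>x. of_real (kap x) * v x) \<in> H1_tilde"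
proof (rule H1_tilde_piecewise)
  have dk: "((\<lambda>x. of_real (kap x) * v x) has_vector_derivative
      of_real (2 * (1 - wt x)) * v x + of_real (kap x) * g x) (at x)" if "x \<noteq> 0" for x
    using has_vector_derivative_mult[OF has_vector_derivative_of_real[OF kap_DERIV[OF that]] d[OF that]]
    by (simp add: add.commute)
  then show "((\<lambda>x. of_real (kap x) * v x) has_vector_derivative
      of_real (2 * (1 - wt x)) * v x + of_real (kap x) * g x) (at x)" if "x \<noteq> 0" for x
    using that by blast
  show "continuous_on UNIV (\<lambda>x. of_real (kap x) * v x)"
  proof (rule continuous_onI_punctured)
    fix x :: real assume "x \<noteq> 0"
    then show "isCont (\<lambda>x. of_real (kap x) * v x) x"
      using dk has_vector_derivative_continuous by blast
  next
    have "isCont v 0" using v by (simp add: continuous_on_eq_continuous_at)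
    then have v0: "((\<lambda>x. cmod (v x)) \<longlongrightarrow> 0) (at 0)" using v(2) by (simp add: isCont_def tendsto_norm_zero)
    have "((\<lambda>x. of_real (kap x) * v x) \<longlongrightarrow> 0) (at 0)"
    proof (rule Lim_null_comparison[OF _ v0], rule always_eventually, rule allI)
      show "norm (of_real (kap x) * v x) \<le> cmod (v x)" for x
        using abs_kap_le[of x] by (simp add: norm_mult mult_left_le_one_le)
    qed
    then show "isCont (\<lambda>x. of_real (kap x) * v x) 0" using v(2) by (simp add: isCont_def)
  qed
  show "(\<lambda>x. of_real (kap x) * v x) \<in> L2"
    by (rule L2_mult_bounded[OF v(3), where B=1]) (use abs_kap_le in auto)
  show "(\<lambda>x. of_real (2 * (1 - wt x)) * v x + of_real (kap x) * g x) \<in> L2"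
  proof (intro L2_add)
    show "(\<lambda>x. of_real (2 * (1 - wt x)) * v x) \<in> L2"
    proof (rule L2_mult_bounded[OF v(3)])
      show "cmod (complex_of_real (2 * (1 - wt x))) \<le> 2" for x
        unfolding norm_of_real using wt_le_1[of x] wt_nonneg[of x] by (simp add: abs_le_iff)
    qed measurable
    show "(\<lambda>x. of_real (kap x) * g x) \<in> L2"
      by (rule L2_mult_bounded[OF g, where B=1]) (use abs_kap_le in auto)
  qed
qed (use v in auto)

text \<open>On an interval where the representative \<open>h\<close> is continuous, \<open>v\<close>
  is a constant plus the integral of \<open>h\<close>, so the weak derivative is a classical one.
  This turns the operator equation into an ordinary differential equation off 0.\<close>

lemma has_vector_derivative_of_AE_derivative:
  assumes v: "v \<in> H1_tilde" and h: "AE y in lborel. weak_deriv v y = h y"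
    and c: "continuous_on {a..b} h" and x: "x \<in> {a<..<b}"
  shows "(v has_vector_derivative h x) (at x)"
proof -
  note V = H1_tilde_weak_deriv[OF v]
  have eq: "v y = v a + integral {a..y} h" if "y \<in> {a..b}" for y
  proof -
    have s: "set_integrable lborel {a..y} h"
      by (rule borel_integrable_atLeastAtMost', rule continuous_on_subset[OF c]) (use that in auto)
    have "v y - v a = (LINT y:{a..y}|lborel. weak_deriv v y)"
      using H1_tilde_primitive[OF v] that by (simp add: primitive_def)
    also have "\<dots> = (LINT y:{a..y}|lborel. h y)"
      unfolding set_lebesgue_integral_def
      using s L2_set_integrable[OF V(4), of a y] h
      by (intro integral_cong_AE) (auto simp: set_integrable_def)
    also have "\<dots> = integral {a..y} h" by (rule set_borel_integral_eq_integral[OF s])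
    finally show ?thesis by (simp add: algebra_simps)
  qed
  have "((\<lambda>y. integral {a..y} h) has_vector_derivative h x) (at x within {a..b})"
    by (rule integral_has_vector_derivative[OF c]) (use x in auto)
  then have "((\<lambda>y. v a + integral {a..y} h) has_vector_derivative 0 + h x) (at x within {a..b})"
    by (rule has_vector_derivative_add[OF has_vector_derivative_const])
  then have "((\<lambda>y. v a + integral {a..y} h) has_vector_derivative h x) (at x within {a..b})"
    by simp
  then have "(v has_vector_derivative h x) (at x within {a..b})"
    by (intro has_vector_derivative_transform[OF _ eq]) (use x in simp_all)
  then show ?thesis using x at_within_Icc_at[of a x b] by simp
qed

text \<open>The equation L v - \<mu> v = f solved for v', read classically and away from its
  singular point 0.\<close>

definition resolvent_eq :: "complex \<Rightarrow> (real \<Rightarrow> complex) \<Rightarrow> (real \<Rightarrow> complex) \<Rightarrow> bool" where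
  "resolvent_eq \<mu> v f \<longleftrightarrow> (\<forall>x. x \<noteq> 0 \<longrightarrow>
     (v has_vector_derivative (f x + \<mu> * v x - of_real (kap x) * v x) / of_real (wt x)) (at x))"

lemma Dom_L_D:
  assumes v: "v \<in> Dom_L"
  shows "v \<in> H1_tilde" "shifted L_op \<mu> v \<in> H1_tilde" "resolvent_eq \<mu> v (shifted L_op \<mu> v)"
proof -
  obtain w where w: "w \<in> H1_tilde" and ae: "AE \<xi> in lborel. w \<xi> = of_real (wt \<xi>) * weak_deriv v \<xi>"
    using v unfolding Dom_L_def wt_def by auto
  show vH: "v \<in> H1_tilde" using v by (simp add: Dom_L_def)
  note V = H1_tilde_weak_deriv[OF vH] and W = H1_tilde_weak_deriv[OF w]
  have ae': "AE x in lborel. weak_deriv v x = w x / of_real (wt x)"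
    using ae AE_lborel_singleton[of 0] by eventually_elim auto
  have d: "(v has_vector_derivative w x / of_real (wt x)) (at x)" if "x \<noteq> 0" for x
  proof (rule has_vector_derivative_of_AE_derivative[OF vH ae'])
    show "continuous_on {x - \<bar>x\<bar>/2..x + \<bar>x\<bar>/2} (\<lambda>x. w x / of_real (wt x))"
      using that by (intro continuous_intros continuous_on_subset[OF W(1)]) auto
    show "x \<in> {x - \<bar>x\<bar>/2<..<x + \<bar>x\<bar>/2}" using that by auto
  qed
  \<comment> \<open>The Hardy bound is applied to \<open>w\<close>, not to \<open>v\<close>: the
    classical derivative of \<open>v\<close> is w / \<open>wt\<close>.\<close>
  have k: "(\<lambda>x. of_real (kap x) * v x) \<in> H1_tilde"
    by (rule kap_mult_H1_tilde[OF V(1-3) H1_tilde_Hardy[OF w] d])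
  have "L_op v = (\<lambda>x. w x + of_real (kap x) * v x)"
    unfolding L_op_def
  proof (rule continuous_rep_eq)
    show "continuous_on UNIV (\<lambda>x. w x + of_real (kap x) * v x)"
      by (rule continuous_on_add[OF W(1) H1_tilde_weak_deriv(1)[OF k]])
    show "AE x in lborel. w x + of_real (kap x) * v x =
       of_real (1 - (phi x)\<^sup>2) * weak_deriv v x + of_real (phi x * phi' x) * v x"
      using ae by eventually_elim (simp add: wt_def kap_def)
  qed
  then have s: "shifted L_op \<mu> v = (\<lambda>x. (w x + of_real (kap x) * v x) + (- \<mu>) * v x)"
    by (simp add: shifted_def)
  show "shifted L_op \<mu> v \<in> H1_tilde"
    unfolding s by (intro H1_tilde_add H1_tilde_cmult w k vH)
  show "resolvent_eq \<mu> v (shifted L_op \<mu> v)"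
    unfolding resolvent_eq_def s using d by simp
qed

text \<open>Integrability of r = v / \<open>wt\<close> suffices: v = \<open>wt\<close> r, and the
  derivative equals f / \<open>wt\<close> + (\<mu> - \<open>kap\<close>) r, where the first summand
  is in \<open>L2\<close> by the Hardy bound for \<open>f\<close>.\<close>

lemma Dom_L_I:
  assumes v: "continuous_on UNIV v" "v 0 = 0" and r: "(\<lambda>x. v x / of_real (wt x)) \<in> L2"
    and f: "f \<in> H1_tilde" and e: "resolvent_eq \<mu> v f"
  shows "v \<in> Dom_L" "shifted L_op \<mu> v = f"
    "AE x in lborel. weak_deriv v x = (f x + \<mu> * v x - of_real (kap x) * v x) / of_real (wt x)"
proof -
  let ?g = "\<lambda>x. (f x + \<mu> * v x - of_real (kap x) * v x) / of_real (wt x)"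
  have d: "(v has_vector_derivative ?g x) (at x)" if "x \<noteq> 0" for x
    using e that by (simp add: resolvent_eq_def)
  have "(\<lambda>x. of_real (wt x) * (v x / of_real (wt x))) \<in> L2"
    by (rule L2_mult_bounded[OF r, where B=1]) (use wt_le_1 in auto)
  moreover have "(\<lambda>x. of_real (wt x) * (v x / of_real (wt x))) = v"
    using v(2) by (auto simp: fun_eq_iff)
  ultimately have vL2: "v \<in> L2" by simp
  have "(\<lambda>x. f x / of_real (wt x) + (\<mu> - of_real (kap x)) * (v x / of_real (wt x))) \<in> L2"
  proof (intro L2_add H1_tilde_Hardy[OF f])
    show "(\<lambda>x. (\<mu> - of_real (kap x)) * (v x / of_real (wt x))) \<in> L2"
    proof (rule L2_mult_bounded[OF r])
      show "cmod (\<mu> - of_real (kap x)) \<le> cmod \<mu> + 1" for x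
        using norm_triangle_ineq4[of \<mu> "of_real (kap x)"] abs_kap_le[of x] by simp
    qed simp
  qed
  moreover have "(\<lambda>x. f x / of_real (wt x) + (\<mu> - of_real (kap x)) * (v x / of_real (wt x))) = ?g"
    by (simp add: fun_eq_iff add_divide_distrib diff_divide_distrib left_diff_distrib)
  ultimately have gL2: "?g \<in> L2" by simp
  have vH: "v \<in> H1_tilde" by (rule H1_tilde_piecewise[OF v vL2 gL2 d])
  show wd: "AE x in lborel. weak_deriv v x = ?g x"
    by (rule weak_deriv_AE[OF v(1) gL2 is_weak_derivative_piecewise[OF v(1) gL2 d]])
  have k: "(\<lambda>x. of_real (kap x) * v x) \<in> H1_tilde"
    by (rule kap_mult_H1_tilde[OF v vL2 gL2 d])
  have wH: "(\<lambda>x. (f x + \<mu> * v x) + (- 1) * (of_real (kap x) * v x)) \<in> H1_tilde"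
    by (intro H1_tilde_add H1_tilde_cmult f vH k)
  have wae: "AE x in lborel. (f x + \<mu> * v x) + (- 1) * (of_real (kap x) * v x) = of_real (wt x) * weak_deriv v x"
    using wd AE_lborel_singleton[of 0] by eventually_elim simp
  show "v \<in> Dom_L"
    unfolding Dom_L_def using vH wH wae by (auto simp: wt_def)
  have "L_op v = (\<lambda>x. f x + \<mu> * v x)"
    unfolding L_op_def
  proof (rule continuous_rep_eq)
    show "continuous_on UNIV (\<lambda>x. f x + \<mu> * v x)"
      using H1_tilde_weak_deriv(1)[OF f] v(1) by (intro continuous_intros)
    show "AE x in lborel. f x + \<mu> * v x =
       of_real (1 - (phi x)\<^sup>2) * weak_deriv v x + of_real (phi x * phi' x) * v x"
      using wae by eventually_elim (simp add: wt_def kap_def diff_eq_eq)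
  qed
  then show "shifted L_op \<mu> v = f" by (simp add: shifted_def)
qed

subsection \<open>The energy identity\<close>

text \<open>The \<open>kap\<close> term of the equation contributes -2 \<open>kap\<close> |v|^2 /
  \<open>wt\<close>^2, which the derivative of the weight cancels. The imaginary part of \<mu> only
  rotates \<open>v\<close> and drops out.\<close>

lemma energy_DERIV:
  assumes x: "x \<noteq> 0"
    and d: "(v has_vector_derivative (f x + \<mu> * v x - of_real (kap x) * v x) / of_real (wt x)) (at x)"
  shows "((\<lambda>x. (cmod (v x))\<^sup>2 / wt x) has_real_derivative
     2 * (Re (f x / of_real (wt x) * cnj (v x / of_real (wt x))) + Re \<mu> * (cmod (v x / of_real (wt x)))\<^sup>2)) (at x)"
proof -
  let ?d = "(f x + \<mu> * v x - of_real (kap x) * v x) / of_real (wt x)"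
  have w: "wt x > 0" using x by simp
  have re: "((\<lambda>x. Re (v x)) has_real_derivative Re ?d) (at x)" "((\<lambda>x. Im (v x)) has_real_derivative Im ?d) (at x)"
    using bounded_linear.has_vector_derivative[OF bounded_linear_Re d]
      bounded_linear.has_vector_derivative[OF bounded_linear_Im d]
    by (simp_all add: has_real_derivative_iff_has_vector_derivative)
  have "((\<lambda>x. (cmod (v x))\<^sup>2) has_real_derivative 2 * (Re (v x) * Re ?d + Im (v x) * Im ?d)) (at x)"
    unfolding cmod_power2
    using DERIV_add[OF DERIV_power[OF re(1), of 2] DERIV_power[OF re(2), of 2]] by (simp add: algebra_simps)
  from DERIV_divide[OF this wt_DERIV[OF x]] w
  have "((\<lambda>x. (cmod (v x))\<^sup>2 / wt x) has_real_derivative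
     (2 * (Re (v x) * Re ?d + Im (v x) * Im ?d) * wt x - (cmod (v x))\<^sup>2 * (- 2 * kap x)) / (wt x * wt x)) (at x)"
    by simp
  also have "(2 * (Re (v x) * Re ?d + Im (v x) * Im ?d) * wt x - (cmod (v x))\<^sup>2 * (- 2 * kap x)) / (wt x * wt x)
    = 2 * (Re (f x / of_real (wt x) * cnj (v x / of_real (wt x))) + Re \<mu> * (cmod (v x / of_real (wt x)))\<^sup>2)"
  proof -
    define D where "D = Re (v x) * Re ?d + Im (v x) * Im ?d"
    have "D * wt x
       = Re (v x) * (Re (f x) + (Re \<mu> * Re (v x) - Im \<mu> * Im (v x)) - kap x * Re (v x))
       + Im (v x) * (Im (f x) + (Re \<mu> * Im (v x) + Im \<mu> * Re (v x)) - kap x * Im (v x))"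
      unfolding D_def using w by (simp add: Re_divide_of_real Im_divide_of_real distrib_right)
    then have "2 * D * wt x - (cmod (v x))\<^sup>2 * (- 2 * kap x)
       = 2 * (Re (f x) * Re (v x) + Im (f x) * Im (v x) + Re \<mu> * (cmod (v x))\<^sup>2)"
      unfolding cmod_power2 mult.assoc[of 2 D] by (simp add: algebra_simps power2_eq_square)
    moreover have "Re (f x / of_real (wt x) * cnj (v x / of_real (wt x))) = (Re (f x) * Re (v x) + Im (f x) * Im (v x)) / (wt x * wt x)"
      by (simp add: Re_divide_of_real Im_divide_of_real add_divide_distrib)
    moreover have "(cmod (v x / of_real (wt x)))\<^sup>2 = (cmod (v x))\<^sup>2 / (wt x * wt x)"
      by (simp add: norm_divide power_divide power2_eq_square)
    ultimately show ?thesis unfolding D_def[symmetric] by (simp add: add_divide_distrib)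
  qed
  finally show ?thesis .
qed

text \<open>M = |v|^2 / \<open>wt\<close> is continuous across 0 and vanishes at both ends, so its
  derivative integrates to 0 over the line; this is the first estimate. For the second, M is bounded
  by the integral of |M'|, and the first estimate absorbs the |Re \<mu>| term. Its constant 4 does
  not depend on \<mu>.\<close>

lemma energy_estimates:
  assumes v: "v \<in> H1_tilde" and f: "f \<in> H1_tilde" and e: "resolvent_eq \<mu> v f"
  defines "r \<equiv> \<lambda>x. v x / of_real (wt x)" and "F \<equiv> \<lambda>x. f x / of_real (wt x)"
  shows "\<bar>Re \<mu>\<bar> * (LINT x|lborel. (cmod (r x))\<^sup>2) \<le> (LINT x|lborel. cmod (F x) * cmod (r x))"
    and "(cmod (v x))\<^sup>2 / wt x \<le> 4 * (LINT x|lborel. cmod (F x) * cmod (r x))"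
proof -
  note V = H1_tilde_weak_deriv[OF v]
  have r: "r \<in> L2" and F: "F \<in> L2" unfolding r_def F_def by (intro H1_tilde_Hardy v f)+
  note [measurable] = L2_D(1)[OF r] L2_D(1)[OF F]
  define M where "M x = (cmod (v x))\<^sup>2 / wt x" for x
  define E where "E x = 2 * (Re (F x * cnj (r x)) + Re \<mu> * (cmod (r x))\<^sup>2)" for x
  have [measurable]: "cnj \<in> borel_measurable borel"
    by (intro borel_measurable_continuous_onI continuous_on_cnj continuous_on_id)
  have iFr: "integrable lborel (\<lambda>x. cmod (F x) * cmod (r x))" by (rule L2_product_integrable[OF F r])
  have ire: "integrable lborel (\<lambda>x. Re (F x * cnj (r x)))"
  proof (rule Bochner_Integration.integrable_bound[OF iFr])
    have "\<bar>Re (F x * cnj (r x))\<bar> \<le> cmod (F x) * cmod (r x)" for x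
      using abs_Re_le_cmod[of "F x * cnj (r x)"] by (simp add: norm_mult)
    then show "AE x in lborel. norm (Re (F x * cnj (r x))) \<le> norm (cmod (F x) * cmod (r x))" by simp
  qed measurable
  have ir: "integrable lborel (\<lambda>x. (cmod (r x))\<^sup>2)" by (rule L2_D(2)[OF r])
  have iE: "integrable lborel E" unfolding E_def
    by (intro integrable_mult_right Bochner_Integration.integrable_add ire ir)
  have dM: "(M has_real_derivative E x) (at x)" if "x \<noteq> 0" for x
    unfolding M_def[abs_def] E_def F_def r_def
    using e that by (intro energy_DERIV) (auto simp: resolvent_eq_def)
  have "isCont M x" for x
    using H1_tilde_vanishing_at_0[OF v] dM[of x] DERIV_isCont unfolding M_def[abs_def] by (cases "x = 0") auto
  then have cM: "continuous_on A M" for A by (simp add: continuous_at_imp_continuous_on)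
  have FTC: "(LINT x:{a..b}|lborel. E x) = M b - M a" if "a \<le> b" for a b
  proof -
    have "(E has_integral (M b - M a)) {a..b}"
      by (rule fundamental_theorem_of_calculus_interior_strong[of "{0}"])
        (use that cM dM in \<open>auto simp: has_real_derivative_iff_has_vector_derivative\<close>)
    moreover have s: "set_integrable lborel {a..b} E"
      unfolding set_integrable_def by (rule integrable_mult_indicator[OF _ iE]) simp
    ultimately show ?thesis
      using set_borel_integral_eq_integral[OF s] by (simp add: integral_unique)
  qed
  have M_inf: "(\<lambda>n. M (real n)) \<longlonglongrightarrow> 0" "(\<lambda>n. M (- real n)) \<longlonglongrightarrow> 0"
    unfolding M_def
    by (rule H1_tilde_vanishing_at_infinity[OF v]; simp add: filterlim_real_sequentially)+
  have "(\<lambda>n. LINT x|lborel. indicator {-real n..real n} x *\<^sub>R E x) \<longlonglongrightarrow> (LINT x|lborel. E x)"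
  proof (rule integral_dominated_convergence[OF _ _ integrable_norm[OF iE]])
    show "AE x in lborel. (\<lambda>n. indicator {-real n..real n} x *\<^sub>R E x) \<longlonglongrightarrow> E x"
    proof (intro always_eventually allI)
      fix x :: real
      obtain N where N: "\<bar>x\<bar> \<le> real N" using real_arch_simple by blast
      have "eventually (\<lambda>n. indicator {-real n..real n} x *\<^sub>R E x = E x) sequentially"
        by (rule eventually_sequentiallyI[of N]) (use N in \<open>auto simp: indicator_def\<close>)
      then show "(\<lambda>n. indicator {-real n..real n} x *\<^sub>R E x) \<longlonglongrightarrow> E x" by (rule tendsto_eventually)
    qed
  qed (use iE in \<open>auto simp: indicator_def\<close>)
  moreover have "(LINT x|lborel. indicator {-real n..real n} x *\<^sub>R E x) = M (real n) - M (- real n)" for n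
    using FTC[of "- real n" "real n"] by (simp add: set_lebesgue_integral_def)
  moreover have "(\<lambda>n. M (real n) - M (- real n)) \<longlonglongrightarrow> 0 - 0" by (intro tendsto_diff M_inf)
  ultimately have E0: "(LINT x|lborel. E x) = 0" using LIMSEQ_unique by force
  have id: "(LINT x|lborel. Re (F x * cnj (r x))) + Re \<mu> * (LINT x|lborel. (cmod (r x))\<^sup>2) = 0"
  proof -
    have "(LINT x|lborel. E x) = 2 * ((LINT x|lborel. Re (F x * cnj (r x))) + (LINT x|lborel. Re \<mu> * (cmod (r x))\<^sup>2))"
      unfolding E_def integral_mult_right_zero
      by (subst Bochner_Integration.integral_add[OF ire integrable_mult_right[OF ir]]) simp
    then show ?thesis using E0 by simp
  qed
  have bound: "\<bar>LINT x|lborel. Re (F x * cnj (r x))\<bar> \<le> (LINT x|lborel. cmod (F x) * cmod (r x))"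
  proof -
    have "\<bar>LINT x|lborel. Re (F x * cnj (r x))\<bar> \<le> (LINT x|lborel. \<bar>Re (F x * cnj (r x))\<bar>)"
      using integral_norm_bound[of lborel "\<lambda>x. Re (F x * cnj (r x))"] by simp
    also have "\<dots> \<le> (LINT x|lborel. cmod (F x) * cmod (r x))"
    proof (rule integral_mono[OF integrable_abs[OF ire] iFr])
      show "\<bar>Re (F x * cnj (r x))\<bar> \<le> cmod (F x) * cmod (r x)" for x
        using abs_Re_le_cmod[of "F x * cnj (r x)"] by (simp add: norm_mult)
    qed
    finally show ?thesis .
  qed
  have r0: "(LINT x|lborel. (cmod (r x))\<^sup>2) \<ge> 0" by simp
  then have "\<bar>Re \<mu>\<bar> * (LINT x|lborel. (cmod (r x))\<^sup>2) = \<bar>Re \<mu> * (LINT x|lborel. (cmod (r x))\<^sup>2)\<bar>"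
    by (simp add: abs_mult)
  also have "\<dots> \<le> (LINT x|lborel. cmod (F x) * cmod (r x))"
    using id bound by linarith
  finally show E1: "\<bar>Re \<mu>\<bar> * (LINT x|lborel. (cmod (r x))\<^sup>2) \<le> (LINT x|lborel. cmod (F x) * cmod (r x))" .
  let ?J = "LINT x|lborel. cmod (F x) * cmod (r x)"
  have absE: "(LINT x|lborel. \<bar>E x\<bar>) \<le> 4 * ?J"
  proof -
    have "(LINT x|lborel. \<bar>E x\<bar>) \<le> (LINT x|lborel. 2 * (cmod (F x) * cmod (r x) + \<bar>Re \<mu>\<bar> * (cmod (r x))\<^sup>2))"
    proof (rule integral_mono[OF integrable_abs[OF iE]])
      show "integrable lborel (\<lambda>x. 2 * (cmod (F x) * cmod (r x) + \<bar>Re \<mu>\<bar> * (cmod (r x))\<^sup>2))"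
        using iFr ir by auto
      show "\<bar>E x\<bar> \<le> 2 * (cmod (F x) * cmod (r x) + \<bar>Re \<mu>\<bar> * (cmod (r x))\<^sup>2)" for x
      proof -
        have "\<bar>Re (F x * cnj (r x))\<bar> \<le> cmod (F x) * cmod (r x)"
          using abs_Re_le_cmod[of "F x * cnj (r x)"] by (simp add: norm_mult)
        moreover have "\<bar>Re \<mu> * (cmod (r x))\<^sup>2\<bar> = \<bar>Re \<mu>\<bar> * (cmod (r x))\<^sup>2" by (simp add: abs_mult)
        moreover have "\<bar>2 * (p + q)\<bar> \<le> 2 * (s + t)" if "\<bar>p\<bar> \<le> s" "\<bar>q\<bar> = t" for p q s t :: real
          using that abs_triangle_ineq[of p q] by (simp add: abs_mult)
        ultimately show ?thesis unfolding E_def by blast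
      qed
    qed
    also have "\<dots> = 2 * (?J + \<bar>Re \<mu>\<bar> * (LINT x|lborel. (cmod (r x))\<^sup>2))" using iFr ir by simp
    also have "\<dots> \<le> 2 * (?J + ?J)" by (intro mult_left_mono add_left_mono E1) simp
    finally show ?thesis by simp
  qed
  have "M x \<le> 4 * ?J"
  proof (rule LIMSEQ_le_const)
    show "(\<lambda>n. 4 * ?J + M (- real n)) \<longlonglongrightarrow> 4 * ?J"
      using tendsto_add[OF tendsto_const M_inf(2)] by simp
    obtain N where N: "\<bar>x\<bar> \<le> real N" using real_arch_simple by blast
    have "M x \<le> 4 * ?J + M (- real n)" if "n \<ge> N" for n
    proof -
      have "M x - M (- real n) = (LINT y:{- real n..x}|lborel. E y)"
        using FTC[of "- real n" x] N that by linarith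
      also have "\<dots> \<le> (LINT y|lborel. \<bar>E y\<bar>)"
        unfolding set_lebesgue_integral_def
        by (intro integral_mono integrable_mult_indicator integrable_abs iE) (auto simp: indicator_def)
      finally show ?thesis using absE by linarith
    qed
    then show "\<exists>N. \<forall>n\<ge>N. M x \<le> 4 * ?J + M (- real n)" by blast
  qed
  then show "(cmod (v x))\<^sup>2 / wt x \<le> 4 * ?J" by (simp add: M_def)
qed

subsection \<open>Solving the resolvent equation\<close>

text \<open>Variation of constants from plus infinity: u y is minus the integral of exp (\<mu> (y -
  s)) h s over s \<ge> y. It converges because Re \<mu> > 0, and integrating the exponential yields
  the bound C / Re \<mu>.\<close>

lemma bounded_solution_pos:
  fixes h :: "real \<Rightarrow> complex"
  assumes mu: "Re \<mu> > 0" and h: "continuous_on UNIV h" and C: "\<And>y. cmod (h y) \<le> C"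
  shows "\<exists>u. (\<forall>y. (u has_vector_derivative \<mu> * u y + h y) (at y)) \<and> (\<forall>y. cmod (u y) \<le> C / Re \<mu>)"
proof -
  have C0: "C \<ge> 0" using C[of 0] norm_ge_zero order_trans by blast
  define k where "k s = exp (- \<mu> * of_real s) * h s" for s
  have ck: "continuous_on A k" for A
    unfolding k_def[abs_def] by (intro continuous_intros continuous_on_subset[OF h]) auto
  have [measurable]: "k \<in> borel_measurable borel"
    by (rule borel_measurable_continuous_onI[OF ck])
  have k_le: "cmod (k s) \<le> C * exp (- Re \<mu> * s)" for s
    using mult_right_mono[OF C[of s], of "exp (- Re \<mu> * s)"] by (simp add: k_def norm_mult mult.commute)
  have nn: "(\<integral>\<^sup>+s. ennreal (norm (indicator {y..} s *\<^sub>R k s)) \<partial>lborel) \<le> ennreal (C * (exp (- Re \<mu> * y) / Re \<mu>))" for y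
  proof -
    have "(\<integral>\<^sup>+s. ennreal (norm (indicator {y..} s *\<^sub>R k s)) \<partial>lborel)
        \<le> (\<integral>\<^sup>+s. ennreal C * (ennreal (exp (- Re \<mu> * s)) * indicator {y..} s) \<partial>lborel)"
      by (intro nn_integral_mono) (use k_le in \<open>auto simp: indicator_def C0 simp flip: ennreal_mult intro!: ennreal_leI\<close>)
    also have "\<dots> = ennreal C * (\<integral>\<^sup>+s. ennreal (exp (- Re \<mu> * s)) * indicator {y..} s \<partial>lborel)"
      by (rule nn_integral_cmult) measurable
    also have "(\<integral>\<^sup>+s. ennreal (exp (- Re \<mu> * s)) * indicator {y..} s \<partial>lborel) = ennreal (exp (- Re \<mu> * y) / Re \<mu>)"
      by (intro nn_integral_has_integral_lebesgue' has_integral_exp_minus_to_infinity mu) auto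
    finally show ?thesis by (simp only: ennreal_mult'[OF C0])
  qed
  have si: "set_integrable lborel {y..} k" for y
    unfolding set_integrable_def
  proof (rule integrableI_bounded)
    show "(\<integral>\<^sup>+s. ennreal (norm (indicator {y..} s *\<^sub>R k s)) \<partial>lborel) < \<infinity>"
      using order_le_less_trans[OF nn[of y]] by simp
  qed measurable
  define G where "G y = (LINT s:{y..}|lborel. k s)" for y
  have G_le: "cmod (G y) \<le> C * (exp (- Re \<mu> * y) / Re \<mu>)" for y
  proof -
    have "ennreal (cmod (G y)) \<le> ennreal (C * (exp (- Re \<mu> * y) / Re \<mu>))"
      unfolding G_def set_lebesgue_integral_def
      using si[of y] by (intro order_trans[OF integral_norm_bound_ennreal nn]) (simp add: set_integrable_def)
    then show ?thesis using C0 mu by (subst (asm) ennreal_le_iff) auto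
  qed
  have G_eq: "G y = G a - integral {a..y} k" if "a \<le> y" for a y
  proof -
    have s: "set_integrable lborel {a..y} k" by (rule borel_integrable_atLeastAtMost'[OF ck])
    have "G a = (LINT s:{a..y} \<union> {y..}|lborel. k s)"
    proof -
      have "{a..} = {a..y} \<union> {y..}" using that by auto
      then show ?thesis unfolding G_def by simp
    qed
    also have "\<dots> = (LINT s:{a..y}|lborel. k s) + G y"
      unfolding G_def
    proof (rule set_integral_Un_AE[OF _ _ _ s si])
      show "AE x in lborel. \<not> (x \<in> {a..y} \<and> x \<in> {y..})"
        using AE_lborel_singleton[of y] by eventually_elim auto
    qed auto
    also have "(LINT s:{a..y}|lborel. k s) = integral {a..y} k"
      by (rule set_borel_integral_eq_integral(2)[OF s])
    finally show ?thesis by simp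
  qed
  have dG: "(G has_vector_derivative - k y) (at y)" for y
  proof -
    have "((\<lambda>z. integral {y-1..z} k) has_vector_derivative k y) (at y within {y-1..y+1})"
      by (rule integral_has_vector_derivative[OF ck]) auto
    from has_vector_derivative_diff[OF has_vector_derivative_const this]
    have "((\<lambda>z. G (y-1) - integral {y-1..z} k) has_vector_derivative - k y) (at y within {y-1..y+1})"
      by simp
    then have "(G has_vector_derivative - k y) (at y within {y-1..y+1})"
      by (rule has_vector_derivative_transform[rotated 2]) (auto intro: G_eq)
    then show ?thesis using at_within_Icc_at[of "y-1" y "y+1"] by simp
  qed
  define u where "u y = - (exp (\<mu> * of_real y) * G y)" for y
  have "(u has_vector_derivative \<mu> * u y + h y) (at y)" for y
  proof -
    have de: "((\<lambda>y. exp (\<mu> * of_real y)) has_vector_derivative \<mu> * exp (\<mu> * of_real y)) (at y)"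
      by (rule has_vector_derivative_real_field) (auto intro!: derivative_eq_intros)
    have "exp (\<mu> * of_real y) * k y = h y"
      by (simp add: k_def flip: mult.assoc exp_add)
    then show ?thesis
      unfolding u_def[abs_def]
      using has_vector_derivative_minus[OF has_vector_derivative_mult[OF de dG[of y]]]
      by (simp add: algebra_simps)
  qed
  moreover have "cmod (u y) \<le> C / Re \<mu>" for y
  proof -
    have "cmod (u y) = exp (Re \<mu> * y) * cmod (G y)" by (simp add: u_def norm_mult)
    also have "\<dots> \<le> exp (Re \<mu> * y) * (C * (exp (- Re \<mu> * y) / Re \<mu>))"
      by (intro mult_left_mono G_le) simp
    also have "\<dots> = exp (Re \<mu> * y) * exp (- Re \<mu> * y) * (C / Re \<mu>)" by simp
    also have "exp (Re \<mu> * y) * exp (- Re \<mu> * y) = 1" by (simp flip: exp_add)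
    finally show ?thesis by simp
  qed
  ultimately show ?thesis by blast
qed

lemma has_vector_derivative_reflect:
  assumes "(u has_vector_derivative d) (at (- y))"
  shows "((\<lambda>y. u (- y)) has_vector_derivative - d) (at (y::real))"
proof -
  have "((\<lambda>y. - y) has_vector_derivative (-1)) (at y)"
    by (auto intro!: derivative_eq_intros)
  from vector_diff_chain_at[OF this, of u d] assms show ?thesis by (simp add: o_def)
qed

text \<open>The reflection y -> -y exchanges \<mu> and -\<mu>, reducing the case Re \<mu> < 0 to the
  previous one.\<close>

lemma bounded_solution:
  fixes h :: "real \<Rightarrow> complex"
  assumes mu: "Re \<mu> \<noteq> 0" and h: "continuous_on UNIV h" and C: "\<And>y. cmod (h y) \<le> C"
  shows "\<exists>u B. \<forall>y. (u has_vector_derivative \<mu> * u y + h y) (at y) \<and> cmod (u y) \<le> B"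
proof (cases "Re \<mu> > 0")
  case True
  then show ?thesis using bounded_solution_pos[OF True h C] by blast
next
  case False
  then have "Re (- \<mu>) > 0" using mu by simp
  moreover have "continuous_on UNIV (\<lambda>y. - h (- y))"
    by (intro continuous_intros continuous_on_compose2[OF h]) auto
  moreover have "cmod (- h (- y)) \<le> C" for y using C by simp
  ultimately obtain u where u: "\<And>y. (u has_vector_derivative - \<mu> * u y + - h (- y)) (at y)"
      "\<And>y. cmod (u y) \<le> C / Re (- \<mu>)"
    using bounded_solution_pos[of "- \<mu>" "\<lambda>y. - h (- y)" C] by auto
  have "((\<lambda>y. u (- y)) has_vector_derivative \<mu> * u (- y) + h y) (at y)" for y
    using has_vector_derivative_reflect[OF u(1)[of "- y"]] by (simp add: add.commute)
  with u(2) show ?thesis by blast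
qed

text \<open>The variable y on the right half-line: the antiderivative of 1 / \<open>wt\<close>
  there, mapping it onto the whole line with inverse ln (1 + exp (2 y)) / 2.\<close>

definition stretch :: "real \<Rightarrow> real" where
  "stretch x = ln (exp (2 * x) - 1) / 2"

lemma stretch_inverse:
  assumes "x > 0"
  shows "ln (1 + exp (2 * stretch x)) / 2 = x"
proof -
  have "exp (2 * x) - 1 > 0" using assms by simp
  then show ?thesis by (simp add: stretch_def)
qed

lemma stretch_DERIV:
  assumes "x > 0"
  shows "(stretch has_real_derivative 1 / wt x) (at x)"
proof -
  have e: "exp (2 * x) - 1 > 0" using assms by simp
  then have "(stretch has_real_derivative exp (2 * x) / (exp (2 * x) - 1)) (at x)"
    unfolding stretch_def[abs_def] by (auto intro!: derivative_eq_intros simp: field_simps)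
  moreover have "exp (2 * x) / (exp (2 * x) - 1) = 1 / wt x"
  proof -
    have "exp (2 * x) * wt x = exp (2 * x) - 1"
      using assms by (simp add: wt_eq right_diff_distrib flip: exp_add)
    then show ?thesis using e assms by (simp add: field_simps)
  qed
  ultimately show ?thesis by simp
qed

lemma sqrt_wt_DERIV:
  assumes "x \<noteq> 0"
  shows "((\<lambda>x. sqrt (wt x)) has_real_derivative - kap x / sqrt (wt x)) (at x)"
proof -
  have "wt x > 0" using assms by simp
  from DERIV_chain2[OF DERIV_real_sqrt[OF this] wt_DERIV[OF assms]]
  have "((\<lambda>x. sqrt (wt x)) has_real_derivative inverse (sqrt (wt x)) / 2 * (- 2 * kap x)) (at x)" .
  moreover have "inverse s / 2 * (- 2 * k) = - k / s" for s k :: real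
    by (cases "s = 0") (auto simp: field_simps)
  ultimately show ?thesis by simp
qed

text \<open>The hypothesis on \<open>f\<close> is boundedness of the transported right-hand side
  \<open>h\<close>, and boundedness of \<open>u\<close> returns as the same kind of bound on
  \<open>v\<close>. Square-integrability of v / \<open>wt\<close> is obtained later, from the energy
  identity.\<close>

lemma halfline_solution:
  assumes mu: "Re \<mu> \<noteq> 0" and f: "continuous_on {0<..} f"
    and C: "\<And>x. x > 0 \<Longrightarrow> (cmod (f x))\<^sup>2 \<le> C * wt x"
  shows "\<exists>v B. \<forall>x>0. (v has_vector_derivative (f x + \<mu> * v x - of_real (kap x) * v x) / of_real (wt x)) (at x)
     \<and> (cmod (v x))\<^sup>2 \<le> B * wt x"
proof -
  define X where "X y = ln (1 + exp (2 * y)) / 2" for y :: real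
  have X0: "X y > 0" for y
    unfolding X_def by (simp add: ln_gt_zero)
  have cX: "continuous_on UNIV X"
    unfolding X_def[abs_def] by (intro continuous_intros) (auto simp: add_pos_pos less_imp_neq[symmetric])
  define h where "h y = f (X y) / of_real (sqrt (wt (X y)))" for y
  have ch: "continuous_on UNIV h"
    unfolding h_def[abs_def]
  proof (intro continuous_on_divide continuous_on_of_real continuous_on_real_sqrt continuous_on_wt cX)
    show "continuous_on UNIV (\<lambda>y. f (X y))"
      by (rule continuous_on_compose2[OF f cX]) (use X0 in auto)
    show "\<forall>y\<in>UNIV. complex_of_real (sqrt (wt (X y))) \<noteq> 0"
    proof
      fix y show "complex_of_real (sqrt (wt (X y))) \<noteq> 0" using X0[of y] by simp
    qed
  qed
  have hC: "cmod (h y) \<le> sqrt C" for y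
  proof -
    have w: "wt (X y) > 0" using X0[of y] by simp
    have "(cmod (h y))\<^sup>2 = (cmod (f (X y)))\<^sup>2 / wt (X y)"
      by (simp add: h_def norm_divide power_divide)
    also have "\<dots> \<le> C" using C[OF X0] w by (simp add: divide_simps)
    finally show ?thesis by (simp add: real_le_rsqrt)
  qed
  obtain u B where u: "\<And>y. (u has_vector_derivative \<mu> * u y + h y) (at y)" "\<And>y. cmod (u y) \<le> B"
    using bounded_solution[OF mu ch hC] by blast
  define v where "v x = of_real (sqrt (wt x)) * u (stretch x)" for x
  have "(v has_vector_derivative (f x + \<mu> * v x - of_real (kap x) * v x) / of_real (wt x)) (at x)"
    "(cmod (v x))\<^sup>2 \<le> B\<^sup>2 * wt x" if x: "x > 0" for x
  proof -
    define s where "s = complex_of_real (sqrt (wt x))"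
    have s: "s \<noteq> 0" "of_real (wt x) = s * s" using x by (auto simp: s_def simp flip: of_real_mult)
    have hx: "h (stretch x) = f x / s"
      by (simp add: h_def X_def stretch_inverse[OF x] s_def)
    have "((\<lambda>x. u (stretch x)) has_vector_derivative (1 / wt x) *\<^sub>R (\<mu> * u (stretch x) + h (stretch x))) (at x)"
      using vector_diff_chain_at[of stretch "1 / wt x" x u, OF _ u(1)] stretch_DERIV[OF x]
      by (simp add: has_real_derivative_iff_has_vector_derivative o_def)
    from has_vector_derivative_mult[OF has_vector_derivative_of_real[OF sqrt_wt_DERIV] this] x
    have "(v has_vector_derivative s * ((1 / wt x) *\<^sub>R (\<mu> * u (stretch x) + h (stretch x)))
        + of_real (- kap x / sqrt (wt x)) * u (stretch x)) (at x)"
      unfolding v_def[abs_def] s_def by simp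
    also have "s * ((1 / wt x) *\<^sub>R (\<mu> * u (stretch x) + h (stretch x)))
        + of_real (- kap x / sqrt (wt x)) * u (stretch x)
        = (f x + \<mu> * v x - of_real (kap x) * v x) / of_real (wt x)"
    proof -
      have vx: "v x = s * u (stretch x)" by (simp add: v_def s_def)
      have kx: "complex_of_real (- kap x / sqrt (wt x)) = - of_real (kap x) / s" by (simp add: s_def)
      have wx: "complex_of_real (1 / wt x) = 1 / (s * s)" by (simp flip: s(2))
      show ?thesis
        unfolding scaleR_conv_of_real wx kx vx hx s(2) using s(1) by (simp add: field_simps)
    qed
    finally show "(v has_vector_derivative (f x + \<mu> * v x - of_real (kap x) * v x) / of_real (wt x)) (at x)" .
    have "(cmod (v x))\<^sup>2 = (cmod (u (stretch x)))\<^sup>2 * wt x"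
      by (simp add: v_def norm_mult power_mult_distrib)
    also have "\<dots> \<le> B\<^sup>2 * wt x" using u(2) by (intro mult_right_mono power_mono) auto
    finally show "(cmod (v x))\<^sup>2 \<le> B\<^sup>2 * wt x" .
  qed
  then show ?thesis by blast
qed

lemma kap_minus [simp]: "kap (- x) = - kap x"
  by (simp add: kap_eq sgn_minus)

text \<open>Since \<open>wt\<close> is even and \<open>kap\<close> odd, x -> -x turns the problem on
  the left half-line into the one on the right with data -\<mu> and -f (-x). The two pieces are
  chosen independently of each other, both being forced to 0 at the origin by the \<open>wt\<close>
  bound.\<close>

lemma line_solution:
  assumes mu: "Re \<mu> \<noteq> 0" and f: "f \<in> H1_tilde"
  shows "\<exists>v B. v 0 = 0 \<and> resolvent_eq \<mu> v f \<and> (\<forall>x. (cmod (v x))\<^sup>2 \<le> B * wt x)"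
proof -
  note F = H1_tilde_weak_deriv[OF f]
  obtain C where C: "\<And>x. (cmod (f x))\<^sup>2 \<le> C * wt x" using H1_tilde_bound_wt[OF f] by blast
  obtain p P where p: "\<And>x. x > 0 \<Longrightarrow> (p has_vector_derivative (f x + \<mu> * p x - of_real (kap x) * p x) / of_real (wt x)) (at x)"
    "\<And>x. x > 0 \<Longrightarrow> (cmod (p x))\<^sup>2 \<le> P * wt x"
    using halfline_solution[OF mu continuous_on_subset[OF F(1)] C] by blast
  have "Re (- \<mu>) \<noteq> 0" using mu by simp
  moreover have "continuous_on {0<..} (\<lambda>x. - f (- x))"
    by (intro continuous_intros continuous_on_compose2[OF F(1)]) auto
  moreover have "(cmod (- f (- x)))\<^sup>2 \<le> C * wt x" for x using C[of "- x"] by simp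
  ultimately obtain q Q where q: "\<And>x. x > 0 \<Longrightarrow> (q has_vector_derivative (- f (- x) + (- \<mu>) * q x - of_real (kap x) * q x) / of_real (wt x)) (at x)"
    "\<And>x. x > 0 \<Longrightarrow> (cmod (q x))\<^sup>2 \<le> Q * wt x"
    using halfline_solution[of "- \<mu>" "\<lambda>x. - f (- x)" C] by blast
  define v where "v x = (if x > 0 then p x else if x < 0 then q (- x) else 0)" for x
  have "resolvent_eq \<mu> v f"
    unfolding resolvent_eq_def
  proof (intro allI impI)
    fix x :: real assume "x \<noteq> 0"
    then consider "x > 0" | "x < 0" by linarith
    then show "(v has_vector_derivative (f x + \<mu> * v x - of_real (kap x) * v x) / of_real (wt x)) (at x)"
    proof cases
      case 1
      have "(v has_vector_derivative (f x + \<mu> * p x - of_real (kap x) * p x) / of_real (wt x)) (at x)"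
        by (rule has_vector_derivative_transform_within_open[OF p(1)[OF 1], of "{0<..}"]) (use 1 in \<open>auto simp: v_def\<close>)
      then show ?thesis using 1 by (simp add: v_def)
    next
      case 2
      have "- x > 0" using 2 by simp
      have eq: "- ((- f (- (- x)) + (- \<mu>) * q (- x) - of_real (kap (- x)) * q (- x)) / of_real (wt (- x)))
          = (f x + \<mu> * q (- x) - of_real (kap x) * q (- x)) / of_real (wt x)"
        unfolding kap_minus wt_minus minus_minus minus_divide_left by (simp add: algebra_simps)
      from has_vector_derivative_reflect[OF q(1)[OF \<open>- x > 0\<close>]]
      have "((\<lambda>x. q (- x)) has_vector_derivative (f x + \<mu> * q (- x) - of_real (kap x) * q (- x)) / of_real (wt x)) (at x)"
        unfolding eq .
      then have "(v has_vector_derivative (f x + \<mu> * q (- x) - of_real (kap x) * q (- x)) / of_real (wt x)) (at x)"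
        by (rule has_vector_derivative_transform_within_open[of _ _ _ "{..<0}"]) (use 2 in \<open>auto simp: v_def\<close>)
      then show ?thesis using 2 by (simp add: v_def)
    qed
  qed
  moreover have "(cmod (v x))\<^sup>2 \<le> max P Q * wt x" for x
  proof -
    have "(cmod (v x))\<^sup>2 \<le> P * wt x \<or> (cmod (v x))\<^sup>2 \<le> Q * wt x"
      using p(2)[of x] q(2)[of "- x"] by (cases x "0 :: real" rule: linorder_cases) (auto simp: v_def)
    moreover have "P * wt x \<le> max P Q * wt x" "Q * wt x \<le> max P Q * wt x" by (intro mult_right_mono; simp)+
    ultimately show ?thesis by (meson order_trans)
  qed
  moreover have "v 0 = 0" by (simp add: v_def)
  ultimately show ?thesis by blast
qed

lemma resolvent_eq_isCont:
  assumes "resolvent_eq \<mu> v f" "x \<noteq> 0"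
  shows "isCont v x"
  using assms has_vector_derivative_continuous unfolding resolvent_eq_def by blast

lemma continuous_of_resolvent_eq:
  assumes e: "resolvent_eq \<mu> v f" and v0: "v 0 = 0" and B: "\<And>x. (cmod (v x))\<^sup>2 \<le> B * wt x"
  shows "continuous_on UNIV v"
proof (rule continuous_onI_punctured)
  show "isCont v x" if "x \<noteq> 0" for x using resolvent_eq_isCont[OF e that] .
  have "((\<lambda>x. sqrt (B * wt x)) \<longlongrightarrow> sqrt (B * wt 0)) (at 0)"
    using isCont_wt[of 0] by (intro tendsto_intros) (simp add: isCont_def)
  then have t: "((\<lambda>x. sqrt (B * wt x)) \<longlongrightarrow> 0) (at 0)" by simp
  have "(v \<longlongrightarrow> 0) (at 0)"
  proof (rule Lim_null_comparison[OF _ t], rule always_eventually, rule allI)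
    show "norm (v x) \<le> sqrt (B * wt x)" for x using B[of x] by (simp add: real_le_rsqrt)
  qed
  then show "isCont v 0" using v0 by (simp add: isCont_def)
qed

lemma Re_mult_cnj_le: "\<bar>Re (a * cnj b)\<bar> \<le> cmod a * cmod b"
  using abs_Re_le_cmod[of "a * cnj b"] by (simp add: norm_mult)

text \<open>\<open>v\<close> is not yet known to lie in the space, so the identity is integrated
  only away from 0. The boundary terms are at most B because 0 \<le> M \<le> B, and Young's
  inequality with weight m = |Re \<mu>| absorbs half of the quadratic term. The result does not
  depend on the interval.\<close>

lemma local_energy_bound:
  assumes mu: "Re \<mu> \<noteq> 0" and f: "f \<in> H1_tilde" and e: "resolvent_eq \<mu> v f"
    and B: "\<And>x. (cmod (v x))\<^sup>2 \<le> B * wt x" and ab: "a \<le> b" "0 \<notin> {a..b}"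
  shows "(\<integral>\<^sup>+x. ennreal ((cmod (v x / of_real (wt x)))\<^sup>2) * indicator {a..b} x \<partial>lborel)
    \<le> ennreal ((B + (LINT x|lborel. (cmod (f x / of_real (wt x)))\<^sup>2) / \<bar>Re \<mu>\<bar>) / \<bar>Re \<mu>\<bar>)"
proof -
  define r where "r x = v x / of_real (wt x)" for x
  define F where "F x = f x / of_real (wt x)" for x
  define M where "M x = (cmod (v x))\<^sup>2 / wt x" for x
  define E where "E x = 2 * (Re (F x * cnj (r x)) + Re \<mu> * (cmod (r x))\<^sup>2)" for x
  define m where "m = \<bar>Re \<mu>\<bar>"
  have m: "m > 0" using mu by (simp add: m_def)
  have F: "F \<in> L2" unfolding F_def by (rule H1_tilde_Hardy[OF f])
  have FTC: "(E has_integral (M b - M a)) {a..b}"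
  proof (rule fundamental_theorem_of_calculus[OF ab(1)])
    fix x assume "x \<in> {a..b}"
    then have "x \<noteq> 0" using ab by auto
    then have "(M has_real_derivative E x) (at x)"
      unfolding M_def[abs_def] E_def F_def r_def
      using e by (intro energy_DERIV) (auto simp: resolvent_eq_def)
    then show "(M has_vector_derivative E x) (at x within {a..b})"
      by (simp add: has_real_derivative_iff_has_vector_derivative has_vector_derivative_at_within)
  qed
  have cr: "continuous_on {a..b} r"
    unfolding r_def
    using resolvent_eq_isCont[OF e] ab
    by (intro continuous_intros continuous_at_imp_continuous_on) auto
  have iF: "((\<lambda>x. (cmod (F x))\<^sup>2) has_integral integral {a..b} (\<lambda>x. (cmod (F x))\<^sup>2)) {a..b}"
    "integral {a..b} (\<lambda>x. (cmod (F x))\<^sup>2) \<le> (LINT x|lborel. (cmod (F x))\<^sup>2)"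
  proof -
    have s: "set_integrable lborel {a..b} (\<lambda>x. (cmod (F x))\<^sup>2)"
      unfolding set_integrable_def by (intro integrable_mult_indicator L2_D(2)[OF F]) simp
    note q = set_borel_integral_eq_integral[OF s]
    show "((\<lambda>x. (cmod (F x))\<^sup>2) has_integral integral {a..b} (\<lambda>x. (cmod (F x))\<^sup>2)) {a..b}"
      using q(1) by (rule integrable_integral)
    have "integral {a..b} (\<lambda>x. (cmod (F x))\<^sup>2) \<le> (LINT x:UNIV|lborel. (cmod (F x))\<^sup>2)"
      unfolding q(2)[symmetric] by (rule set_integral_nonneg_mono[OF L2_D(2)[OF F]]) auto
    then show "integral {a..b} (\<lambda>x. (cmod (F x))\<^sup>2) \<le> (LINT x|lborel. (cmod (F x))\<^sup>2)"
      by (simp add: set_lebesgue_integral_def)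
  qed
  have ir: "((\<lambda>x. (cmod (r x))\<^sup>2) has_integral integral {a..b} (\<lambda>x. (cmod (r x))\<^sup>2)) {a..b}"
    by (intro integrable_integral integrable_continuous_real continuous_intros cr)
  have M01: "0 \<le> M x" "M x \<le> B" if "x \<in> {a..b}" for x
  proof -
    have "wt x > 0" using that ab by auto
    then show "0 \<le> M x" "M x \<le> B" using B[of x] by (auto simp: M_def divide_simps)
  qed
  have pw: "m * (cmod (r x))\<^sup>2 \<le> sgn (Re \<mu>) * E x + (1 / m) * (cmod (F x))\<^sup>2" for x
  proof -
    have "sgn (Re \<mu>) * E x = 2 * (sgn (Re \<mu>) * Re (F x * cnj (r x))) + 2 * (m * (cmod (r x))\<^sup>2)"
      by (simp add: E_def m_def abs_sgn algebra_simps)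
    moreover have "\<bar>sgn (Re \<mu>) * Re (F x * cnj (r x))\<bar> \<le> cmod (F x) * cmod (r x)"
      using Re_mult_cnj_le[of "F x" "r x"] mu by (simp add: abs_mult sgn_real_def)
    moreover have "2 * (cmod (F x) * cmod (r x)) \<le> (1 / m) * (cmod (F x))\<^sup>2 + m * (cmod (r x))\<^sup>2"
    proof -
      have "0 \<le> (cmod (F x) - m * cmod (r x))\<^sup>2 / m" using m by simp
      also have "\<dots> = (1 / m) * (cmod (F x))\<^sup>2 + m * (cmod (r x))\<^sup>2 - 2 * (cmod (F x) * cmod (r x))"
        using m by (simp add: power2_eq_square field_simps)
      finally show ?thesis by simp
    qed
    ultimately show ?thesis by linarith
  qed
  have "m * integral {a..b} (\<lambda>x. (cmod (r x))\<^sup>2)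
     \<le> sgn (Re \<mu>) * (M b - M a) + (1 / m) * integral {a..b} (\<lambda>x. (cmod (F x))\<^sup>2)"
    using has_integral_mult_right[OF ir, of m]
      has_integral_add[OF has_integral_mult_right[OF FTC, of "sgn (Re \<mu>)"] has_integral_mult_right[OF iF(1), of "1/m"]]
    by (rule has_integral_le) (rule pw)
  also have "\<dots> \<le> B + (1 / m) * (LINT x|lborel. (cmod (F x))\<^sup>2)"
  proof (intro add_mono mult_left_mono iF(2))
    \<comment> \<open>Whatever the sign, one of the two boundary values enters negatively and is
      dropped.\<close>
    show "sgn (Re \<mu>) * (M b - M a) \<le> B"
      using M01[of a] M01[of b] ab by (auto simp: sgn_real_def)
  qed (use m in auto)
  finally have "integral {a..b} (\<lambda>x. (cmod (r x))\<^sup>2) \<le> (B + (LINT x|lborel. (cmod (F x))\<^sup>2) / m) / m"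
    using m by (simp add: field_simps)
  moreover have "(\<integral>\<^sup>+x. ennreal ((cmod (r x))\<^sup>2) * indicator {a..b} x \<partial>lborel) = ennreal (integral {a..b} (\<lambda>x. (cmod (r x))\<^sup>2))"
    by (rule nn_integral_has_integral_lebesgue'[OF _ ir]) simp
  ultimately show ?thesis
    unfolding r_def F_def m_def by (simp add: ennreal_leI)
qed

text \<open>The uniform local bounds on intervals exhausting the punctured line, with monotone
  convergence, give r in \<open>L2\<close>, the remaining requirement of
  \<open>Dom_L_I\<close>.\<close>

lemma resolvent_solution:
  assumes mu: "Re \<mu> \<noteq> 0" and f: "f \<in> H1_tilde"
  obtains v where "v \<in> Dom_L" "shifted L_op \<mu> v = f"
proof -
  obtain v B where v0: "v 0 = 0" and e: "resolvent_eq \<mu> v f" and B: "\<And>x. (cmod (v x))\<^sup>2 \<le> B * wt x"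
    using line_solution[OF mu f] by blast
  have cv: "continuous_on UNIV v" by (rule continuous_of_resolvent_eq[OF e v0 B])
  then have [measurable]: "v \<in> borel_measurable borel" by (rule borel_measurable_continuous_onI)
  define r where "r x = v x / of_real (wt x)" for x
  have [measurable]: "r \<in> borel_measurable borel" unfolding r_def[abs_def] by measurable
  define K where "K = (B + (LINT x|lborel. (cmod (f x / of_real (wt x)))\<^sup>2) / \<bar>Re \<mu>\<bar>) / \<bar>Re \<mu>\<bar>"
  define A where "A n = {1 / real (Suc n)..real (Suc n)}" for n
  define A' where "A' n = {- real (Suc n)..- (1 / real (Suc n))}" for n
  have inv: "1 / real (Suc n) \<le> real (Suc n)" for n
    by (simp add: divide_simps) (simp add: algebra_simps)
  have bd: "(\<integral>\<^sup>+x. ennreal ((cmod (r x))\<^sup>2) * indicator (A n \<union> A' n) x \<partial>lborel) \<le> 2 * ennreal K" for n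
  proof -
    have "(\<integral>\<^sup>+x. ennreal ((cmod (r x))\<^sup>2) * indicator (A n \<union> A' n) x \<partial>lborel)
       \<le> (\<integral>\<^sup>+x. ennreal ((cmod (r x))\<^sup>2) * indicator (A n) x + ennreal ((cmod (r x))\<^sup>2) * indicator (A' n) x \<partial>lborel)"
      by (intro nn_integral_mono) (auto simp: indicator_def)
    also have "\<dots> = (\<integral>\<^sup>+x. ennreal ((cmod (r x))\<^sup>2) * indicator (A n) x \<partial>lborel)
        + (\<integral>\<^sup>+x. ennreal ((cmod (r x))\<^sup>2) * indicator (A' n) x \<partial>lborel)"
      by (rule nn_integral_add) (auto simp: A_def A'_def)
    also have "\<dots> \<le> ennreal K + ennreal K"
    proof (intro add_mono)
      have "0 < 1 / real (Suc n)" by simp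
      then have "0 \<notin> {1 / real (Suc n)..real (Suc n)}" "0 \<notin> {- real (Suc n)..- (1 / real (Suc n))}" by auto
      then show "(\<integral>\<^sup>+x. ennreal ((cmod (r x))\<^sup>2) * indicator (A n) x \<partial>lborel) \<le> ennreal K"
        "(\<integral>\<^sup>+x. ennreal ((cmod (r x))\<^sup>2) * indicator (A' n) x \<partial>lborel) \<le> ennreal K"
        unfolding r_def K_def A_def A'_def using inv[of n]
        by (intro local_energy_bound[OF mu f e B]; simp)+
    qed
    finally show ?thesis by (simp add: mult_2)
  qed
  have "r \<in> L2"
  proof -
    have inc: "incseq (\<lambda>n x. ennreal ((cmod (r x))\<^sup>2) * indicator (A n \<union> A' n) x)"
    proof (intro incseq_SucI le_funI mult_left_mono)
      fix n x
      have "1 / real (Suc (Suc n)) \<le> 1 / real (Suc n)" by (simp add: frac_le)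
      then have "A n \<union> A' n \<subseteq> A (Suc n) \<union> A' (Suc n)"
        unfolding A_def A'_def by (intro Un_mono) (auto simp del: of_nat_Suc intro: order_trans)
      then show "(indicator (A n \<union> A' n) x :: ennreal) \<le> indicator (A (Suc n) \<union> A' (Suc n)) x"
        by (auto simp: indicator_def)
    qed simp
    \<comment> \<open>The sets never contain 0, but there r vanishes by the convention for division
      by zero, so the supremum is right at every point.\<close>
    have sup: "(SUP n. ennreal ((cmod (r x))\<^sup>2) * indicator (A n \<union> A' n) x) = ennreal ((cmod (r x))\<^sup>2)" for x
    proof (cases "x = 0")
      case True
      then show ?thesis by (simp add: r_def)
    next
      case False
      obtain N1 where "\<bar>x\<bar> \<le> real N1" using real_arch_simple by blast
      moreover obtain N2 where N2: "1 / \<bar>x\<bar> \<le> real N2" using real_arch_simple by blast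
      define N where "N = max N1 N2"
      have "1 / \<bar>x\<bar> \<le> real (Suc N)" using N2 by (simp add: N_def)
      then have "1 / real (Suc N) \<le> \<bar>x\<bar>" using False by (simp add: field_simps)
      moreover have "\<bar>x\<bar> \<le> real (Suc N)" using \<open>\<bar>x\<bar> \<le> real N1\<close> by (simp add: N_def)
      ultimately have N: "x \<in> A N \<union> A' N" by (auto simp: A_def A'_def abs_if split: if_splits)
      show ?thesis
      proof (rule antisym)
        show "(SUP n. ennreal ((cmod (r x))\<^sup>2) * indicator (A n \<union> A' n) x) \<le> ennreal ((cmod (r x))\<^sup>2)"
          by (rule SUP_least) (auto simp: indicator_def)
        have "ennreal ((cmod (r x))\<^sup>2) = ennreal ((cmod (r x))\<^sup>2) * indicator (A N \<union> A' N) x"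
          using N by simp
        also have "\<dots> \<le> (SUP n. ennreal ((cmod (r x))\<^sup>2) * indicator (A n \<union> A' n) x)"
          by (rule SUP_upper) simp
        finally show "ennreal ((cmod (r x))\<^sup>2) \<le> (SUP n. ennreal ((cmod (r x))\<^sup>2) * indicator (A n \<union> A' n) x)" .
      qed
    qed
    have "(\<integral>\<^sup>+x. ennreal ((cmod (r x))\<^sup>2) \<partial>lborel)
        = (\<integral>\<^sup>+x. (SUP n. ennreal ((cmod (r x))\<^sup>2) * indicator (A n \<union> A' n) x) \<partial>lborel)"
      by (simp only: sup)
    also have "\<dots> = (SUP n. \<integral>\<^sup>+x. ennreal ((cmod (r x))\<^sup>2) * indicator (A n \<union> A' n) x \<partial>lborel)"
      by (rule nn_integral_monotone_convergence_SUP[OF inc]) (auto simp: A_def A'_def)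
    also have "\<dots> \<le> 2 * ennreal K" by (rule SUP_least) (rule bd)
    also have "\<dots> < \<infinity>" by (simp add: ennreal_mult_less_top)
    finally have "integrable lborel (\<lambda>x. (cmod (r x))\<^sup>2)" by (intro integrableI_nonneg) auto
    then show ?thesis by (simp add: L2_def)
  qed
  then have r: "(\<lambda>x. v x / of_real (wt x)) \<in> L2" by (simp add: r_def[abs_def])
  show thesis
    using that Dom_L_I(1,2)[OF cv v0 r f e] by blast
qed

section \<open>Uniqueness, trivial kernel, and surjectivity off the imaginary axis\<close>

lemma zero_L2: "(\<lambda>_. 0) \<in> L2"
  by (simp add: L2_def)

lemma zero_H1_tilde: "(\<lambda>_. 0) \<in> H1_tilde"
  by (rule H1_tilde_piecewise[OF _ _ zero_L2 zero_L2]) auto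

lemma resolvent_eq_diff:
  assumes "resolvent_eq \<mu> u f" "resolvent_eq \<mu> v f"
  shows "resolvent_eq \<mu> (\<lambda>x. u x + (- 1) * v x) (\<lambda>_. 0)"
  unfolding resolvent_eq_def
proof (intro allI impI)
  fix x :: real assume x: "x \<noteq> 0"
  have "((\<lambda>x. u x - v x) has_vector_derivative
     (f x + \<mu> * u x - of_real (kap x) * u x) / of_real (wt x)
     - (f x + \<mu> * v x - of_real (kap x) * v x) / of_real (wt x)) (at x)"
    using assms x unfolding resolvent_eq_def by (intro has_vector_derivative_diff) auto
  then show "((\<lambda>x. u x + (- 1) * v x) has_vector_derivative
     (0 + \<mu> * (u x + (- 1) * v x) - of_real (kap x) * (u x + (- 1) * v x)) / of_real (wt x)) (at x)"
    by (simp add: diff_divide_distrib[symmetric] algebra_simps)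
qed

text \<open>With zero right-hand side the bound on sup M is 0. This works for every \<mu>, including
  the imaginary axis, where the integral estimate gives no information about
  \<open>v\<close>.\<close>

lemma resolvent_eq_zero:
  assumes v: "v \<in> H1_tilde" and e: "resolvent_eq \<mu> v (\<lambda>_. 0)"
  shows "v = (\<lambda>_. 0)"
proof
  fix x
  have "(cmod (v x))\<^sup>2 / wt x \<le> 0"
    using energy_estimates(2)[OF v zero_H1_tilde e, of x] by simp
  moreover have "wt x > 0" if "x \<noteq> 0" using that by simp
  ultimately show "v x = 0"
    using H1_tilde_weak_deriv(2)[OF v] by (cases "x = 0") (auto simp: divide_le_eq simp del: wt_pos)
qed

lemma inj_on_shifted: "inj_on (shifted L_op \<mu>) Dom_L"
proof (rule inj_onI)
  fix u v assume uv: "u \<in> Dom_L" "v \<in> Dom_L" and eq: "shifted L_op \<mu> u = shifted L_op \<mu> v"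
  have "resolvent_eq \<mu> (\<lambda>x. u x + (- 1) * v x) (\<lambda>_. 0)"
    by (rule resolvent_eq_diff[OF Dom_L_D(3)[OF uv(1), of \<mu>, unfolded eq] Dom_L_D(3)[OF uv(2)]])
  moreover have "(\<lambda>x. u x + (- 1) * v x) \<in> H1_tilde"
    by (intro H1_tilde_add H1_tilde_cmult Dom_L_D(1) uv)
  ultimately have "(\<lambda>x. u x + (- 1) * v x) = (\<lambda>_. 0)" by (rule resolvent_eq_zero[rotated])
  then show "u = v" by (simp add: fun_eq_iff)
qed

lemma kernel_trivial: "kernel_on Dom_L (shifted L_op \<mu>) = {\<lambda>_. 0}"
proof -
  have "resolvent_eq \<mu> (\<lambda>_. 0) (\<lambda>_. 0)" by (simp add: resolvent_eq_def)
  then have z: "(\<lambda>_. 0) \<in> Dom_L" "shifted L_op \<mu> (\<lambda>_. 0) = (\<lambda>_. 0)"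
    using Dom_L_I[OF _ _ _ zero_H1_tilde, of "\<lambda>_. 0" \<mu>] zero_L2 by auto
  moreover have "v = (\<lambda>_. 0)" if "v \<in> Dom_L" "shifted L_op \<mu> v = (\<lambda>_. 0)" for v
    using inj_onD[OF inj_on_shifted[of \<mu>] _ that(1) z(1)] that(2) z(2) by simp
  ultimately show ?thesis unfolding kernel_on_def by blast
qed

lemma shifted_image_subset: "shifted L_op \<mu> ` Dom_L \<subseteq> H1_tilde"
  using Dom_L_D(2) by auto

lemma shifted_image_eq:
  assumes "Re \<mu> \<noteq> 0"
  shows "shifted L_op \<mu> ` Dom_L = H1_tilde"
  using shifted_image_subset resolvent_solution[OF assms] by blast

subsection \<open>The range on the imaginary axis is dense\<close>

lemma H1_norm_le:
  assumes "AE x in lborel. weak_deriv v x = g x"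
    and "integrable lborel P" "\<And>x. (cmod (v x))\<^sup>2 \<le> P x" "integrable lborel Q" "\<And>x. (cmod (g x))\<^sup>2 \<le> Q x"
  shows "H1_norm v \<le> sqrt ((LINT x|lborel. P x) + (LINT x|lborel. Q x))"
proof -
  have "(LINT x|lborel. (cmod (v x))\<^sup>2) \<le> (LINT x|lborel. P x)"
    using order_trans[OF zero_le_power2 assms(3)] by (intro integral_mono' assms(2,3))
  moreover have "(LINT x|lborel. (cmod (weak_deriv v x))\<^sup>2) \<le> (LINT x|lborel. Q x)"
  proof (rule integral_mono_AE')
    show "AE x in lborel. (cmod (weak_deriv v x))\<^sup>2 \<le> Q x"
      using assms(1) by eventually_elim (use assms(5) in simp)
    show "AE x in lborel. 0 \<le> Q x"
      using assms(5) by (intro always_eventually allI) (meson order_trans zero_le_power2)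
  qed (rule assms(4))
  ultimately show ?thesis by (simp add: H1_norm_def)
qed

lemma H1_norm_zero: "H1_norm (\<lambda>_. 0) = 0"
proof -
  have "AE x in lborel. weak_deriv (\<lambda>_. 0) x = 0"
    by (rule weak_deriv_AE[OF _ zero_L2 is_weak_derivative_piecewise[OF _ zero_L2]]) auto
  from H1_norm_le[OF this, of "\<lambda>_. 0" "\<lambda>_. 0"] have "H1_norm (\<lambda>_. 0) \<le> 0" by simp
  moreover have "H1_norm (\<lambda>_. 0) \<ge> 0" by (simp add: H1_norm_def)
  ultimately show ?thesis by simp
qed

text \<open>With \<open>p = \<epsilon> |r|\<close> the energy identity gives \<open>\<integral> p\<^sup>2 \<le> \<integral> |F| p\<close>. Since \<open>|F| p \<le> |F| min p (2|F|) + p\<^sup>2 / 2\<close>,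
  half of the left-hand side absorbs the last term, and the remaining integrand is dominated by \<open>2|F|\<^sup>2\<close>.\<close>

lemma regularised_solutions_vanish:
  assumes f: "f \<in> H1_tilde" and mu: "Re \<mu> = 0"
    and v: "\<And>n. v n \<in> H1_tilde" "\<And>n. resolvent_eq (\<mu> + of_real (1 / real (Suc n))) (v n) f"
  shows "(\<lambda>n. LINT x|lborel. (1 / real (Suc n) * cmod (v n x / of_real (wt x)))\<^sup>2) \<longlonglongrightarrow> 0"
proof -
  define \<epsilon> where "\<epsilon> n = 1 / real (Suc n)" for n
  define r where "r n x = v n x / of_real (wt x)" for n x
  define F where "F x = f x / of_real (wt x)" for x
  define p where "p n x = \<epsilon> n * cmod (r n x)" for n x
  have e0: "\<epsilon> n > 0" for n by (simp add: \<epsilon>_def)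
  have r: "r n \<in> L2" and F: "F \<in> L2" for n
    unfolding r_def[abs_def] F_def[abs_def] by (intro H1_tilde_Hardy v f)+
  note [measurable] = L2_D(1)[OF r] L2_D(1)[OF F]
  have pm [measurable]: "p n \<in> borel_measurable borel" for n unfolding p_def[abs_def] by measurable
  have p0: "p n x \<ge> 0" for n x using e0[of n] by (simp add: p_def)
  have ip: "integrable lborel (\<lambda>x. (p n x)\<^sup>2)" for n
    unfolding p_def power_mult_distrib using L2_D(2)[OF r] by auto
  have iFp: "integrable lborel (\<lambda>x. cmod (F x) * p n x)" for n
    using integrable_mult_right[OF L2_product_integrable[OF F r], of "\<epsilon> n" n] by (simp add: p_def mult_ac)
  have iF: "integrable lborel (\<lambda>x. (cmod (F x))\<^sup>2)" by (rule L2_D(2)[OF F])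
  define X where "X n = (LINT x|lborel. (p n x)\<^sup>2)" for n
  define Y where "Y n = (LINT x|lborel. cmod (F x) * p n x)" for n
  define A where "A = (LINT x|lborel. (cmod (F x))\<^sup>2)"
  have A0: "A \<ge> 0" by (simp add: A_def)
  have Yr: "Y n = \<epsilon> n * (LINT x|lborel. cmod (F x) * cmod (r n x))" for n
  proof -
    have "Y n = (LINT x|lborel. \<epsilon> n * (cmod (F x) * cmod (r n x)))"
      unfolding Y_def p_def by (intro Bochner_Integration.integral_cong) auto
    then show ?thesis by simp
  qed
  have XY: "X n \<le> Y n" for n
  proof -
    have "Re (\<mu> + of_real (1 / real (Suc n))) = \<epsilon> n" using mu by (simp add: \<epsilon>_def)
    then have "\<epsilon> n * (LINT x|lborel. (cmod (r n x))\<^sup>2) \<le> (LINT x|lborel. cmod (F x) * cmod (r n x))"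
      using energy_estimates(1)[OF v(1) f v(2), of n] e0[of n] unfolding r_def F_def by simp
    then have "\<epsilon> n * (\<epsilon> n * (LINT x|lborel. (cmod (r n x))\<^sup>2)) \<le> Y n"
      unfolding Yr using e0[of n] by (intro mult_left_mono) auto
    moreover have "X n = \<epsilon> n * (\<epsilon> n * (LINT x|lborel. (cmod (r n x))\<^sup>2))"
      unfolding X_def p_def power_mult_distrib by (simp add: power2_eq_square[of "\<epsilon> n"])
    ultimately show ?thesis by simp
  qed
  \<comment> \<open>Young's inequality and X \<le> Y give Y \<le> (A + Y) / 2, a bound uniform in
    n.\<close>
  have YA: "Y n \<le> A" for n
  proof -
    have "Y n \<le> (LINT x|lborel. ((cmod (F x))\<^sup>2 + (p n x)\<^sup>2) / 2)"
      unfolding Y_def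
    proof (rule integral_mono[OF iFp])
      show "integrable lborel (\<lambda>x. ((cmod (F x))\<^sup>2 + (p n x)\<^sup>2) / 2)" using iF ip[of n] by auto
      show "cmod (F x) * p n x \<le> ((cmod (F x))\<^sup>2 + (p n x)\<^sup>2) / 2" for x
        using sum_squares_bound[of "cmod (F x)" "p n x"] by simp
    qed
    also have "\<dots> = (A + X n) / 2" unfolding A_def X_def using iF ip[of n] by simp
    finally show ?thesis using XY[of n] by simp
  qed
  \<comment> \<open>Multiplying the bound on M by eps^2 leaves one spare factor eps in front of Y
    \<le> A, so p decays like sqrt eps at each fixed point, though not uniformly near 0.\<close>
  have pl: "(\<lambda>n. p n x) \<longlonglongrightarrow> 0" for x
  proof (cases "x = 0")
    case True
    then show ?thesis by (simp add: p_def r_def)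
  next
    case False
    then have w: "wt x > 0" by simp
    have b: "(p n x)\<^sup>2 \<le> \<epsilon> n * (4 * A / wt x)" for n
    proof -
      have "(cmod (v n x))\<^sup>2 / wt x \<le> 4 * (LINT x|lborel. cmod (F x) * cmod (r n x))"
        unfolding F_def r_def by (rule energy_estimates(2)[OF v(1) f v(2)])
      then have "\<epsilon> n * (\<epsilon> n * ((cmod (v n x))\<^sup>2 / wt x)) \<le> \<epsilon> n * (\<epsilon> n * (4 * (LINT x|lborel. cmod (F x) * cmod (r n x))))"
        using e0[of n] by (intro mult_left_mono) auto
      also have "\<dots> = \<epsilon> n * (4 * Y n)" by (simp add: Yr)
      also have "\<dots> \<le> \<epsilon> n * (4 * A)" using e0[of n] YA[of n] by (intro mult_left_mono) auto
      finally have "\<epsilon> n * (\<epsilon> n * ((cmod (v n x))\<^sup>2 / wt x)) / wt x \<le> \<epsilon> n * (4 * A) / wt x"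
        using w by (intro divide_right_mono) auto
      then show ?thesis
        by (simp add: p_def r_def norm_divide power_mult_distrib power_divide power2_eq_square mult_ac)
    qed
    have "\<epsilon> \<longlonglongrightarrow> 0" unfolding \<epsilon>_def[abs_def] using lim_1_over_n LIMSEQ_Suc by blast
    then have "(\<lambda>n. \<epsilon> n * (4 * A / wt x)) \<longlonglongrightarrow> 0" by (rule tendsto_mult_left_zero)
    then have "(\<lambda>n. sqrt (\<epsilon> n * (4 * A / wt x))) \<longlonglongrightarrow> 0" using tendsto_real_sqrt by fastforce
    then show ?thesis
    proof (rule Lim_null_comparison[rotated], intro always_eventually allI)
      show "norm (p n x) \<le> sqrt (\<epsilon> n * (4 * A / wt x))" for n
        using b[of n] p0[of n x] by (simp add: real_le_rsqrt)
    qed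
  qed
  define q where "q n x = cmod (F x) * min (p n x) (2 * cmod (F x))" for n x
  have q_bd: "0 \<le> q n x" "q n x \<le> 2 * (cmod (F x))\<^sup>2" for n x
  proof -
    show "0 \<le> q n x" using p0[of n x] by (simp add: q_def)
    have "cmod (F x) * min (p n x) (2 * cmod (F x)) \<le> cmod (F x) * (2 * cmod (F x))"
      by (intro mult_left_mono) auto
    then show "q n x \<le> 2 * (cmod (F x))\<^sup>2" by (simp add: q_def power2_eq_square)
  qed
  have iq: "integrable lborel (q n)" for n
  proof (rule Bochner_Integration.integrable_bound)
    show "integrable lborel (\<lambda>x. 2 * (cmod (F x))\<^sup>2)" using iF by simp
    show "q n \<in> borel_measurable lborel" unfolding q_def[abs_def] by measurable
    show "AE x in lborel. norm (q n x) \<le> norm (2 * (cmod (F x))\<^sup>2)" using q_bd[of n] by auto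
  qed
  have Q: "(\<lambda>n. LINT x|lborel. q n x) \<longlonglongrightarrow> (LINT x|(lborel::real measure). (0::real))"
  proof (rule integral_dominated_convergence[where w="\<lambda>x. 2 * (cmod (F x))\<^sup>2"])
    show "integrable lborel (\<lambda>x. 2 * (cmod (F x))\<^sup>2)" using iF by simp
    show "q n \<in> borel_measurable lborel" for n using iq[of n] by auto
    show "AE x in lborel. (\<lambda>n. q n x) \<longlonglongrightarrow> 0"
    proof (intro always_eventually allI)
      fix x
      have "(\<lambda>n. cmod (F x) * min (p n x) (2 * cmod (F x))) \<longlonglongrightarrow> cmod (F x) * min 0 (2 * cmod (F x))"
        by (intro tendsto_intros pl)
      then show "(\<lambda>n. q n x) \<longlonglongrightarrow> 0" by (simp add: q_def)
    qed
    show "AE x in lborel. norm (q n x) \<le> 2 * (cmod (F x))\<^sup>2" for n using q_bd[of n] by auto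
  qed simp
  have XQ: "X n \<le> 2 * (LINT x|lborel. q n x)" for n
  proof -
    have "Y n \<le> (LINT x|lborel. q n x + (p n x)\<^sup>2 / 2)"
      unfolding Y_def
    proof (rule integral_mono[OF iFp])
      show "integrable lborel (\<lambda>x. q n x + (p n x)\<^sup>2 / 2)" using iq[of n] ip[of n] by auto
      show "cmod (F x) * p n x \<le> q n x + (p n x)\<^sup>2 / 2" for x
      proof (cases "p n x \<le> 2 * cmod (F x)")
        case False
        then have "cmod (F x) * p n x \<le> (p n x / 2) * p n x" using p0[of n x] by (intro mult_right_mono) auto
        then show ?thesis using q_bd(1)[of n x] by (simp add: power2_eq_square)
      qed (simp add: q_def)
    qed
    also have "\<dots> = (LINT x|lborel. q n x) + X n / 2" unfolding X_def using iq[of n] ip[of n] by simp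
    finally show ?thesis using XY[of n] by simp
  qed
  have "X \<longlonglongrightarrow> 0"
  proof (rule Lim_null_comparison[of _ "\<lambda>n. 2 * (LINT x|lborel. q n x)"])
    have "X n \<ge> 0" for n by (simp add: X_def)
    then show "eventually (\<lambda>n. norm (X n) \<le> 2 * (LINT x|lborel. q n x)) sequentially"
      using XQ by (intro always_eventually) simp
    show "(\<lambda>n. 2 * (LINT x|lborel. q n x)) \<longlonglongrightarrow> 0" using tendsto_mult_right_zero[of "\<lambda>n. LINT x|lborel. q n x"] Q by simp
  qed
  then show ?thesis unfolding X_def[abs_def] p_def r_def \<epsilon>_def .
qed

text \<open>If v solves the equation with \<mu> + eps, then f minus (L - \<mu>) v equals -eps v. Its
  derivative is -eps (F + (\<mu> + eps - \<open>kap\<close>) r), so the whole \<open>H1_norm\<close>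
  is controlled by eps F and eps r in \<open>L2\<close>, and no separate estimate of derivatives is
  needed.\<close>

lemma range_dense_imaginary_axis:
  assumes f: "f \<in> H1_tilde" and mu: "Re \<mu> = 0" and e: "e > 0"
  shows "\<exists>s\<in>shifted L_op \<mu> ` Dom_L. H1_norm (\<lambda>x. f x - s x) < e"
proof -
  define \<epsilon> where "\<epsilon> n = 1 / real (Suc n)" for n
  have e0: "\<epsilon> n > 0" "\<epsilon> n \<le> 1" for n by (simp_all add: \<epsilon>_def)
  define m where "m n = \<mu> + of_real (\<epsilon> n)" for n
  have "\<exists>v. v \<in> Dom_L \<and> shifted L_op (m n) v = f" for n
  proof -
    have "Re (m n) \<noteq> 0" using mu e0[of n] by (simp add: m_def)
    from resolvent_solution[OF this f] show ?thesis by metis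
  qed
  then obtain v where v: "\<And>n. v n \<in> Dom_L" "\<And>n. shifted L_op (m n) (v n) = f" by metis
  have vH: "v n \<in> H1_tilde" for n by (rule Dom_L_D(1)[OF v(1)])
  have vR: "resolvent_eq (m n) (v n) f" for n using Dom_L_D(3)[OF v(1), of "m n" n] v(2) by simp
  note V = H1_tilde_weak_deriv[OF vH]
  define r where "r n x = v n x / of_real (wt x)" for n x
  define F where "F x = f x / of_real (wt x)" for x
  have r: "r n \<in> L2" and F: "F \<in> L2" for n
    unfolding r_def[abs_def] F_def[abs_def] by (intro H1_tilde_Hardy vH f)+
  define X where "X n = (LINT x|lborel. (\<epsilon> n * cmod (r n x))\<^sup>2)" for n
  have X: "X \<longlonglongrightarrow> 0"
    unfolding X_def[abs_def] r_def \<epsilon>_def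
    by (rule regularised_solutions_vanish[OF f mu vH]) (use vR in \<open>simp add: m_def \<epsilon>_def\<close>)
  define A where "A = (LINT x|lborel. (cmod (F x))\<^sup>2)"
  \<comment> \<open>Bounds the multiplier \<mu> + eps - \<open>kap\<close>, since eps and
    |\<open>kap\<close>| are at most 1.\<close>
  define C where "C = cmod \<mu> + 2"
  have ip: "integrable lborel (\<lambda>x. (\<epsilon> n * cmod (r n x))\<^sup>2)" for n
    unfolding power_mult_distrib using L2_D(2)[OF r] by auto
  have iF: "integrable lborel (\<lambda>x. (cmod (F x))\<^sup>2)" by (rule L2_D(2)[OF F])
  have bound: "H1_norm (\<lambda>x. f x - shifted L_op \<mu> (v n) x) \<le> sqrt (X n + (2 * (\<epsilon> n)\<^sup>2 * A + 2 * C\<^sup>2 * X n))" for n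
  proof -
    have rL2: "(\<lambda>x. v n x / complex_of_real (wt x)) \<in> L2" using r by (simp add: r_def[abs_def])
    note wd = Dom_L_I(3)[OF V(1,2) rL2 f vR]
    let ?g = "\<lambda>x. (f x + m n * v n x - of_real (kap x) * v n x) / of_real (wt x)"
    have d: "(\<lambda>x. f x - shifted L_op \<mu> (v n) x) = (\<lambda>x. - of_real (\<epsilon> n) * v n x)"
      unfolding v(2)[of n, symmetric] by (simp add: shifted_def m_def algebra_simps)
    have "AE x in lborel. weak_deriv (\<lambda>x. - of_real (\<epsilon> n) * v n x) x = - of_real (\<epsilon> n) * weak_deriv (v n) x"
      by (rule weak_deriv_AE[OF _ L2_cmult[OF V(4)] is_weak_derivative_cmult[OF V(5)]])
        (intro continuous_intros V(1))
    then have ae: "AE x in lborel. weak_deriv (\<lambda>x. - of_real (\<epsilon> n) * v n x) x = - of_real (\<epsilon> n) * ?g x"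
      using wd by eventually_elim simp
    have b1: "(cmod (- of_real (\<epsilon> n) * v n x))\<^sup>2 \<le> (\<epsilon> n * cmod (r n x))\<^sup>2" for x
    proof -
      have "cmod (v n x) = wt x * cmod (r n x)" using V(2)[of n] by (simp add: r_def norm_divide)
      also have "\<dots> \<le> cmod (r n x)" using wt_le_1[of x] by (intro mult_left_le_one_le) auto
      finally have "\<epsilon> n * cmod (v n x) \<le> \<epsilon> n * cmod (r n x)" using e0[of n] by (intro mult_left_mono) auto
      then show ?thesis using e0[of n] by (intro power_mono) (auto simp: norm_mult)
    qed
    have b2: "(cmod (- of_real (\<epsilon> n) * ?g x))\<^sup>2 \<le> 2 * (\<epsilon> n)\<^sup>2 * (cmod (F x))\<^sup>2 + 2 * C\<^sup>2 * (\<epsilon> n * cmod (r n x))\<^sup>2" for x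
    proof -
      have g: "?g x = F x + (m n - of_real (kap x)) * r n x"
        by (simp add: F_def r_def add_divide_distrib diff_divide_distrib left_diff_distrib)
      have "cmod (m n - of_real (kap x)) \<le> cmod \<mu> + cmod (of_real (\<epsilon> n)) + cmod (of_real (kap x))"
        unfolding m_def by (meson norm_triangle_ineq4 norm_triangle_ineq order_trans add_right_mono)
      also have "\<dots> \<le> C" using e0[of n] abs_kap_le[of x] by (simp add: C_def)
      finally have c: "cmod (m n - of_real (kap x)) \<le> C" .
      have "cmod (?g x) \<le> cmod (F x) + cmod ((m n - of_real (kap x)) * r n x)"
        unfolding g by (rule norm_triangle_ineq)
      also have "\<dots> \<le> cmod (F x) + C * cmod (r n x)"
        using mult_right_mono[OF c, of "cmod (r n x)"] by (simp add: norm_mult)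
      finally have "\<epsilon> n * cmod (?g x) \<le> \<epsilon> n * (cmod (F x) + C * cmod (r n x))"
        using e0[of n] by (intro mult_left_mono) auto
      then have "(\<epsilon> n * cmod (?g x))\<^sup>2 \<le> (\<epsilon> n * cmod (F x) + C * (\<epsilon> n * cmod (r n x)))\<^sup>2"
        using e0[of n] by (intro power_mono) (auto simp: algebra_simps)
      also have "\<dots> \<le> 2 * (\<epsilon> n * cmod (F x))\<^sup>2 + 2 * (C * (\<epsilon> n * cmod (r n x)))\<^sup>2"
        using sum_squares_bound[of "\<epsilon> n * cmod (F x)" "C * (\<epsilon> n * cmod (r n x))"] by (simp add: power2_sum)
      also have "\<dots> = 2 * (\<epsilon> n)\<^sup>2 * (cmod (F x))\<^sup>2 + 2 * C\<^sup>2 * (\<epsilon> n * cmod (r n x))\<^sup>2"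
        by (simp add: power_mult_distrib)
      also have "\<epsilon> n * cmod (?g x) = cmod (- of_real (\<epsilon> n) * ?g x)"
        by (simp only: norm_mult norm_minus_cancel norm_of_real abs_of_pos[OF e0(1)])
      finally show ?thesis .
    qed
    have "H1_norm (\<lambda>x. - of_real (\<epsilon> n) * v n x) \<le> sqrt ((LINT x|lborel. (\<epsilon> n * cmod (r n x))\<^sup>2)
       + (LINT x|lborel. 2 * (\<epsilon> n)\<^sup>2 * (cmod (F x))\<^sup>2 + 2 * C\<^sup>2 * (\<epsilon> n * cmod (r n x))\<^sup>2))"
      using iF ip[of n] by (intro H1_norm_le[OF ae] b1 b2) auto
    also have "(LINT x|lborel. 2 * (\<epsilon> n)\<^sup>2 * (cmod (F x))\<^sup>2 + 2 * C\<^sup>2 * (\<epsilon> n * cmod (r n x))\<^sup>2)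
        = 2 * (\<epsilon> n)\<^sup>2 * A + 2 * C\<^sup>2 * X n"
      unfolding A_def X_def using iF ip[of n] by simp
    finally show ?thesis unfolding d X_def .
  qed
  have "\<epsilon> \<longlonglongrightarrow> 0" unfolding \<epsilon>_def[abs_def] using lim_1_over_n LIMSEQ_Suc by blast
  then have "(\<lambda>n. sqrt (X n + (2 * (\<epsilon> n)\<^sup>2 * A + 2 * C\<^sup>2 * X n))) \<longlonglongrightarrow> sqrt (0 + (2 * 0\<^sup>2 * A + 2 * C\<^sup>2 * 0))"
    by (intro tendsto_intros X)
  then have "(\<lambda>n. sqrt (X n + (2 * (\<epsilon> n)\<^sup>2 * A + 2 * C\<^sup>2 * X n))) \<longlonglongrightarrow> 0" by simp
  then have "eventually (\<lambda>n. sqrt (X n + (2 * (\<epsilon> n)\<^sup>2 * A + 2 * C\<^sup>2 * X n)) < e) sequentially"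
    using e order_tendstoD(2) by blast
  then obtain n where "sqrt (X n + (2 * (\<epsilon> n)\<^sup>2 * A + 2 * C\<^sup>2 * X n)) < e"
    by (meson eventually_sequentially order_refl)
  with bound[of n] have "H1_norm (\<lambda>x. f x - shifted L_op \<mu> (v n) x) < e" by linarith
  then show ?thesis using v(1)[of n] by blast
qed

lemma closure_range: "closure_in H1_tilde H1_norm (shifted L_op \<mu> ` Dom_L) = H1_tilde"
proof -
  have "\<exists>s\<in>shifted L_op \<mu> ` Dom_L. H1_norm (\<lambda>x. f x - s x) < e" if f: "f \<in> H1_tilde" and e: "e > 0" for f e
  proof (cases "Re \<mu> = 0")
    case True
    then show ?thesis using range_dense_imaginary_axis f e by blast
  next
    case False
    then show ?thesis using f e H1_norm_zero by (intro bexI[of _ f]) (auto simp: shifted_image_eq)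
  qed
  then show ?thesis unfolding closure_in_def by blast
qed

subsection \<open>The range on the imaginary axis is not the whole space\<close>

text \<open>The function exp (\<mu> y) carried back to the right half-line. It solves the
  homogeneous equation there, but for imaginary \<mu> it has |z|^2 / \<open>wt\<close> = 1 at
  positive points, contrary to the vanishing shared by all members of
  \<open>H1_tilde\<close>.\<close>

definition gen_eigenfunction :: "complex \<Rightarrow> real \<Rightarrow> complex" where
  "gen_eigenfunction \<mu> x = of_real (sqrt (wt x)) * exp (\<mu> * of_real (stretch x))"

lemma gen_eigenfunction_derivative:
  assumes "x > 0"
  shows "(gen_eigenfunction \<mu> has_vector_derivative
     (\<mu> - of_real (kap x)) * gen_eigenfunction \<mu> x / of_real (wt x)) (at x)"
proof -
  define s where "s = complex_of_real (sqrt (wt x))"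
  define E where "E = exp (\<mu> * of_real (stretch x))"
  have s: "s \<noteq> 0" "of_real (wt x) = s * s" using assms by (auto simp: s_def simp flip: of_real_mult)
  have de: "((\<lambda>y. exp (\<mu> * of_real y)) has_vector_derivative \<mu> * exp (\<mu> * of_real y)) (at y)" for y
    by (rule has_vector_derivative_real_field) (auto intro!: derivative_eq_intros)
  have "((\<lambda>x. exp (\<mu> * of_real (stretch x))) has_vector_derivative (1 / wt x) *\<^sub>R (\<mu> * E)) (at x)"
    using vector_diff_chain_at[of stretch "1 / wt x" x "\<lambda>y. exp (\<mu> * of_real y)", OF _ de] stretch_DERIV[OF assms]
    by (simp add: has_real_derivative_iff_has_vector_derivative o_def E_def)
  from has_vector_derivative_mult[OF has_vector_derivative_of_real[OF sqrt_wt_DERIV] this] assms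
  have "(gen_eigenfunction \<mu> has_vector_derivative s * ((1 / wt x) *\<^sub>R (\<mu> * E))
      + of_real (- kap x / sqrt (wt x)) * E) (at x)"
    unfolding gen_eigenfunction_def[abs_def] s_def E_def by simp
  also have "s * ((1 / wt x) *\<^sub>R (\<mu> * E)) + of_real (- kap x / sqrt (wt x)) * E
     = (\<mu> - of_real (kap x)) * gen_eigenfunction \<mu> x / of_real (wt x)"
  proof -
    have zx: "gen_eigenfunction \<mu> x = s * E" by (simp add: gen_eigenfunction_def s_def E_def)
    have kx: "complex_of_real (- kap x / sqrt (wt x)) = - of_real (kap x) / s" by (simp add: s_def)
    have wx: "complex_of_real (1 / wt x) = 1 / (s * s)" by (simp flip: s(2))
    show ?thesis
      unfolding scaleR_conv_of_real wx kx zx s(2) using s(1) by (simp add: field_simps)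
  qed
  finally show ?thesis .
qed

lemma cmod_gen_eigenfunction: "Re \<mu> = 0 \<Longrightarrow> cmod (gen_eigenfunction \<mu> x) = sqrt (wt x)"
  by (simp add: gen_eigenfunction_def norm_mult)

text \<open>A positive multiple of the homogeneous solution, so that dividing by it leaves a
  positive real source. The powers of \<open>wt\<close> compensate for the division by
  \<open>wt\<close> in the derivative at 0, and exp (-x) provides decay.\<close>

definition forcing :: "complex \<Rightarrow> real \<Rightarrow> complex" where
  "forcing \<mu> x = (if x > 0 then gen_eigenfunction \<mu> x * of_real ((wt x)\<^sup>2 * exp (- x)) else 0)"

lemma L2_exp_halfline:
  assumes "g \<in> borel_measurable borel" and "\<And>x. x > 0 \<Longrightarrow> cmod (g x) \<le> C * exp (- x)" and "\<And>x. x \<le> 0 \<Longrightarrow> g x = 0"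
  shows "g \<in> L2"
proof (rule L2_bound)
  have "(\<integral>\<^sup>+x. ennreal (exp (- 2 * x) * indicator {0..} x) \<partial>lborel)
      = (\<integral>\<^sup>+x. ennreal (exp (- 2 * x)) * indicator {0..} x \<partial>lborel)"
    by (intro nn_integral_cong) (auto simp: indicator_def)
  also have "\<dots> = ennreal (exp (- 2 * 0) / 2)"
    by (intro nn_integral_has_integral_lebesgue' has_integral_exp_minus_to_infinity) auto
  also have "\<dots> < \<infinity>" by (simp only: infinity_ennreal_def ennreal_less_top)
  finally have fin: "(\<integral>\<^sup>+x. ennreal (exp (- 2 * x) * indicator {0..} x) \<partial>lborel) < \<infinity>" .
  have "integrable lborel (\<lambda>x::real. exp (- 2 * x) * indicator {0..} x)"
    by (rule integrableI_nonneg[OF _ _ fin]) auto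
  then show "integrable lborel (\<lambda>x::real. C\<^sup>2 * (exp (- 2 * x) * indicator {0..} x))" by (rule integrable_mult_right)
  show "(cmod (g x))\<^sup>2 \<le> C\<^sup>2 * (exp (- 2 * x) * indicator {0..} x)" for x
  proof (cases "x > 0")
    case True
    have "(cmod (g x))\<^sup>2 \<le> (C * exp (- x))\<^sup>2" using assms(2)[OF True] by (intro power_mono) auto
    also have "\<dots> = C\<^sup>2 * exp (- 2 * x)" by (simp add: power_mult_distrib flip: exp_double)
    finally show ?thesis using True by simp
  qed (use assms(3) in auto)
qed (use assms in auto)

lemma forcing_H1_tilde:
  assumes mu: "Re \<mu> = 0"
  shows "forcing \<mu> \<in> H1_tilde"
proof -
  let ?z = "gen_eigenfunction \<mu>"
  define q where "q x = (wt x)\<^sup>2 * exp (- x)" for x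
  define q' where "q' x = - 4 * wt x * kap x * exp (- x) - (wt x)\<^sup>2 * exp (- x)" for x
  have dq: "(q has_real_derivative q' x) (at x)" if "x > 0" for x
    unfolding q_def[abs_def] q'_def
    using that by (auto intro!: derivative_eq_intros wt_DERIV simp: algebra_simps)
  define g where "g x = (if x > 0 then ?z x * of_real (q' x)
      + (\<mu> - of_real (kap x)) * ?z x * of_real (wt x * exp (- x)) else 0)" for x
  have d: "(forcing \<mu> has_vector_derivative g x) (at x)" if "x \<noteq> 0" for x
  proof (cases "x > 0")
    case True
    have "((\<lambda>x. ?z x * of_real (q x)) has_vector_derivative
        ?z x * of_real (q' x) + (\<mu> - of_real (kap x)) * ?z x / of_real (wt x) * of_real (q x)) (at x)"
      by (intro has_vector_derivative_mult gen_eigenfunction_derivative has_vector_derivative_of_real dq True)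
    moreover have "(\<mu> - of_real (kap x)) * ?z x / of_real (wt x) * of_real (q x)
        = (\<mu> - of_real (kap x)) * ?z x * of_real (wt x * exp (- x))"
      using True by (simp add: q_def power2_eq_square)
    ultimately have "((\<lambda>x. ?z x * of_real (q x)) has_vector_derivative g x) (at x)"
      using True by (simp add: g_def)
    then show ?thesis
      by (rule has_vector_derivative_transform_within_open[of _ _ _ "{0<..}"])
        (use True in \<open>auto simp: forcing_def q_def\<close>)
  next
    case False
    have "((\<lambda>_. 0) has_vector_derivative g x) (at x)" using False by (simp add: g_def)
    then show ?thesis
      by (rule has_vector_derivative_transform_within_open[of _ _ _ "{..<0}"])
        (use False that in \<open>auto simp: forcing_def\<close>)
  qed
  have z1: "cmod (?z x) \<le> 1" for x
    using cmod_gen_eigenfunction[OF mu, of x] wt_le_1[of x] by simp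
  have w2: "(wt x)\<^sup>2 \<le> 1" for x by (intro power_le_one wt_le_1) simp
  have f_le: "cmod (forcing \<mu> x) \<le> wt x * exp (- x)" if "x > 0" for x
  proof -
    have "cmod (forcing \<mu> x) = cmod (?z x) * ((wt x)\<^sup>2 * exp (- x))" using that by (simp add: forcing_def norm_mult norm_power)
    also have "\<dots> \<le> 1 * ((wt x)\<^sup>2 * exp (- x))" by (intro mult_right_mono z1) simp
    also have "\<dots> \<le> wt x * exp (- x)"
      using mult_left_le[OF wt_le_1[of x] wt_nonneg[of x]] by (simp add: power2_eq_square mult_right_mono)
    finally show ?thesis .
  qed
  have cont: "continuous_on UNIV (forcing \<mu>)"
  proof (rule continuous_onI_punctured)
    show "isCont (forcing \<mu>) x" if "x \<noteq> 0" for x using d[OF that] by (rule has_vector_derivative_continuous)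
    have "(wt \<longlongrightarrow> 0) (at 0)" using isCont_wt[of 0] by (simp add: isCont_def)
    then have "(forcing \<mu> \<longlongrightarrow> 0) (at 0)"
    proof (rule Lim_null_comparison[rotated], intro always_eventually allI)
      fix x
      show "norm (forcing \<mu> x) \<le> wt x"
      proof (cases "x > 0")
        case True
        have "wt x * exp (- x) \<le> wt x * 1" using True by (intro mult_left_mono) auto
        then show ?thesis using f_le[OF True] by simp
      qed (simp add: forcing_def)
    qed
    then show "isCont (forcing \<mu>) 0" by (simp add: isCont_def forcing_def)
  qed
  have [measurable]: "(\<lambda>y. exp (\<mu> * complex_of_real y)) \<in> borel_measurable borel"
    by (intro borel_measurable_continuous_onI continuous_intros)
  have [measurable]: "stretch \<in> borel_measurable borel" unfolding stretch_def[abs_def] by measurable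
  have [measurable]: "(\<lambda>x. exp (\<mu> * complex_of_real (stretch x))) \<in> borel_measurable borel"
    using measurable_compose[OF \<open>stretch \<in> _\<close> \<open>(\<lambda>y. exp (\<mu> * complex_of_real y)) \<in> _\<close>] .
  have [measurable]: "?z \<in> borel_measurable borel" unfolding gen_eigenfunction_def[abs_def] by measurable
  show ?thesis
  proof (rule H1_tilde_piecewise[OF cont _ _ _ d])
    show "forcing \<mu> 0 = 0" by (simp add: forcing_def)
    show "forcing \<mu> \<in> L2"
    proof (rule L2_exp_halfline[where C=1])
      show "forcing \<mu> \<in> borel_measurable borel" using cont by (rule borel_measurable_continuous_onI)
      show "cmod (forcing \<mu> x) \<le> 1 * exp (- x)" if "x > 0" for x
        using order_trans[OF f_le[OF that] mult_right_mono[OF wt_le_1]] by simp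
    qed (simp add: forcing_def)
    show "g \<in> L2"
    \<comment> \<open>5 = 4 + 1 bounds the two terms of \<open>q'\<close>, and cmod \<mu> + 1 bounds
      the factor \<mu> - \<open>kap\<close>; all remaining factors except exp (-x) are at most
      1.\<close>
    proof (rule L2_exp_halfline[where C="cmod \<mu> + 6"])
      show "g \<in> borel_measurable borel" unfolding g_def[abs_def] q'_def by measurable
      fix x :: real assume x: "x > 0"
      have "\<bar>- 4 * wt x * kap x\<bar> \<le> 4"
      proof -
        have "\<bar>wt x\<bar> * \<bar>kap x\<bar> \<le> 1 * 1" using wt_le_1[of x] abs_kap_le[of x] by (intro mult_mono) auto
        then show ?thesis by (simp add: abs_mult)
      qed
      then have "\<bar>- 4 * wt x * kap x\<bar> + \<bar>(wt x)\<^sup>2\<bar> \<le> 5" using w2[of x] by simp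
      then have "\<bar>- 4 * wt x * kap x - (wt x)\<^sup>2\<bar> \<le> 5" by (rule order_trans[OF abs_triangle_ineq4])
      moreover have "q' x = (- 4 * wt x * kap x - (wt x)\<^sup>2) * exp (- x)" by (simp add: q'_def algebra_simps)
      ultimately have q': "\<bar>q' x\<bar> \<le> 5 * exp (- x)" by (simp add: abs_mult)
      have "cmod (g x) \<le> cmod (?z x * of_real (q' x)) + cmod ((\<mu> - of_real (kap x)) * ?z x * of_real (wt x * exp (- x)))"
        using x by (simp add: g_def norm_triangle_ineq)
      also have "\<dots> = cmod (?z x) * \<bar>q' x\<bar> + cmod (\<mu> - of_real (kap x)) * (cmod (?z x) * (wt x * exp (- x)))"
        by (simp add: norm_mult abs_mult)
      also have "\<dots> \<le> 1 * (5 * exp (- x)) + (cmod \<mu> + 1) * (1 * (1 * exp (- x)))"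
      proof (intro add_mono mult_mono z1 q' wt_le_1)
        show "cmod (\<mu> - of_real (kap x)) \<le> cmod \<mu> + 1"
          using norm_triangle_ineq4[of \<mu> "of_real (kap x)"] abs_kap_le[of x] by simp
      qed auto
      also have "\<dots> = (cmod \<mu> + 6) * exp (- x)" by (simp add: algebra_simps)
      finally show "cmod (g x) \<le> (cmod \<mu> + 6) * exp (- x)" .
    qed (simp add: g_def)
  qed
qed

text \<open>Variation of constants: for a preimage v, the quotient v / z has the real derivative
  \<open>wt\<close> x exp (-x). Since |z|^2 = \<open>wt\<close> on the positive axis, the square of
  U is at most |v|^2 / \<open>wt\<close>, which forces limit 0 at the origin and at
  infinity.\<close>

lemma forcing_not_in_range:
  assumes mu: "Re \<mu> = 0"
  shows "forcing \<mu> \<notin> shifted L_op \<mu> ` Dom_L"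
proof
  assume "forcing \<mu> \<in> shifted L_op \<mu> ` Dom_L"
  then obtain v where v: "v \<in> Dom_L" "shifted L_op \<mu> v = forcing \<mu>" by auto
  have vH: "v \<in> H1_tilde" by (rule Dom_L_D(1)[OF v(1)])
  have vR: "resolvent_eq \<mu> v (forcing \<mu>)" using Dom_L_D(3)[OF v(1), of \<mu>] v(2) by simp
  define z where "z = gen_eigenfunction \<mu>"
  have z0: "z x \<noteq> 0" if "x > 0" for x using that by (simp add: z_def gen_eigenfunction_def)
  define U where "U x = Re (v x / z x)" for x
  have dU: "(U has_real_derivative wt x * exp (- x)) (at x)" if x: "x > 0" for x
  proof -
    define w where "w = complex_of_real (wt x)"
    have w: "w \<noteq> 0" using x by (simp add: w_def)
    have dv: "(v has_vector_derivative (forcing \<mu> x + \<mu> * v x - of_real (kap x) * v x) / w) (at x)"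
      using vR x by (simp add: resolvent_eq_def w_def)
    have dz: "(z has_vector_derivative (\<mu> - of_real (kap x)) * z x / w) (at x)"
      unfolding z_def w_def by (rule gen_eigenfunction_derivative[OF x])
    have "((\<lambda>x. v x / z x) has_vector_derivative
       (((forcing \<mu> x + \<mu> * v x - of_real (kap x) * v x) / w) * z x - v x * ((\<mu> - of_real (kap x)) * z x / w)) / (z x * z x)) (at x)"
      using dv dz z0[OF x] unfolding has_vector_derivative_def
      by (auto intro!: derivative_eq_intros simp: fun_eq_iff scaleR_conv_of_real field_simps)
    also have "(((forcing \<mu> x + \<mu> * v x - of_real (kap x) * v x) / w) * z x - v x * ((\<mu> - of_real (kap x)) * z x / w)) / (z x * z x)
      = forcing \<mu> x / z x / w"
      using z0[OF x] w by (simp add: field_simps)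
    also have "\<dots> = of_real (wt x * exp (- x))"
    proof -
      have "forcing \<mu> x = z x * (w * w * of_real (exp (- x)))"
        using x by (simp add: forcing_def z_def w_def power2_eq_square)
      then show ?thesis using z0[OF x] w by (simp add: w_def)
    qed
    finally show ?thesis
      using bounded_linear.has_vector_derivative[OF bounded_linear_Re]
      unfolding U_def[abs_def] has_real_derivative_iff_has_vector_derivative by fastforce
  qed
  have mono: "U a < U b" if "0 < a" "a < b" for a b
  proof (rule DERIV_pos_imp_increasing[OF that(2)])
    fix x assume "a \<le> x" "x \<le> b"
    then show "\<exists>y. (U has_real_derivative y) (at x) \<and> 0 < y"
      using dU[of x] that by (intro exI[of _ "wt x * exp (- x)"]) auto
  qed
  have U_le: "\<bar>U x\<bar> \<le> sqrt ((cmod (v x))\<^sup>2 / wt x)" for x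
  proof -
    have "\<bar>U x\<bar> \<le> cmod (v x / z x)" unfolding U_def by (rule abs_Re_le_cmod)
    also have "\<dots> = sqrt ((cmod (v x))\<^sup>2 / wt x)"
      by (simp add: norm_divide z_def cmod_gen_eigenfunction[OF mu] real_sqrt_divide)
    finally show ?thesis .
  qed
  have lim: "(\<lambda>n. U (X n)) \<longlonglongrightarrow> 0" if "(\<lambda>n. (cmod (v (X n)))\<^sup>2 / wt (X n)) \<longlonglongrightarrow> 0" for X :: "nat \<Rightarrow> real"
  proof -
    have "(\<lambda>n. sqrt ((cmod (v (X n)))\<^sup>2 / wt (X n))) \<longlonglongrightarrow> sqrt 0" using that by (rule tendsto_real_sqrt)
    then have "(\<lambda>n. sqrt ((cmod (v (X n)))\<^sup>2 / wt (X n))) \<longlonglongrightarrow> 0" by simp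
    then show ?thesis by (rule Lim_null_comparison[rotated]) (use U_le in simp)
  qed
  have l1: "(\<lambda>n. U (real n)) \<longlonglongrightarrow> 0"
    by (rule lim, rule H1_tilde_vanishing_at_infinity[OF vH]) (simp add: filterlim_real_sequentially)
  have l2: "(\<lambda>n. U (1 / real (Suc n))) \<longlonglongrightarrow> 0"
  proof (rule lim)
    have "(\<lambda>n. 1 / real (Suc n)) \<longlonglongrightarrow> 0" using lim_1_over_n LIMSEQ_Suc by blast
    from isCont_tendsto_compose[OF H1_tilde_vanishing_at_0[OF vH] this]
    show "(\<lambda>n. (cmod (v (1 / real (Suc n))))\<^sup>2 / wt (1 / real (Suc n))) \<longlonglongrightarrow> 0" by simp
  qed
  \<comment> \<open>Comparison with the limit at infinity gives U 2 \<le> 0 and with the limit at 0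
    gives 0 \<le> U 1, which contradicts U 1 < U 2.\<close>
  have "U 2 \<le> 0"
  proof (rule LIMSEQ_le_const[OF l1], intro exI allI impI)
    fix n :: nat assume "n \<ge> 3"
    then show "U 2 \<le> U (real n)" using mono[of 2 "real n"] by simp
  qed
  moreover have "0 \<le> U 1"
  proof (rule LIMSEQ_le_const2[OF l2], intro exI allI impI)
    fix n :: nat assume "n \<ge> 1"
    then show "U (1 / real (Suc n)) \<le> U 1" using mono[of "1 / real (Suc n)" 1] by simp
  qed
  ultimately show False using mono[of 1 2] by simp
qed

theorem theorem5p1:
  shows "spectrum H1_tilde Dom_L L_op = {\<mu>. Re \<mu> = 0} \<and>
         point_spectrum Dom_L L_op = {} \<and>
         residual_spectrum H1_tilde H1_norm Dom_L L_op = {} \<and>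
         continuous_spectrum H1_tilde H1_norm Dom_L L_op = {\<mu>. Re \<mu> = 0}"
proof -
  \<comment> \<open>For every \<mu> the kernel is trivial and the range is dense, so surjectivity
    alone decides the type of each spectral value.\<close>
  have range: "shifted L_op \<mu> ` Dom_L = H1_tilde \<longleftrightarrow> Re \<mu> \<noteq> 0" for \<mu>
    using shifted_image_eq forcing_not_in_range forcing_H1_tilde by metis
  then have "bij_betw (shifted L_op \<mu>) Dom_L H1_tilde \<longleftrightarrow> Re \<mu> \<noteq> 0" for \<mu>
    unfolding bij_betw_def using inj_on_shifted by simp
  then show ?thesis
    unfolding spectrum_def point_spectrum_def residual_spectrum_def continuous_spectrum_def
    using range by (simp add: kernel_trivial closure_range)
qed

end
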